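(* Let $\mathscr{M}$ be an $n$-dimensional smooth manifold and let $X(\cdot,t):\mathscr{M}\to\mathbb{R}^{n+1}$ be a family of smooth hypersurface immersions satisfying the hyperbolic mean curvature flow $$\frac{\partial^2}{\partial t^2}X(x,t)=H(x,t)\vec n(x,t)+c_1(t)X(x,t),\qquad X(x,0)=X_0(x),\qquad \frac{\partial X}{\partial t}(x,0)=X_1(x),$$ where $c_1(t)$ is a bounded continuous function, $X_0$ is a smooth hypersurface immersion of $\mathscr{M}$ into $\mathbb{R}^{n+1}$ and $X_1$ is a smooth vector-valued function on $\mathscr{M}$. Then $$\begin{aligned}\frac{\partial^2H}{\partial t^2}=&\ \triangle H+H|A|^2-2g^{ik}g^{jl}h_{ij}\left(\frac{\partial^2X}{\partial t\partial x^k},\frac{\partial^2X}{\partial t\partial x^l}\right)+Hg^{kl}\left(\vec n,\frac{\partial^2X}{\partial t\partial x^k}\right)\left(\vec n,\frac{\partial^2X}{\partial t\partial x^l}\right)\\&-2g^{ij}\frac{\partial\Gamma_{ij}^k}{\partial t}\left(\vec n,\frac{\partial^2X}{\partial t\partial x^k}\right)+2g^{ik}g^{jp}g^{lq}h_{ij}\frac{\partial g_{pq}}{\partial t}\frac{\partial g_{kl}}{\partial t}-2g^{ik}g^{jl}\frac{\partial g_{kl}}{\partial t}\frac{\partial h_{ij}}{\partial t}-c_1(t)H,\end{aligned}$$ and $$\begin{aligned}\frac{\partial^2}{\partial t^2}|A|^2=&\ \triangle(|A|^2)-2|\nabla A|^2+2|A|^4+2|A|^2g^{pq}\left(\vec n,\frac{\partial^2X}{\partial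 t\partial x^p}\right)\left(\vec n,\frac{\partial^2X}{\partial t\partial x^q}\right)\\&+2g^{ij}g^{kl}\frac{\partial h_{ik}}{\partial t}\frac{\partial h_{jl}}{\partial t}-8g^{im}g^{jn}g^{kl}h_{jl}\frac{\partial g_{mn}}{\partial t}\frac{\partial h_{ik}}{\partial t}\\&-4g^{im}g^{jn}g^{kl}h_{ik}h_{jl}\left(\vec n,\frac{\partial^2X}{\partial t\partial x^m}\right)\left(\vec n,\frac{\partial^2X}{\partial t\partial x^n}\right)\\&+2g^{im}\frac{\partial g_{pq}}{\partial t}\frac{\partial g_{mn}}{\partial t}h_{ik}h_{jl}\left(2g^{jp}g^{nq}g^{kl}+g^{jn}g^{kp}g^{lq}\right)\\&-4g^{ij}g^{kl}h_{jl}\frac{\partial\Gamma_{ik}^p}{\partial t}\left(\vec n,\frac{\partial^2X}{\partial t\partial x^p}\right)-2c_1(t)|A|^2.\end{aligned}$$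
   Context: $(\cdot,\cdot)$ is the Euclidean inner product of $\mathbb{R}^{n+1}$; $\{x^i\}$ are local coordinates on $\mathscr{M}$ (independent of $t$), and repeated indices are summed. $\vec n$ is the unit inward normal of $X(\cdot,t)$, $g_{ij}=\left(\frac{\partial X}{\partial x^i},\frac{\partial X}{\partial x^j}\right)$ the induced metric with inverse $(g^{ij})$, $h_{ij}=\left(\vec n,\frac{\partial^2X}{\partial x^i\partial x^j}\right)$ the second fundamental form (also denoted $A$), $H=g^{ij}h_{ij}$ the mean curvature, $|A|^2=g^{ij}g^{kl}h_{ik}h_{jl}$, $|A|^4=(|A|^2)^2$, $\Gamma_{ij}^k=g^{kl}\left(\frac{\partial^2X}{\partial x^i\partial x^j},\frac{\partial X}{\partial x^l}\right)$ the Christoffel symbols, and $\nabla$, $\triangle=g^{ij}\nabla_i\nabla_j$ the Riemannian (Levi-Civita) connection and Laplacian of the induced metric; $|\nabla A|^2$ is the squared norm of the covariant derivative of the second fundamental form.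
   Formalization: In the second identity, the factor (n, X_tm)(n, X_tn) in the term −4g^{im}g^{jn}g^{kl}h_ik h_jl(…) is replaced by the inner product (∂²X/∂t∂x^m, ∂²X/∂t∂x^n); as printed the identity fails for a circle of radius r(t) with r'≠0. *)

theory Defs
  imports "HOL-Analysis.Analysis"
begin

section \<open>Partial derivatives and smoothness in coordinates\<close>

definition pd :: "'n::finite \<Rightarrow> (real ^ 'n \<Rightarrow> 'b::real_normed_vector) \<Rightarrow> real ^ 'n \<Rightarrow> 'b" where
  "pd i f u = frechet_derivative f (at u) (axis i 1)"

primrec iter_pd :: "'n::finite list \<Rightarrow> (real ^ 'n \<Rightarrow> 'b::real_normed_vector) \<Rightarrow> real ^ 'n \<Rightarrow> 'b" where
  "iter_pd [] f = f"
| "iter_pd (i # is) f = pd i (iter_pd is f)"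

text \<open>Meant for open \<open>W\<close>: all iterated partial derivatives exist and are differentiable
  (hence continuous), that is, \<open>f\<close> is of class C-infinity.\<close>

definition smooth_on :: "(real ^ 'n::finite) set \<Rightarrow> (real ^ 'n \<Rightarrow> 'b::real_normed_vector) \<Rightarrow> bool" where
  "smooth_on W f \<longleftrightarrow> (\<forall>is. iter_pd is f differentiable_on W)"

text \<open>Time derivatives are taken within the time interval \<open>I\<close>, hence one-sided at its end points.\<close>

definition dt :: "real set \<Rightarrow> (real \<Rightarrow> 'b::real_normed_vector) \<Rightarrow> real \<Rightarrow> 'b" where
  "dt I f t = vector_derivative f (at t within I)"

definition has_second_derivative ::
    "(real \<Rightarrow> 'b::real_normed_vector) \<Rightarrow> 'b \<Rightarrow> real \<Rightarrow> real set \<Rightarrow> bool" where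
  "has_second_derivative f D t I \<longleftrightarrow>
     (\<exists>f'. (\<forall>s\<in>I. (f has_vector_derivative f' s) (at s within I)) \<and>
           (f' has_vector_derivative D) (at t within I))"

text \<open>Families \<open>t \<mapsto> F t\<close> that are smooth in space and, together with all spatial derivatives,
  twice continuously differentiable in time. (Since the forcing coefficient of the flow is only
  continuous in time, more time regularity cannot be required.)\<close>

definition smooth_family_on ::
    "(real ^ 'n::finite) set \<Rightarrow> real set \<Rightarrow> (real \<Rightarrow> real ^ 'n \<Rightarrow> 'b::real_normed_vector) \<Rightarrow> bool" where
  "smooth_family_on W I F \<longleftrightarrow>
     (\<forall>t\<in>I. smooth_on W (F t)) \<and>
     (\<forall>is. \<exists>D1 D2.
        (\<forall>u\<in>W. \<forall>t\<in>I.
           ((\<lambda>s. iter_pd is (F s) u) has_vector_derivative D1 u t) (at t within I) \<and>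
           (D1 u has_vector_derivative D2 u t) (at t within I)) \<and>
        continuous_on (W \<times> I) (\<lambda>(u, t). iter_pd is (F t) u) \<and>
        continuous_on (W \<times> I) (\<lambda>(u, t). D1 u t) \<and>
        continuous_on (W \<times> I) (\<lambda>(u, t). D2 u t))"

section \<open>Smooth manifolds, smooth maps, immersions\<close>

type_synonym ('m, 'n) chart = "'m set \<times> ('m \<Rightarrow> real ^ 'n)"

definition is_chart :: "'m topology \<Rightarrow> ('m, 'n::finite) chart \<Rightarrow> bool" where
  "is_chart M = (\<lambda>(U, \<phi>). openin M U \<and> open (\<phi> ` U) \<and>
     homeomorphic_map (subtopology M U) (top_of_set (\<phi> ` U)) \<phi>)"

text \<open>The atlas is not required to be maximal: taking \<open>\<A>\<close> to be the maximal atlas, its members are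
  all the local coordinate systems of the manifold.\<close>

definition smooth_manifold :: "'m topology \<Rightarrow> ('m, 'n::finite) chart set \<Rightarrow> bool" where
  "smooth_manifold M \<A> \<longleftrightarrow>
     Hausdorff_space M \<and> second_countable M \<and>
     (\<forall>c\<in>\<A>. is_chart M c) \<and> (\<Union>(U, \<phi>)\<in>\<A>. U) = topspace M \<and>
     (\<forall>(U, \<phi>)\<in>\<A>. \<forall>(V, \<psi>)\<in>\<A>. smooth_on (\<phi> ` (U \<inter> V)) (\<lambda>u. \<psi> (inv_into U \<phi> u)))"

definition coord_rep :: "('m, 'n::finite) chart \<Rightarrow> ('m \<Rightarrow> 'b) \<Rightarrow> real ^ 'n \<Rightarrow> 'b" where
  "coord_rep = (\<lambda>(U, \<phi>) f u. f (inv_into U \<phi> u))"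

definition smooth_map :: "('m, 'n::finite) chart set \<Rightarrow> ('m \<Rightarrow> 'b::real_normed_vector) \<Rightarrow> bool" where
  "smooth_map \<A> f \<longleftrightarrow> (\<forall>(U, \<phi>)\<in>\<A>. smooth_on (\<phi> ` U) (coord_rep (U, \<phi>) f))"

definition smooth_immersion ::
    "('m, 'n::finite) chart set \<Rightarrow> ('m \<Rightarrow> 'b::real_normed_vector) \<Rightarrow> bool" where
  "smooth_immersion \<A> f \<longleftrightarrow> smooth_map \<A> f \<and>
     (\<forall>(U, \<phi>)\<in>\<A>. \<forall>u\<in>\<phi> ` U. inj (frechet_derivative (coord_rep (U, \<phi>) f) (at u)))"

definition smooth_map_family ::
    "('m, 'n::finite) chart set \<Rightarrow> real set \<Rightarrow> ('m \<Rightarrow> real \<Rightarrow> 'b::real_normed_vector) \<Rightarrow> bool" where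
  "smooth_map_family \<A> I X \<longleftrightarrow>
     (\<forall>(U, \<phi>)\<in>\<A>. smooth_family_on (\<phi> ` U) I (\<lambda>t. coord_rep (U, \<phi>) (\<lambda>x. X x t)))"

text \<open>A continuous choice of unit normal along the family. For an embedded closed hypersurface the
  inward normal is one such choice; for an immersion no choice is distinguished.\<close>

definition unit_normal_field ::
    "'m topology \<Rightarrow> ('m, 'n::finite) chart set \<Rightarrow> real set \<Rightarrow> ('m \<Rightarrow> real \<Rightarrow> 'b::real_inner)
       \<Rightarrow> ('m \<Rightarrow> real \<Rightarrow> 'b) \<Rightarrow> bool" where
  "unit_normal_field M \<A> I X \<nu> \<longleftrightarrow>
     continuous_map (prod_topology M (top_of_set I)) euclidean (\<lambda>(x, t). \<nu> x t) \<and>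
     (\<forall>x\<in>topspace M. \<forall>t\<in>I. norm (\<nu> x t) = 1) \<and>
     (\<forall>(U, \<phi>)\<in>\<A>. \<forall>x\<in>U. \<forall>t\<in>I. \<forall>i.
        \<nu> x t \<bullet> pd i (coord_rep (U, \<phi>) (\<lambda>y. X y t)) (\<phi> x) = 0)"

section \<open>Geometry of a hypersurface patch \<open>F\<close> with unit normal \<open>N\<close>\<close>

definition first_form :: "(real ^ 'n::finite \<Rightarrow> 'b::real_inner) \<Rightarrow> real ^ 'n \<Rightarrow> real ^ 'n ^ 'n" where
  "first_form F u = (\<chi> i j. pd i F u \<bullet> pd j F u)"

definition inv_form :: "(real ^ 'n::finite \<Rightarrow> 'b::real_inner) \<Rightarrow> real ^ 'n \<Rightarrow> real ^ 'n ^ 'n" where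
  "inv_form F u = matrix_inv (first_form F u)"

definition second_form ::
    "(real ^ 'n::finite \<Rightarrow> 'b::real_inner) \<Rightarrow> (real ^ 'n \<Rightarrow> 'b) \<Rightarrow> real ^ 'n \<Rightarrow> real ^ 'n ^ 'n" where
  "second_form F N u = (\<chi> i j. N u \<bullet> pd i (pd j F) u)"

text \<open>\<open>christoffel F k i j\<close> has the upper index \<open>k\<close> first.\<close>

definition christoffel ::
    "(real ^ 'n::finite \<Rightarrow> 'b::real_inner) \<Rightarrow> 'n \<Rightarrow> 'n \<Rightarrow> 'n \<Rightarrow> real ^ 'n \<Rightarrow> real" where
  "christoffel F k i j u = (\<Sum>l\<in>UNIV. inv_form F u $ k $ l * (pd i (pd j F) u \<bullet> pd l F u))"

definition mean_curv ::
    "(real ^ 'n::finite \<Rightarrow> 'b::real_inner) \<Rightarrow> (real ^ 'n \<Rightarrow> 'b) \<Rightarrow> real ^ 'n \<Rightarrow> real" where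
  "mean_curv F N u = (\<Sum>(i, j)\<in>UNIV. inv_form F u $ i $ j * second_form F N u $ i $ j)"

definition norm_A_sq ::
    "(real ^ 'n::finite \<Rightarrow> 'b::real_inner) \<Rightarrow> (real ^ 'n \<Rightarrow> 'b) \<Rightarrow> real ^ 'n \<Rightarrow> real" where
  "norm_A_sq F N u =
     (\<Sum>(i, j, k, l)\<in>UNIV. inv_form F u $ i $ j * inv_form F u $ k $ l *
        second_form F N u $ i $ k * second_form F N u $ j $ l)"

text \<open>\<open>nabla_A F N k i j\<close> is the component of the covariant derivative of the second fundamental
  form in direction \<open>k\<close>.\<close>

definition nabla_A ::
    "(real ^ 'n::finite \<Rightarrow> 'b::real_inner) \<Rightarrow> (real ^ 'n \<Rightarrow> 'b) \<Rightarrow> 'n \<Rightarrow> 'n \<Rightarrow> 'n \<Rightarrow> real ^ 'n \<Rightarrow> real" where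
  "nabla_A F N k i j u =
     pd k (\<lambda>v. second_form F N v $ i $ j) u
     - (\<Sum>l\<in>UNIV. christoffel F l k i u * second_form F N u $ l $ j)
     - (\<Sum>l\<in>UNIV. christoffel F l k j u * second_form F N u $ i $ l)"

definition norm_nabla_A_sq ::
    "(real ^ 'n::finite \<Rightarrow> 'b::real_inner) \<Rightarrow> (real ^ 'n \<Rightarrow> 'b) \<Rightarrow> real ^ 'n \<Rightarrow> real" where
  "norm_nabla_A_sq F N u =
     (\<Sum>(i, p, j, q, k, r)\<in>UNIV.
        inv_form F u $ i $ p * inv_form F u $ j $ q * inv_form F u $ k $ r *
        nabla_A F N k i j u * nabla_A F N r p q u)"

text \<open>The trace of the covariant Hessian of the function \<open>f\<close>.\<close>

definition laplace_form ::
    "(real ^ 'n::finite \<Rightarrow> 'b::real_inner) \<Rightarrow> (real ^ 'n \<Rightarrow> real) \<Rightarrow> real ^ 'n \<Rightarrow> real" where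
  "laplace_form F f u =
     (\<Sum>(i, j)\<in>UNIV. inv_form F u $ i $ j *
        (pd i (pd j f) u - (\<Sum>k\<in>UNIV. christoffel F k i j u * pd k f u)))"

end

(* In matrix form: let G be the inverse metric, h the second fundamental form, S = G h the shape
   operator, so that H = tr S and |A|^2 = tr (S S).

   Space. Write D_i T = d_i T + [Gam_i, T] for the covariant derivative of an endomorphism field,
   where Gam_i is the matrix of Christoffel symbols. Comparing the tangential and normal parts of the
   symmetric third derivatives of X gives the equations of Gauss and Codazzi. Codazzi makes the
   second covariant derivative of S symmetric in its last two indices, Gauss computes its commutator
   in the first two, and contracting with S yields Simons' identity
     Lap |A|^2 = 2 |nabla A|^2 + 2 tr (S G Hess H) + 2 H tr S^3 - 2 |A|^4.

   Time. Space derivatives commute with time derivatives, so the flow equation gives the second time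
   derivatives of X_i and X_ij. Differentiating the Gauss formula X_ij = Gam^k_ij X_k + h_ij n once in
   time (instead of computing the derivative of Gam) gives
     h_tt = Hess H - H h S + (c1 + |n_t|^2) h - 2 (d_t Gam^k) (n, X_tk),
   and g_tt = 2 (X_ti, X_tj) - 2 H h + 2 c1 g. Both identities are then second derivatives of traces;
   the terms H tr S^3 from Simons' identity and from h_tt and g_tt cancel. *)

theory Submission
  imports Defs
begin

section \<open>Calculus\<close>

text \<open>Low regularity shapes the calculus. The family is only C^2 in time and the unit normal
  is only continuous, so each derivative of the normal must first be shown to exist; this is done by
  expressing the normal, and then its first derivative, through the tangent frame, in space and in
  time alike. Mixed derivatives are known one variable at a time, without joint differentiability,
  so space and time derivatives are interchanged by integration. The shape operator is preferred to
  the second fundamental form because the connection then acts by a commutator and disappears under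
  traces. The Hessian of \<open>H\<close> is never expanded in the evolution equations: in the first
  identity its trace is the Laplacian, in the second it occurs in the same contraction as in Simons'
  identity.\<close>

lemma bounded_bilinear_matrix_mult:
  "bounded_bilinear ((**) :: real^'n^'m \<Rightarrow> real^'p^'n \<Rightarrow> real^'p^'m)"
  unfolding bilinear_conv_bounded_bilinear[symmetric] bilinear_def linear_iff
  by (auto simp: vec_eq_iff matrix_matrix_mult_def sum.distrib algebra_simps sum_distrib_left)

text \<open>An integral form of Schwarz's theorem: the fundamental theorem of calculus in
  \<open>h\<close>, differentiation under the integral sign in \<open>s\<close>, then the
  fundamental theorem in \<open>h\<close> again.\<close>

lemma vector_derivative_integral_exchange:
  fixes g :: "real \<Rightarrow> real \<Rightarrow> 'b::banach"
  assumes I: "convex I" "s \<in> I" "at s within I \<noteq> bot"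
    and gh: "\<And>h s. h \<in> {a..b} \<Longrightarrow> s \<in> I \<Longrightarrow>
      ((\<lambda>h. g h s) has_vector_derivative gh h s) (at h within {a..b})"
    and gs: "\<And>h s. h \<in> {a..b} \<Longrightarrow> s \<in> I \<Longrightarrow>
      ((\<lambda>s. g h s) has_vector_derivative gs h s) (at s within I)"
    and ghs: "\<And>h s. h \<in> {a..b} \<Longrightarrow> s \<in> I \<Longrightarrow>
      ((\<lambda>s. gh h s) has_vector_derivative ghs h s) (at s within I)"
    and cgh: "\<And>s. s \<in> I \<Longrightarrow> continuous_on {a..b} (\<lambda>h. gh h s)"
    and cghs: "continuous_on (I \<times> {a..b}) (\<lambda>(s, h). ghs h s)"
    and h: "h \<in> {a..b}"
  shows "((\<lambda>h. gs h s) has_vector_derivative ghs h s) (at h within {a..b})"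
proof -
  \<comment> \<open>The difference \<open>g x r - g a r\<close> is differentiated in
    \<open>r\<close> at \<open>s\<close> in two ways, termwise and as the integral of
    \<open>gh\<close>; uniqueness of the derivative equates the results.\<close>
  have key: "gs x s = gs a s + integral {a..x} (\<lambda>h. ghs h s)" if x: "x \<in> {a..b}" for x
  proof -
    have sub: "{a..x} \<subseteq> {a..b}" and ax: "a \<le> x" "a \<in> {a..b}" using x by auto
    have int: "integral {a..x} (\<lambda>h. gh h r) = g x r - g a r" if "r \<in> I" for r
    proof -
      have "((\<lambda>h. gh h r) has_integral (g x r - g a r)) {a..x}"
        using has_vector_derivative_within_subset[OF gh[OF _ that] sub] sub
        by (intro fundamental_theorem_of_calculus[OF ax(1)]) blast
      then show ?thesis by (rule integral_unique)
    qed
    have "((\<lambda>r. integral (cbox a x) (\<lambda>h. gh h r)) has_vector_derivative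
        integral (cbox a x) (\<lambda>h. ghs h s)) (at s within I)"
    proof (rule leibniz_rule_vector_derivative[where U = I and fx = "\<lambda>r h. ghs h r"])
      show "((\<lambda>r. gh t r) has_vector_derivative ghs t r) (at r within I)"
        if "r \<in> I" "t \<in> cbox a x" for r t using ghs that sub by auto
      show "(\<lambda>h. gh h r) integrable_on cbox a x" if "r \<in> I" for r
        unfolding cbox_interval
        by (rule integrable_continuous_real) (rule continuous_on_subset[OF cgh[OF that] sub])
      show "continuous_on (I \<times> cbox a x) (\<lambda>(s, h). ghs h s)"
        by (rule continuous_on_subset[OF cghs]) (use sub in auto)
    qed (use I in auto)
    then have "((\<lambda>r. g x r - g a r) has_vector_derivative
        integral {a..x} (\<lambda>h. ghs h s)) (at s within I)"
      unfolding cbox_interval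
      by (rule has_vector_derivative_transform[OF I(2), rotated]) (simp add: int)
    moreover have "((\<lambda>r. g x r - g a r) has_vector_derivative (gs x s - gs a s)) (at s within I)"
      by (intro has_vector_derivative_diff gs I x ax)
    ultimately have "gs x s - gs a s = integral {a..x} (\<lambda>h. ghs h s)"
      using I(3) vector_derivative_within by metis
    then show ?thesis by (simp add: algebra_simps)
  qed
  have "continuous_on {a..b} (\<lambda>h. ghs h s)"
    using continuous_on_compose2[OF cghs, of "{a..b}" "Pair s"] I
    by (force intro!: continuous_intros)
  then have "((\<lambda>x. gs a s + integral {a..x} (\<lambda>h. ghs h s)) has_vector_derivative 0 + ghs h s)
      (at h within {a..b})"
    by (intro has_vector_derivative_add has_vector_derivative_const
        integral_has_vector_derivative h)
  then show ?thesis
    by (intro has_vector_derivative_transform[OF h key]) simp_all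
qed

text \<open>Derivatives in the direction \<open>e\<close> commute with derivatives in the parameter; no Frechet
  differentiability is assumed, so that the lemma can be iterated.\<close>

lemma directional_derivative_exchange:
  fixes f :: "real \<Rightarrow> 'a::real_normed_vector \<Rightarrow> 'b::banach"
  assumes W: "open W" "u \<in> W" and I: "convex I" "s \<in> I" "at s within I \<noteq> bot"
    and fe: "\<And>v t. v \<in> W \<Longrightarrow> t \<in> I \<Longrightarrow>
      ((\<lambda>h. f t (v + h *\<^sub>R e)) has_vector_derivative fe t v) (at 0)"
    and f1: "\<And>v t. v \<in> W \<Longrightarrow> t \<in> I \<Longrightarrow>
      ((\<lambda>t. f t v) has_vector_derivative f1 t v) (at t within I)"
    and fe1: "\<And>v t. v \<in> W \<Longrightarrow> t \<in> I \<Longrightarrow>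
      ((\<lambda>t. fe t v) has_vector_derivative fe1 t v) (at t within I)"
    and cfe: "\<And>t. t \<in> I \<Longrightarrow> continuous_on W (fe t)"
    and cfe1: "continuous_on (W \<times> I) (\<lambda>(v, t). fe1 t v)"
  shows "((\<lambda>h. f1 s (u + h *\<^sub>R e)) has_vector_derivative fe1 s u) (at 0)"
proof -
  obtain r where r: "r > 0" "ball u r \<subseteq> W" using W by (meson openE)
  \<comment> \<open>Chosen so that \<open>norm (h *\<^sub>R e) \<le> r / 2\<close> whenever
    \<open>\<bar>h\<bar> \<le> d\<close>; the added 1 keeps the denominator positive when
    \<open>e = 0\<close>.\<close>
  define d where "d = r / (2 * (norm e + 1))"
  have n1: "norm e + 1 > 0" by (smt (verit) norm_ge_zero)
  have d: "d > 0" unfolding d_def using r n1 by simp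
  have inW: "u + h *\<^sub>R e \<in> W" if "h \<in> {-d..d}" for h
  proof -
    have "norm (h *\<^sub>R e) \<le> d * (norm e + 1)"
      using that by (auto intro!: mult_mono)
    also have "\<dots> = r / 2" unfolding d_def using n1 by (simp add: field_simps)
    also have "\<dots> < r" using r by simp
    finally show ?thesis using r by (auto simp: dist_norm)
  qed
  have "((\<lambda>h. f1 s (u + h *\<^sub>R e)) has_vector_derivative fe1 s (u + 0 *\<^sub>R e)) (at 0 within {-d..d})"
  proof (rule vector_derivative_integral_exchange
      [where I = I and g = "\<lambda>h t. f t (u + h *\<^sub>R e)" and gh = "\<lambda>h t. fe t (u + h *\<^sub>R e)"
        and ghs = "\<lambda>h t. fe1 t (u + h *\<^sub>R e)"])
    fix h t assume ht: "h \<in> {-d..d}" "t \<in> I"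
    have "((\<lambda>k. f t ((u + h *\<^sub>R e) + k *\<^sub>R e)) has_vector_derivative fe t (u + h *\<^sub>R e)) (at 0)"
      by (rule fe) (use ht inW in auto)
    then have "((\<lambda>k. f t ((u + h *\<^sub>R e) + k *\<^sub>R e)) \<circ> (\<lambda>k. k - h) has_vector_derivative
        1 *\<^sub>R fe t (u + h *\<^sub>R e)) (at h)"
      by (intro vector_diff_chain_at)
        (auto intro!: derivative_eq_intros simp: has_vector_derivative_def fun_eq_iff algebra_simps)
    then have "((\<lambda>h. f t (u + h *\<^sub>R e)) has_vector_derivative fe t (u + h *\<^sub>R e)) (at h)"
      by (simp add: o_def algebra_simps)
    then show "((\<lambda>h. f t (u + h *\<^sub>R e)) has_vector_derivative fe t (u + h *\<^sub>R e))
        (at h within {-d..d})"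
      by (rule has_vector_derivative_at_within)
  next
    show "continuous_on {-d..d} (\<lambda>h. fe t (u + h *\<^sub>R e))" if "t \<in> I" for t
      by (rule continuous_on_compose2[OF cfe[OF that]])
        (use inW in \<open>auto intro!: continuous_intros\<close>)
    show "continuous_on (I \<times> {-d..d}) (\<lambda>(t, h). fe1 t (u + h *\<^sub>R e))"
      using continuous_on_compose2[OF cfe1, of "I \<times> {-d..d}" "\<lambda>p. (u + snd p *\<^sub>R e, fst p)"] inW
      by (force intro!: continuous_intros simp: split_beta)
  qed (use d inW I f1 fe1 in auto)
  then show ?thesis
    using d by (simp add: at_within_Icc_at)
qed

subsection \<open>Partial derivatives\<close>

lemma pd_eqI: "(f has_derivative f') (at u) \<Longrightarrow> pd i f u = f' (axis i 1)"
  unfolding pd_def by (metis frechet_derivative_at)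

lemma pd_has_vector_derivative:
  assumes "f differentiable (at u)"
  shows "((\<lambda>h. f (u + h *\<^sub>R axis i 1)) has_vector_derivative pd i f u) (at 0)"
proof -
  have "(f has_derivative frechet_derivative f (at u)) (at (u + 0 *\<^sub>R axis i 1))"
    using assms frechet_derivative_works by auto
  then have "(f \<circ> (\<lambda>h. u + h *\<^sub>R axis i 1) has_derivative
      frechet_derivative f (at u) \<circ> (\<lambda>h. h *\<^sub>R axis i 1)) (at 0)"
    by (rule diff_chain_at[rotated]) (auto intro!: derivative_eq_intros)
  moreover have "frechet_derivative f (at u) \<circ> (\<lambda>h. h *\<^sub>R axis i 1) = (\<lambda>h. h *\<^sub>R pd i f u)"
    using linear_frechet_derivative[OF assms] by (auto simp: fun_eq_iff pd_def linear_cmul)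
  ultimately show ?thesis
    by (simp add: has_vector_derivative_def o_def)
qed

text \<open>Exchange of derivatives yields derivatives along lines only, whereas \<open>pd\<close>
  is read off from a Frechet derivative; this lemma links the two.\<close>

lemma pd_eq_directional:
  assumes "f differentiable (at u)"
    and "((\<lambda>h. f (u + h *\<^sub>R axis i 1)) has_vector_derivative D) (at 0)"
  shows "pd i f u = D"
  using pd_has_vector_derivative[OF assms(1)] assms(2) vector_derivative_at by metis

text \<open>\<open>frechet_derivative\<close> is a choice among all derivatives, so functions with
  the same derivatives share it, even at points where there is none. Hence \<open>pd_cong\<close>
  asks for no differentiability.\<close>

lemma eventually_eq_frechet_derivative:
  assumes "\<forall>\<^sub>F v in nhds u. f v = g v"
  shows "frechet_derivative f (at u) = frechet_derivative g (at u)"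
proof -
  have ev: "\<forall>\<^sub>F v in at u. f v = g v" "f u = g u"
    using assms eventually_nhds_x_imp_x by (auto simp: eventually_at_filter elim: eventually_mono)
  then have "\<forall>\<^sub>F v in at u. g v = f v" by (simp add: eq_commute)
  with ev have "(f has_derivative D) (at u) \<longleftrightarrow> (g has_derivative D) (at u)" for D
    using has_derivative_transform_eventually[of f D u UNIV g]
      has_derivative_transform_eventually[of g D u UNIV f] by auto
  then show ?thesis unfolding frechet_derivative_def by simp
qed

lemma pd_cong:
  assumes "open W" "u \<in> W" "\<And>v. v \<in> W \<Longrightarrow> f v = g v"
  shows "pd i f u = pd i g u"
proof -
  have "\<forall>\<^sub>F v in nhds u. f v = g v"
    using assms eventually_nhds by blast
  then show ?thesis
    unfolding pd_def by (rule arg_cong[OF eventually_eq_frechet_derivative, THEN fun_cong])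
qed

lemma pd_const: "pd i (\<lambda>_. c) u = 0"
  by (simp add: pd_def)

lemma pd_add:
  assumes "f differentiable (at u)" "g differentiable (at u)"
  shows "pd i (\<lambda>v. f v + g v) u = pd i f u + pd i g u"
  using pd_eqI[OF has_derivative_add[OF assms[unfolded frechet_derivative_works]]]
  by (simp add: pd_def)

lemma pd_linear:
  assumes "bounded_linear L" "f differentiable (at u)"
  shows "pd i (\<lambda>v. L (f v)) u = L (pd i f u)"
  using pd_eqI[OF bounded_linear.has_derivative[OF assms(1) assms(2)[unfolded frechet_derivative_works]]]
  by (simp add: pd_def)

lemma pd_sum:
  assumes "\<And>k. k \<in> K \<Longrightarrow> f k differentiable (at u)"
  shows "pd i (\<lambda>v. \<Sum>k\<in>K. f k v) u = (\<Sum>k\<in>K. pd i (f k) u)"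
  unfolding pd_def
  by (rule pd_eqI[unfolded pd_def, OF has_derivative_sum])
    (use assms frechet_derivative_works in blast)

lemma pd_bilinear:
  assumes "bounded_bilinear B" "f differentiable (at u)" "g differentiable (at u)"
  shows "pd i (\<lambda>v. B (f v) (g v)) u = B (pd i f u) (g u) + B (f u) (pd i g u)"
  using pd_eqI[OF bounded_bilinear.FDERIV[OF assms(1)
      assms(2,3)[unfolded frechet_derivative_works]]]
  by (simp add: pd_def add.commute)

lemma differentiable_bilinear:
  assumes "bounded_bilinear B" "f differentiable (at u within A)" "g differentiable (at u within A)"
  shows "(\<lambda>v. B (f v) (g v)) differentiable (at u within A)"
  using assms unfolding differentiable_def by (blast intro: bounded_bilinear.FDERIV)

lemma differentiable_bounded_linear:
  assumes "bounded_linear L" "f differentiable (at u within A)"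
  shows "(\<lambda>v. L (f v)) differentiable (at u within A)"
  using assms unfolding differentiable_def by (blast intro: bounded_linear.has_derivative)

lemma bounded_linear_axis: "bounded_linear (axis a :: 'b::euclidean_space \<Rightarrow> 'b ^ 'm::finite)"
  unfolding linear_conv_bounded_linear[symmetric] linear_iff
  by (auto simp: vec_eq_iff axis_def)

lemma sum_axis_nth: "(\<Sum>a\<in>UNIV. axis a (x $ a)) = x" for x :: "'b::euclidean_space ^ 'm::finite"
  by (simp add: vec_eq_iff axis_def if_distrib cong: if_cong)

lemma has_vector_derivative_vec_lambda:
  fixes f :: "real \<Rightarrow> 'b::euclidean_space ^ 'm::finite"
  assumes "\<And>a. ((\<lambda>s. f s $ a) has_vector_derivative D $ a) (at t within I)"
  shows "(f has_vector_derivative D) (at t within I)"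
proof -
  have "((\<lambda>s. \<Sum>a\<in>UNIV. axis a (f s $ a)) has_vector_derivative (\<Sum>a\<in>UNIV. axis a (D $ a)))
      (at t within I)"
    by (intro has_vector_derivative_sum
        bounded_linear.has_vector_derivative[OF bounded_linear_axis assms])
  then show ?thesis by (simp add: sum_axis_nth)
qed

lemma differentiable_vec_lambda:
  fixes f :: "'a::real_normed_vector \<Rightarrow> 'b::euclidean_space ^ 'm::finite"
  assumes "\<And>a. (\<lambda>v. f v $ a) differentiable (at u within A)"
  shows "f differentiable (at u within A)"
proof -
  have "(\<lambda>v. \<Sum>a\<in>UNIV. axis a (f v $ a)) differentiable (at u within A)"
    by (intro differentiable_sum ballI differentiable_bounded_linear[OF bounded_linear_axis assms]) auto
  then show ?thesis by (simp add: sum_axis_nth)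
qed

lemma pd_nth:
  assumes "f differentiable (at u)"
  shows "pd i (\<lambda>v. f v $ a) u = pd i f u $ a"
  by (rule pd_linear[OF bounded_linear_vec_nth assms])

text \<open>Schwarz's theorem as an instance of \<open>directional_derivative_exchange\<close>: the
  parameter is the shift \<open>s\<close> in \<open>f (v + s *\<^sub>R axis j 1)\<close>, evaluated
  at \<open>s = 0\<close>.\<close>

lemma pd_commute:
  fixes f :: "real ^ 'n::finite \<Rightarrow> 'b::banach"
  assumes W: "open W" "u \<in> W"
    and f: "\<And>v. v \<in> W \<Longrightarrow> f differentiable (at v)"
    and fi: "\<And>i v. v \<in> W \<Longrightarrow> pd i f differentiable (at v)"
    and fij: "continuous_on W (pd j (pd i f))"
  shows "pd i (pd j f) u = pd j (pd i f) u"
proof (rule pd_eq_directional)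
  obtain r where r: "r > 0" "ball u r \<subseteq> W" using W by (meson openE)
  \<comment> \<open>The radii \<open>r/2\<close> and \<open>r/4\<close> add up to less than
    \<open>r\<close>, so shifted points stay in \<open>W\<close>.\<close>
  have inW: "v + s *\<^sub>R axis j 1 \<in> W" if "v \<in> ball u (r/2)" "s \<in> {-(r/4)..r/4}" for v s
  proof -
    have "dist u (v + s *\<^sub>R axis j 1) \<le> dist u v + norm (s *\<^sub>R axis j 1 :: real^'n)"
      by (metis add_diff_cancel_left' dist_norm dist_triangle norm_minus_commute)
    also have "\<dots> < r" using that r by (auto simp: norm_axis_1)
    finally show ?thesis using r by auto
  qed
  have "((\<lambda>h. pd j f ((u + h *\<^sub>R axis i 1) + 0 *\<^sub>R axis j 1)) has_vector_derivative
      pd j (pd i f) (u + 0 *\<^sub>R axis j 1)) (at 0)"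
  proof (rule directional_derivative_exchange[where W = "ball u (r/2)" and I = "{-(r/4)..r/4}"
        and f = "\<lambda>s v. f (v + s *\<^sub>R axis j 1)" and fe = "\<lambda>s v. pd i f (v + s *\<^sub>R axis j 1)"
        and ?f1.0 = "\<lambda>s v. pd j f (v + s *\<^sub>R axis j 1)"
        and ?fe1.0 = "\<lambda>s v. pd j (pd i f) (v + s *\<^sub>R axis j 1)"])
    have shift: "((\<lambda>t. F (v + t *\<^sub>R axis j 1)) has_vector_derivative pd j F (v + t *\<^sub>R axis j 1))
        (at t within {-(r/4)..r/4})"
      if "F differentiable (at (v + t *\<^sub>R axis j 1))" for F :: "real ^ 'n \<Rightarrow> 'b" and v t
    proof -
      have "((\<lambda>k. k - t) has_vector_derivative 1) (at t)"
        unfolding has_real_derivative_iff_has_vector_derivative[symmetric]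
        by (auto intro!: derivative_eq_intros)
      moreover have "((\<lambda>h. F ((v + t *\<^sub>R axis j 1) + h *\<^sub>R axis j 1)) has_vector_derivative
          pd j F (v + t *\<^sub>R axis j 1)) (at (t - t))"
        using pd_has_vector_derivative[OF that] by simp
      ultimately have "((\<lambda>h. F ((v + t *\<^sub>R axis j 1) + h *\<^sub>R axis j 1)) \<circ> (\<lambda>k. k - t)
          has_vector_derivative 1 *\<^sub>R pd j F (v + t *\<^sub>R axis j 1)) (at t)"
        by (rule vector_diff_chain_at)
      then have "((\<lambda>t. F (v + t *\<^sub>R axis j 1)) has_vector_derivative
          pd j F (v + t *\<^sub>R axis j 1)) (at t)"
        by (simp add: o_def algebra_simps)
      then show ?thesis by (rule has_vector_derivative_at_within)
    qed
    fix v t assume vt: "v \<in> ball u (r/2)" "t \<in> {-(r/4)..r/4}"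
    show "((\<lambda>h. f (v + h *\<^sub>R axis i 1 + t *\<^sub>R axis j 1)) has_vector_derivative
        pd i f (v + t *\<^sub>R axis j 1)) (at 0)"
      using pd_has_vector_derivative[OF f[OF inW[OF vt]]] by (simp add: algebra_simps)
    show "((\<lambda>t. f (v + t *\<^sub>R axis j 1)) has_vector_derivative pd j f (v + t *\<^sub>R axis j 1))
        (at t within {-(r/4)..r/4})" by (rule shift[OF f[OF inW[OF vt]]])
    show "((\<lambda>t. pd i f (v + t *\<^sub>R axis j 1)) has_vector_derivative
        pd j (pd i f) (v + t *\<^sub>R axis j 1)) (at t within {-(r/4)..r/4})"
      by (rule shift[OF fi[OF inW[OF vt]]])
  next
    fix t assume t: "t \<in> {-(r/4)..r/4}"
    have "continuous_on W (pd i f)"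
      by (simp add: W(1) continuous_on_eq_continuous_at differentiable_imp_continuous_within fi)
    then show "continuous_on (ball u (r/2)) (\<lambda>v. pd i f (v + t *\<^sub>R axis j 1))"
      by (rule continuous_on_compose2) (use inW t in \<open>auto intro!: continuous_intros\<close>)
  next
    show "continuous_on (ball u (r/2) \<times> {-(r/4)..r/4})
        (\<lambda>(v, t). pd j (pd i f) (v + t *\<^sub>R axis j 1))"
      using continuous_on_compose2[OF fij, of "ball u (r/2) \<times> {-(r/4)..r/4}"
          "\<lambda>p. fst p + snd p *\<^sub>R axis j 1"] inW
      by (force intro!: continuous_intros simp: split_beta)
  next
    show "at 0 within {-(r/4)..r/4} \<noteq> bot" using r by (simp add: at_within_Icc_at)
  qed (use r in auto)
  then show "((\<lambda>h. pd j f (u + h *\<^sub>R axis i 1)) has_vector_derivative pd j (pd i f) u) (at 0)"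
    by simp
qed (rule fi[OF W(2)])

subsection \<open>Differentiating the inverse matrix\<close>

lemma differentiable_det:
  fixes f :: "'a::real_normed_vector \<Rightarrow> real ^ 'n ^ 'n"
  assumes "\<And>i j. (\<lambda>v. f v $ i $ j) differentiable (at x within A)"
  shows "(\<lambda>v. det (f v)) differentiable (at x within A)"
proof -
  have "(\<lambda>v. \<Prod>i\<in>UNIV. f v $ i $ p i) differentiable (at x within A)" for p
    using has_derivative_prod[of UNIV "\<lambda>i v. f v $ i $ p i"
        "\<lambda>i. frechet_derivative (\<lambda>v. f v $ i $ p i) (at x within A)" x A]
      assms frechet_derivative_works unfolding differentiable_def by blast
  then show ?thesis
    unfolding det_def by (intro differentiable_sum differentiable_mult differentiable_const) auto
qed

lemma matrix_inv_left_right: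
  fixes A :: "real ^ 'n ^ 'n"
  assumes "det A \<noteq> 0"
  shows "A ** matrix_inv A = mat 1" "matrix_inv A ** A = mat 1"
  using someI_ex[of "\<lambda>B. A ** B = mat 1 \<and> B ** A = mat 1"] assms
  unfolding invertible_det_nz[symmetric] invertible_def matrix_inv_def by blast+

text \<open>Column \<open>b\<close> of the inverse solves the linear system with right-hand side
  \<open>axis b 1\<close>. Cramer's rule makes its entries quotients of polynomials in the entries
  of \<open>A\<close>, hence differentiable.\<close>

lemma matrix_inv_cramer:
  fixes A :: "real ^ 'n ^ 'n"
  assumes "det A \<noteq> 0"
  shows "matrix_inv A $ k $ b = det (\<chi> i j. if j = k then axis b 1 $ i else A $ i $ j) / det A"
proof -
  have "A *v (matrix_inv A *v axis b 1) = axis b 1"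
    by (simp add: matrix_vector_mul_assoc matrix_inv_left_right assms)
  then have "matrix_inv A *v axis b 1 =
      (\<chi> k. det (\<chi> i j. if j = k then axis b 1 $ i else A $ i $ j) / det A)"
    using cramer[OF assms] by blast
  then have "(matrix_inv A *v axis b 1) $ k =
      det (\<chi> i j. if j = k then axis b 1 $ i else A $ i $ j) / det A"
    by simp
  moreover have "(matrix_inv A *v axis b 1) $ k = matrix_inv A $ k $ b"
    by (simp add: matrix_vector_mult_def axis_def if_distrib cong: if_cong)
  ultimately show ?thesis by simp
qed

text \<open>Cramer's rule gives differentiability, since \<open>det\<close> stays nonzero near
  \<open>A\<close>; the value of the derivative then follows by differentiating
  \<open>B ** matrix_inv B = mat 1\<close>.\<close>

lemma matrix_inv_has_derivative:
  fixes A :: "real ^ 'n ^ 'n"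
  assumes A: "det A \<noteq> 0"
  shows "(matrix_inv has_derivative (\<lambda>E. - (matrix_inv A ** E ** matrix_inv A))) (at A)"
proof -
  have entry: "(\<lambda>B :: real ^ 'n ^ 'n. B $ i $ j) differentiable (at C)" for i j C
    by (intro differentiable_bounded_linear[OF bounded_linear_vec_nth] differentiable_ident)
  have "isCont det A"
    by (intro differentiable_imp_continuous_within differentiable_det entry)
  then have ev: "\<forall>\<^sub>F B in at A. det B \<noteq> 0"
    using A by (intro tendsto_imp_eventually_ne) (auto simp: isCont_def)
  have "matrix_inv differentiable (at A)"
  proof (intro differentiable_vec_lambda)
    fix k b
    have "(\<lambda>B :: real ^ 'n ^ 'n.
        (\<chi> i j. if j = k then axis b 1 $ i else B $ i $ j) $ p $ q) differentiable (at A)" for p q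
      by (cases "q = k") (auto intro: entry)
    then have "(\<lambda>B. det (\<chi> i j. if j = k then axis b 1 $ i else B $ i $ j) / det B)
        differentiable (at A)"
      using A by (intro differentiable_divide differentiable_det entry) auto
    then obtain D where "((\<lambda>B. det (\<chi> i j. if j = k then axis b 1 $ i else B $ i $ j) / det B)
        has_derivative D) (at A)"
      unfolding differentiable_def by blast
    then have "((\<lambda>B. matrix_inv B $ k $ b) has_derivative D) (at A)"
      by (rule has_derivative_transform_eventually)
        (use ev A in \<open>auto elim!: eventually_mono simp: matrix_inv_cramer\<close>)
    then show "(\<lambda>B. matrix_inv B $ k $ b) differentiable (at A)"
      unfolding differentiable_def by blast
  qed
  then obtain D where D: "(matrix_inv has_derivative D) (at A)"
    unfolding differentiable_def by blast
  have "((\<lambda>B. B ** matrix_inv B) has_derivative (\<lambda>E. A ** D E + E ** matrix_inv A)) (at A)"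
    by (rule bounded_bilinear.FDERIV[OF bounded_bilinear_matrix_mult has_derivative_ident D])
  moreover have "((\<lambda>B. B ** matrix_inv B) has_derivative (\<lambda>E. 0)) (at A)"
    by (rule has_derivative_transform_eventually[OF has_derivative_const[of "mat 1"]])
      (use ev A in \<open>auto elim!: eventually_mono simp: matrix_inv_left_right\<close>)
  ultimately have *: "A ** D E + E ** matrix_inv A = 0" for E
    using has_derivative_unique by (metis (no_types, lifting))
  have "D E = - (matrix_inv A ** E ** matrix_inv A)" for E
  proof -
    have "matrix_inv A ** (A ** D E + E ** matrix_inv A) = 0"
      using * by (simp add: matrix_matrix_mult_def vec_eq_iff)
    then show ?thesis
      by (simp add: matrix_add_ldistrib matrix_mul_assoc matrix_inv_left_right A
          eq_neg_iff_add_eq_0)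
  qed
  then have "D = (\<lambda>E. - (matrix_inv A ** E ** matrix_inv A))" by blast
  with D show ?thesis by simp
qed

lemma has_vector_derivative_matrix_inv:
  fixes g :: "real \<Rightarrow> real ^ 'n ^ 'n"
  assumes "(g has_vector_derivative g') (at t within I)" "det (g t) \<noteq> 0"
  shows "((\<lambda>s. matrix_inv (g s)) has_vector_derivative
    - (matrix_inv (g t) ** g' ** matrix_inv (g t))) (at t within I)"
proof -
  have "((\<lambda>s. matrix_inv (g s)) has_derivative
      (\<lambda>h. - (matrix_inv (g t) ** (h *\<^sub>R g') ** matrix_inv (g t)))) (at t within I)"
    by (rule has_derivative_compose[OF assms(1)[unfolded has_vector_derivative_def]
          matrix_inv_has_derivative[OF assms(2)]])
  then show ?thesis
    by (simp add: has_vector_derivative_def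
        bounded_bilinear.scaleR_left[OF bounded_bilinear_matrix_mult]
        bounded_bilinear.scaleR_right[OF bounded_bilinear_matrix_mult])
qed

lemma differentiable_matrix_inv:
  fixes g :: "'a::real_normed_vector \<Rightarrow> real ^ 'n ^ 'n"
  assumes "g differentiable (at x within A)" "det (g x) \<noteq> 0"
  shows "(\<lambda>s. matrix_inv (g s)) differentiable (at x within A)"
  using has_derivative_compose[of g _ x A matrix_inv, OF _ matrix_inv_has_derivative[OF assms(2)]]
    assms(1)
  unfolding differentiable_def by blast

lemma pd_matrix_inv:
  fixes g :: "real ^ 'm::finite \<Rightarrow> real ^ 'n ^ 'n"
  assumes "g differentiable (at x)" "det (g x) \<noteq> 0"
  shows "pd i (\<lambda>s. matrix_inv (g s)) x = - (matrix_inv (g x) ** pd i g x ** matrix_inv (g x))"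
  using pd_eqI[OF has_derivative_compose[OF assms(1)[unfolded frechet_derivative_works]
      matrix_inv_has_derivative[OF assms(2)]]] by (simp add: pd_def)

subsection \<open>Finitely many derivatives\<close>

text \<open>Smoothness graded by order. The grading permits induction: a product rule, or a
  differential equation such as Weingarten's, bounds the order of a derivative by that of the
  functions involved. Smoothness is \<open>kdiff k\<close> for every \<open>k\<close>.\<close>

primrec kdiff ::
    "nat \<Rightarrow> (real ^ 'n::finite) set \<Rightarrow> (real ^ 'n \<Rightarrow> 'b::real_normed_vector) \<Rightarrow> bool" where
  "kdiff 0 W f \<longleftrightarrow> True"
| "kdiff (Suc k) W f \<longleftrightarrow> (\<forall>v\<in>W. f differentiable (at v)) \<and> (\<forall>i. kdiff k W (pd i f))"

lemma iter_pd_append: "iter_pd (is @ js) f = iter_pd is (iter_pd js f)"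
  by (induction "is") auto

lemma smooth_on_pd:
  assumes "smooth_on W f"
  shows "smooth_on W (pd i f)"
  using assms iter_pd_append[of _ "[i]" f] unfolding smooth_on_def by (metis iter_pd.simps)

lemma smooth_on_imp_kdiff:
  assumes "open W"
  shows "smooth_on W f \<Longrightarrow> kdiff k W f"
proof (induction k arbitrary: f)
  case (Suc k)
  have "f differentiable_on W"
    using Suc.prems unfolding smooth_on_def by (metis iter_pd.simps(1))
  moreover have "kdiff k W (pd i f)" for i
    by (rule Suc.IH[OF smooth_on_pd[OF Suc.prems]])
  ultimately show ?case
    using assms by (auto simp: differentiable_on_eq_differentiable_at)
qed simp

lemma kdiff_cong:
  assumes W: "open W"
  shows "(\<And>v. v \<in> W \<Longrightarrow> f v = g v) \<Longrightarrow> kdiff k W f \<Longrightarrow> kdiff k W g"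
proof (induction k arbitrary: f g)
  case (Suc k)
  have "g differentiable (at v)" if "v \<in> W" for v
    using Suc.prems that has_derivative_transform_within_open[OF _ W that]
    unfolding differentiable_def kdiff.simps by metis
  moreover have "kdiff k W (pd i g)" for i
    by (rule Suc.IH[of "pd i f"]) (use Suc.prems pd_cong[OF W _ Suc.prems(1)] in auto)
  ultimately show ?case by simp
qed simp

lemma kdiff_Suc_imp: "kdiff (Suc k) W f \<Longrightarrow> kdiff k W f"
  by (induction k arbitrary: f) auto

lemma kdiff_const: "kdiff k W (\<lambda>_. c)"
  by (induction k arbitrary: c) (auto simp: pd_const[abs_def])

lemma kdiff_add:
  assumes W: "open W"
  shows "kdiff k W f \<Longrightarrow> kdiff k W g \<Longrightarrow> kdiff k W (\<lambda>v. f v + g v)"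
proof (induction k arbitrary: f g)
  case (Suc k)
  have "kdiff k W (pd i (\<lambda>v. f v + g v))" for i
    by (rule kdiff_cong[OF W _ Suc.IH[of "pd i f" "pd i g"]]) (use Suc.prems in \<open>auto simp: pd_add\<close>)
  then show ?case using Suc.prems by (auto intro!: differentiable_add)
qed simp

lemma kdiff_sum:
  assumes W: "open W"
  shows "(\<And>a. a \<in> K \<Longrightarrow> kdiff k W (f a)) \<Longrightarrow> kdiff k W (\<lambda>v. \<Sum>a\<in>K. f a v)"
  by (induction K rule: infinite_finite_induct) (auto intro: kdiff_const kdiff_add[OF W])

lemma kdiff_linear:
  assumes W: "open W" and L: "bounded_linear L"
  shows "kdiff k W f \<Longrightarrow> kdiff k W (\<lambda>v. L (f v))"
proof (induction k arbitrary: f)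
  case (Suc k)
  have "kdiff k W (pd i (\<lambda>v. L (f v)))" for i
    by (rule kdiff_cong[OF W _ Suc.IH[of "pd i f"]]) (use Suc.prems in \<open>auto simp: pd_linear[OF L]\<close>)
  then show ?case using Suc.prems by (auto intro!: differentiable_bounded_linear[OF L])
qed simp

lemma kdiff_bilinear:
  assumes W: "open W" and B: "bounded_bilinear B"
  shows "kdiff k W f \<Longrightarrow> kdiff k W g \<Longrightarrow> kdiff k W (\<lambda>v. B (f v) (g v))"
proof (induction k arbitrary: f g)
  case (Suc k)
  have "kdiff k W (pd i (\<lambda>v. B (f v) (g v)))" for i
  proof (rule kdiff_cong[OF W])
    show "kdiff k W (\<lambda>v. B (pd i f v) (g v) + B (f v) (pd i g v))"
      using Suc.prems Suc.prems[THEN kdiff_Suc_imp] by (intro kdiff_add[OF W] Suc.IH) simp_all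
  qed (use Suc.prems in \<open>auto simp: pd_bilinear[OF B]\<close>)
  then show ?case using Suc.prems by (auto intro!: differentiable_bilinear[OF B])
qed simp

lemma kdiff_vec_lambda:
  fixes f :: "real ^ 'n::finite \<Rightarrow> 'b::euclidean_space ^ 'm::finite"
  assumes W: "open W"
  shows "(\<And>a. kdiff k W (\<lambda>v. f v $ a)) \<Longrightarrow> kdiff k W f"
proof (induction k arbitrary: f)
  case (Suc k)
  then have d: "f differentiable (at v)" if "v \<in> W" for v
    using that by (auto intro: differentiable_vec_lambda)
  have "kdiff k W (pd i f)" for i
    by (rule Suc.IH, rule kdiff_cong[OF W _ Suc.prems[unfolded kdiff.simps, THEN conjunct2, rule_format]])
      (use d in \<open>auto simp: pd_nth\<close>)
  with d show ?case by simp
qed simp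

text \<open>The derivative of the inverse is a product of the inverse itself and the derivative of
  \<open>g\<close>, so one order is gained at each step.\<close>

lemma kdiff_matrix_inv:
  fixes g :: "real ^ 'm::finite \<Rightarrow> real ^ 'n ^ 'n"
  assumes W: "open W" and det: "\<And>v. v \<in> W \<Longrightarrow> det (g v) \<noteq> 0"
  shows "kdiff k W g \<Longrightarrow> kdiff k W (\<lambda>v. matrix_inv (g v))"
proof (induction k)
  case (Suc k)
  have d: "(\<lambda>v. matrix_inv (g v)) differentiable (at v)" if "v \<in> W" for v
    using Suc.prems that det by (auto intro!: differentiable_matrix_inv)
  have "kdiff k W (pd i (\<lambda>v. matrix_inv (g v)))" for i
  proof (rule kdiff_cong[OF W])
    have "kdiff k W (\<lambda>v. matrix_inv (g v))" using Suc kdiff_Suc_imp by auto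
    then show "kdiff k W (\<lambda>v. - (matrix_inv (g v) ** pd i g v ** matrix_inv (g v)))"
      using Suc.prems
      by (intro kdiff_linear[OF W bounded_linear_minus[OF bounded_linear_ident]]
          kdiff_bilinear[OF W bounded_bilinear_matrix_mult]) auto
  qed (use Suc.prems det in \<open>auto simp: pd_matrix_inv\<close>)
  with d show ?case by simp
qed simp

section \<open>Frames adapted to a hyperplane\<close>

definition gram :: "('n::finite \<Rightarrow> 'a::real_inner) \<Rightarrow> real ^ 'n ^ 'n" where
  "gram e = (\<chi> i j. e i \<bullet> e j)"

text \<open>For independent \<open>e\<close>, the dual basis inside the span of \<open>e\<close>,
  with the index raised by the inverse Gram matrix; pairing with it reads off tangential
  coefficients.\<close>

definition dual :: "('n::finite \<Rightarrow> 'a::real_inner) \<Rightarrow> 'n \<Rightarrow> 'a" where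
  "dual e k = (\<Sum>l\<in>UNIV. (matrix_inv (gram e) $ k $ l) *\<^sub>R e l)"

lemma transpose_gram: "transpose (gram e) = gram e"
  by (simp add: gram_def transpose_def vec_eq_iff inner_commute)

lemma transpose_matrix_inv_symmetric:
  fixes A :: "real ^ 'n ^ 'n"
  assumes "det A \<noteq> 0" "transpose A = A"
  shows "transpose (matrix_inv A) = matrix_inv A"
proof -
  have "transpose (matrix_inv A) ** A = mat 1"
    by (metis assms matrix_inv_left_right(1) matrix_transpose_mul transpose_mat)
  then show ?thesis
    by (metis assms(1) matrix_inv_left_right(1) matrix_mul_assoc matrix_mul_lid matrix_mul_rid)
qed

text \<open>The linear algebra at a single point and time, kept free of derivatives so that it
  serves equally when the frame varies in space and when it varies in time.\<close>

locale adapted_frame =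
  fixes e :: "'n::finite \<Rightarrow> real ^ 'k::finite" and N :: "real ^ 'k"
  assumes card: "CARD('k) = CARD('n) + 1"
    and indep: "(\<Sum>i\<in>UNIV. x $ i *\<^sub>R e i) = 0 \<Longrightarrow> x = 0"
    and norm_N: "norm N = 1"
    and N_e: "N \<bullet> e i = 0"
begin

lemma N_N: "N \<bullet> N = 1"
  using norm_N by (simp add: dot_square_norm)

lemma e_N: "e i \<bullet> N = 0"
  using N_e by (simp add: inner_commute)

text \<open>For \<open>x\<close> in the kernel, the squared length of
  \<open>\<Sum>i\<in>UNIV. x $ i *\<^sub>R e i\<close> is
  \<open>x \<bullet> (gram e *v x) = 0\<close>, and independence gives \<open>x = 0\<close>.\<close>

lemma det_gram: "det (gram e) \<noteq> 0"
proof -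
  have "x = 0" if "gram e *v x = 0" for x
  proof (rule indep)
    have "(\<Sum>i\<in>UNIV. x $ i *\<^sub>R e i) \<bullet> (\<Sum>j\<in>UNIV. x $ j *\<^sub>R e j) = x \<bullet> (gram e *v x)"
      by (simp add: inner_sum_left inner_sum_right gram_def matrix_vector_mult_def inner_vec_def[of x]
          sum_distrib_left mult.left_commute mult.commute inner_commute)
    then show "(\<Sum>i\<in>UNIV. x $ i *\<^sub>R e i) = 0"
      unfolding that inner_zero_right inner_eq_zero_iff .
  qed
  then have "\<exists>B. B ** gram e = mat 1" using matrix_left_invertible_ker by blast
  then show ?thesis
    using invertible_left_inverse invertible_det_nz by blast
qed

lemma transpose_gram_inv: "transpose (matrix_inv (gram e)) = matrix_inv (gram e)"
  by (rule transpose_matrix_inv_symmetric[OF det_gram transpose_gram])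

lemma gram_inv_sym: "matrix_inv (gram e) $ i $ j = matrix_inv (gram e) $ j $ i"
  using arg_cong[OF transpose_gram_inv, of "\<lambda>A. A $ j $ i"] by (simp add: transpose_def)

lemma dual_e: "dual e k \<bullet> e j = (if k = j then 1 else 0)"
proof -
  have "dual e k \<bullet> e j = (matrix_inv (gram e) ** gram e) $ k $ j"
    by (simp add: dual_def inner_sum_left matrix_matrix_mult_def gram_def)
  then show ?thesis
    by (simp add: matrix_inv_left_right det_gram mat_def)
qed

lemma dual_N: "dual e k \<bullet> N = 0"
  by (simp add: dual_def inner_sum_left e_N)

text \<open>The map \<open>\<Phi>\<close> that assembles a vector from coefficients is injective,
  because \<open>dual e\<close> and \<open>N\<close> recover the coefficients; \<open>card\<close>
  makes source and target dimensions equal, so it is onto.\<close>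

lemma expand: "z = (\<Sum>k\<in>UNIV. (z \<bullet> dual e k) *\<^sub>R e k) + (z \<bullet> N) *\<^sub>R N"
proof -
  define \<Phi> where "\<Phi> = (\<lambda>(x :: real ^ 'n, a :: real). (\<Sum>k\<in>UNIV. x $ k *\<^sub>R e k) + a *\<^sub>R N)"
  have lin: "linear \<Phi>"
    unfolding \<Phi>_def linear_iff
    by (auto simp: scaleR_add_left sum.distrib scaleR_sum_right algebra_simps)
  have coeff: "\<Phi> (x, a) \<bullet> dual e k = x $ k" "\<Phi> (x, a) \<bullet> N = a" for x a k
    by (simp_all add: \<Phi>_def inner_add_left inner_sum_left e_N N_N inner_commute[of N "dual e k"]
        dual_N inner_commute[of "e _" "dual e k"] dual_e if_distrib cong: if_cong)
  have "inj \<Phi>"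
  proof (rule injI)
    fix p q assume eq: "\<Phi> p = \<Phi> q"
    obtain x a y b where pq: "p = (x, a)" "q = (y, b)" by (cases p, cases q)
    have "x $ k = y $ k" for k using eq coeff(1) unfolding pq by metis
    moreover have "a = b" using eq coeff(2) unfolding pq by metis
    ultimately show "p = q" by (simp add: pq vec_eq_iff)
  qed
  then have "dim (range \<Phi>) = DIM(real ^ 'k)"
    using dim_image_eq[OF lin, of UNIV] card by simp
  moreover have "subspace (range \<Phi>)"
    by (rule linear_subspace_image[OF lin subspace_UNIV])
  ultimately have "range \<Phi> = UNIV"
    using dim_eq_full[of "range \<Phi>"] by (simp add: span_eq_iff[THEN iffD2])
  then have "z \<in> range \<Phi>" by simp
  then obtain x a where "z = \<Phi> (x, a)" by auto
  then show ?thesis using coeff[of x a] by (simp add: \<Phi>_def)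
qed

lemma inner_dual: "z \<bullet> dual e k = (\<Sum>l\<in>UNIV. matrix_inv (gram e) $ k $ l * (z \<bullet> e l))"
  by (simp add: dual_def inner_sum_right)

lemma inner_expand: "z \<bullet> w = (\<Sum>k\<in>UNIV. (z \<bullet> dual e k) * (w \<bullet> e k)) + (z \<bullet> N) * (w \<bullet> N)"
proof -
  have "z \<bullet> w = ((\<Sum>k\<in>UNIV. (z \<bullet> dual e k) *\<^sub>R e k) + (z \<bullet> N) *\<^sub>R N) \<bullet> w"
    using expand[of z] by (rule arg_cong)
  then show ?thesis by (simp add: inner_add_right inner_sum_right inner_commute[of _ w])
qed

end

lemma differentiable_sqrt:
  assumes "f differentiable (at x within A)" "f x > (0::real)"
  shows "(\<lambda>y. sqrt (f y)) differentiable (at x within A)"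
  using assms has_derivative_real_sqrt unfolding differentiable_def by blast

lemma differentiable_gram:
  assumes "\<And>i. e i differentiable (at x within A)"
  shows "(\<lambda>y. gram (\<lambda>i. e i y)) differentiable (at x within A)"
  by (intro differentiable_vec_lambda)
    (auto simp: gram_def intro!: differentiable_bilinear[OF bounded_bilinear_inner] assms)

text \<open>With \<open>w = N x\<close>, the normal part of \<open>w\<close> at \<open>y\<close> is \<open>(w \<bullet> N y) N y\<close>; it depends on the
  tangent frame only, and normalising it recovers \<open>N y\<close> as long as \<open>w \<bullet> N y\<close> is positive.\<close>

lemma unit_normal_differentiable:
  fixes e :: "'n::finite \<Rightarrow> 'a::real_normed_vector \<Rightarrow> real ^ 'k::finite"
  assumes x: "x \<in> A"
    and frame: "\<And>y. y \<in> A \<Longrightarrow> adapted_frame (\<lambda>i. e i y) (N y)"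
    and e: "\<And>i. e i differentiable (at x within A)"
    and N: "continuous (at x within A) N"
  shows "N differentiable (at x within A)"
proof -
  define w where "w = N x"
  define P where "P y = w - (\<Sum>k\<in>UNIV. (w \<bullet> dual (\<lambda>i. e i y) k) *\<^sub>R e k y)" for y
  have P: "P y = (w \<bullet> N y) *\<^sub>R N y" if "y \<in> A" for y
  proof -
    interpret adapted_frame "\<lambda>i. e i y" "N y" by (rule frame[OF that])
    show ?thesis unfolding P_def using expand[of w] by (simp add: algebra_simps)
  qed
  interpret x: adapted_frame "\<lambda>i. e i x" "N x" by (rule frame[OF x])
  have Px: "w \<bullet> P x = 1" by (simp add: P[OF x] w_def x.N_N)
  have "(\<lambda>y. matrix_inv (gram (\<lambda>i. e i y)) $ k $ l) differentiable (at x within A)" for k l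
    by (intro differentiable_bounded_linear[OF bounded_linear_vec_nth] differentiable_matrix_inv
        differentiable_gram e x.det_gram)
  then have Pd: "P differentiable (at x within A)"
    unfolding P_def[abs_def] dual_def
    by (intro differentiable_diff differentiable_const differentiable_sum ballI finite
        differentiable_bilinear[OF bounded_bilinear_scaleR]
        differentiable_bilinear[OF bounded_bilinear_inner] e) auto
  then have wPd: "(\<lambda>y. w \<bullet> P y) differentiable (at x within A)"
    by (intro differentiable_bilinear[OF bounded_bilinear_inner] differentiable_const)
  \<comment> \<open>By \<open>P\<close>, the quantity \<open>w \<bullet> P y\<close> is the square
    of \<open>w \<bullet> N y\<close> on \<open>A\<close>. It equals 1 at \<open>x\<close>, which
    makes the square root and its inverse differentiable there.\<close>
  have d: "(\<lambda>y. inverse (sqrt (w \<bullet> P y)) *\<^sub>R P y) differentiable (at x within A)"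
    by (intro differentiable_bilinear[OF bounded_bilinear_scaleR] differentiable_inverse
        differentiable_sqrt Pd wPd) (simp_all add: Px)
  \<comment> \<open>The frame determines the normal up to sign; continuity of \<open>N\<close>
    excludes a jump to the opposite normal.\<close>
  have "continuous (at x within A) (\<lambda>y. w \<bullet> N y)"
    by (intro continuous_intros N)
  then have "\<forall>\<^sub>F y in at x within A. w \<bullet> N y > 0"
    unfolding continuous_within by (rule order_tendstoD) (simp add: w_def x.N_N)
  then obtain r where r: "r > 0" "\<And>y. y \<in> A \<Longrightarrow> dist y x < r \<Longrightarrow> y \<noteq> x \<Longrightarrow> w \<bullet> N y > 0"
    unfolding eventually_at by auto
  show ?thesis
  proof (rule differentiable_transform_within[OF d r(1) x])
    fix y assume y: "y \<in> A" "dist y x < r"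
    have "w \<bullet> N y > 0" using r(2)[OF y] by (cases "y = x") (auto simp: w_def x.N_N)
    moreover have "sqrt (w \<bullet> P y) = \<bar>w \<bullet> N y\<bar>"
      by (simp add: P[OF y(1)])
    ultimately show "inverse (sqrt (w \<bullet> P y)) *\<^sub>R P y = N y"
      by (simp add: P[OF y(1)])
  qed
qed

section \<open>Hypersurface patches\<close>

text \<open>Indices are arranged so that the covariant derivative in direction \<open>i\<close> of an endomorphism
  field \<open>T\<close> is \<open>pd i T + conn F i ** T - T ** conn F i\<close>.\<close>

definition conn :: "(real ^ 'n::finite \<Rightarrow> 'b::real_inner) \<Rightarrow> 'n \<Rightarrow> real ^ 'n \<Rightarrow> real ^ 'n ^ 'n" where
  "conn F i v = (\<chi> k j. christoffel F k i j v)"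

definition shape ::
    "(real ^ 'n::finite \<Rightarrow> 'b::real_inner) \<Rightarrow> (real ^ 'n \<Rightarrow> 'b) \<Rightarrow> real ^ 'n \<Rightarrow> real ^ 'n ^ 'n" where
  "shape F N v = inv_form F v ** second_form F N v"

lemma first_form_eq_gram: "first_form F v = gram (\<lambda>i. pd i F v)"
  by (simp add: first_form_def gram_def)

lemma christoffel_eq_dual: "christoffel F k i j v = pd i (pd j F) v \<bullet> dual (\<lambda>i. pd i F v) k"
  by (simp add: christoffel_def dual_def inv_form_def first_form_eq_gram inner_sum_right)

text \<open>The normal is a given continuous field rather than a formula in \<open>F\<close>; its
  smoothness is derived in \<open>kdiff_N\<close>.\<close>

locale hypersurface =
  fixes W :: "(real ^ 'n::finite) set" and F :: "real ^ 'n \<Rightarrow> real ^ 'k::finite"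
    and N :: "real ^ 'n \<Rightarrow> real ^ 'k"
  assumes W: "open W" and F: "smooth_on W F" and cont_N: "continuous_on W N"
    and frame: "v \<in> W \<Longrightarrow> adapted_frame (\<lambda>i. pd i F v) (N v)"
begin

lemma kdiff_F: "kdiff k W F"
  by (rule smooth_on_imp_kdiff[OF W F])

lemma kdiff_pd_F: "kdiff k W (pd i F)"
  by (rule smooth_on_imp_kdiff[OF W smooth_on_pd[OF F]])

lemma kdiff_pd_pd_F: "kdiff k W (pd i (pd j F))"
  by (rule smooth_on_imp_kdiff[OF W smooth_on_pd[OF smooth_on_pd[OF F]]])

lemma kdiff_differentiable: "(\<And>k. kdiff k W f) \<Longrightarrow> v \<in> W \<Longrightarrow> f differentiable (at v)"
  using kdiff.simps(2) by blast

lemma kdiff_pd_commute: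
  fixes f :: "real ^ 'n \<Rightarrow> 'b::banach"
  assumes f: "\<And>k. kdiff k W f" and v: "v \<in> W"
  shows "pd i (pd j f) v = pd j (pd i f) v"
proof (rule pd_commute[OF W v])
  have fi: "kdiff k W (pd i f)" for k i using f[of "Suc k"] by simp
  have fij: "kdiff k W (pd j (pd i f))" for k using fi[of "Suc k"] by simp
  show "\<And>v. v \<in> W \<Longrightarrow> f differentiable (at v)" "\<And>i v. v \<in> W \<Longrightarrow> pd i f differentiable (at v)"
    using kdiff_differentiable f fi by blast+
  show "continuous_on W (pd j (pd i f))"
    using kdiff_differentiable[OF fij] W
    by (simp add: continuous_on_eq_continuous_at differentiable_imp_continuous_within)
qed

lemma kdiff_first_form: "kdiff k W (first_form F)"
  by (intro kdiff_vec_lambda[OF W])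
    (auto simp: first_form_def intro!: kdiff_bilinear[OF W bounded_bilinear_inner] kdiff_pd_F)

lemma det_first_form: "v \<in> W \<Longrightarrow> det (first_form F v) \<noteq> 0"
  unfolding first_form_eq_gram by (rule adapted_frame.det_gram[OF frame])

lemma kdiff_inv_form: "kdiff k W (inv_form F)"
  unfolding inv_form_def[abs_def]
  by (rule kdiff_matrix_inv[OF W det_first_form kdiff_first_form])

lemma second_form_sym: "v \<in> W \<Longrightarrow> second_form F N v $ i $ j = second_form F N v $ j $ i"
  by (simp add: second_form_def kdiff_pd_commute[OF kdiff_F, of v i j])

lemma transpose_second_form: "v \<in> W \<Longrightarrow> transpose (second_form F N v) = second_form F N v"
  by (simp add: transpose_def vec_eq_iff second_form_sym[of v "_ :: 'n"])

lemma transpose_inv_form: "v \<in> W \<Longrightarrow> transpose (inv_form F v) = inv_form F v"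
  unfolding inv_form_def first_form_eq_gram by (rule adapted_frame.transpose_gram_inv[OF frame])

lemma inv_form_sym: "v \<in> W \<Longrightarrow> inv_form F v $ i $ j = inv_form F v $ j $ i"
  unfolding inv_form_def first_form_eq_gram by (rule adapted_frame.gram_inv_sym[OF frame])

lemma N_differentiable: "v \<in> W \<Longrightarrow> N differentiable (at v)"
proof -
  assume v: "v \<in> W"
  have "N differentiable (at v within W)"
  proof (rule unit_normal_differentiable[OF v, where e = "\<lambda>i v. pd i F v"])
    show "(\<lambda>v. pd i F v) differentiable (at v within W)" for i
      using kdiff_differentiable[OF kdiff_pd_F v] differentiable_at_withinI by blast
    show "continuous (at v within W) N"
      using cont_N v by (simp add: continuous_on_eq_continuous_within)
  qed (rule frame)
  then show ?thesis unfolding at_within_open[OF v W] .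
qed

lemma pd_N_N: "v \<in> W \<Longrightarrow> pd i N v \<bullet> N v = 0"
proof -
  assume v: "v \<in> W"
  have "pd i (\<lambda>v. N v \<bullet> N v) v = pd i (\<lambda>v. 1) v"
    by (rule pd_cong[OF W v]) (use adapted_frame.N_N[OF frame] in blast)
  then show ?thesis
    by (simp add: pd_bilinear[OF bounded_bilinear_inner] N_differentiable[OF v] pd_const
        inner_commute)
qed

lemma pd_N_e: "v \<in> W \<Longrightarrow> pd i N v \<bullet> pd j F v = - second_form F N v $ i $ j"
proof -
  assume v: "v \<in> W"
  have "pd i (\<lambda>v. N v \<bullet> pd j F v) v = pd i (\<lambda>v. 0) v"
    by (rule pd_cong[OF W v]) (use adapted_frame.N_e[OF frame] in blast)
  then show ?thesis
    by (simp add: pd_bilinear[OF bounded_bilinear_inner] N_differentiable[OF v] pd_const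
        kdiff_differentiable[OF kdiff_pd_F v] second_form_def)
qed

lemma pd_N_dual: "v \<in> W \<Longrightarrow> pd i N v \<bullet> dual (\<lambda>i. pd i F v) k = - shape F N v $ k $ i"
  using second_form_sym
  by (simp add: adapted_frame.inner_dual[OF frame] pd_N_e shape_def matrix_matrix_mult_def
      inv_form_def first_form_eq_gram sum_negf)

lemma weingarten: "v \<in> W \<Longrightarrow> pd i N v = - (\<Sum>k\<in>UNIV. shape F N v $ k $ i *\<^sub>R pd k F v)"
  using adapted_frame.expand[OF frame, of v "pd i N v"]
  by (simp add: pd_N_dual pd_N_N sum_negf)

lemma gauss_formula: "v \<in> W \<Longrightarrow>
  pd i (pd j F) v = (\<Sum>k\<in>UNIV. conn F i v $ k $ j *\<^sub>R pd k F v) + second_form F N v $ i $ j *\<^sub>R N v"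
  using adapted_frame.expand[OF frame, of v "pd i (pd j F) v"]
  by (simp add: christoffel_eq_dual[symmetric] conn_def second_form_def inner_commute)

text \<open>A bootstrap through Weingarten's equation: if \<open>N\<close> has order
  \<open>k\<close>, so do the second fundamental form and the shape operator, hence the right-hand
  side of \<open>weingarten\<close>, which is \<open>pd i N\<close>.\<close>

lemma kdiff_N: "kdiff k W N"
proof (induction k)
  case (Suc k)
  have "kdiff k W (pd i N)" for i
  proof (rule kdiff_cong[OF W weingarten[symmetric]])
    have "kdiff k W (second_form F N)"
      by (intro kdiff_vec_lambda[OF W])
        (auto simp: second_form_def intro!: kdiff_bilinear[OF W bounded_bilinear_inner]
          kdiff_pd_pd_F Suc.IH)
    then have "kdiff k W (shape F N)"
      unfolding shape_def[abs_def]
      by (intro kdiff_bilinear[OF W bounded_bilinear_matrix_mult] kdiff_inv_form)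
    then show "kdiff k W (\<lambda>v. - (\<Sum>k\<in>UNIV. shape F N v $ k $ i *\<^sub>R pd k F v))"
      by (intro kdiff_linear[OF W bounded_linear_minus[OF bounded_linear_ident]] kdiff_sum[OF W]
          kdiff_bilinear[OF W bounded_bilinear_scaleR] kdiff_linear[OF W bounded_linear_vec_nth]
          kdiff_pd_F)
  qed
  then show ?case using N_differentiable by simp
qed simp

lemma kdiff_second_form: "kdiff k W (second_form F N)"
  by (intro kdiff_vec_lambda[OF W])
    (auto simp: second_form_def intro!: kdiff_bilinear[OF W bounded_bilinear_inner]
      kdiff_pd_pd_F kdiff_N)

lemma kdiff_shape: "kdiff k W (shape F N)"
  unfolding shape_def[abs_def]
  by (intro kdiff_bilinear[OF W bounded_bilinear_matrix_mult] kdiff_inv_form kdiff_second_form)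

lemma kdiff_conn: "kdiff k W (conn F i)"
  by (intro kdiff_vec_lambda[OF W])
    (auto simp: conn_def christoffel_def intro!: kdiff_sum[OF W]
      kdiff_bilinear[OF W bounded_bilinear_mult] kdiff_bilinear[OF W bounded_bilinear_inner]
      kdiff_pd_pd_F kdiff_pd_F kdiff_linear[OF W bounded_linear_vec_nth] kdiff_inv_form)

lemma conn_sym: "v \<in> W \<Longrightarrow> conn F i v $ k $ j = conn F j v $ k $ i"
  using kdiff_pd_commute[OF kdiff_F, of v i j] by (simp add: conn_def christoffel_def)

end

section \<open>Matrix algebra\<close>

text \<open>Oriented towards a normal form: sums are multiplied out and products bracketed to the
  right, so that a matrix identity becomes a linear one between words.\<close>

lemmas matrix_mult_simps =
  bounded_bilinear.add_left[OF bounded_bilinear_matrix_mult]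
  bounded_bilinear.add_right[OF bounded_bilinear_matrix_mult]
  bounded_bilinear.diff_left[OF bounded_bilinear_matrix_mult]
  bounded_bilinear.diff_right[OF bounded_bilinear_matrix_mult]
  bounded_bilinear.minus_left[OF bounded_bilinear_matrix_mult]
  bounded_bilinear.minus_right[OF bounded_bilinear_matrix_mult]
  bounded_bilinear.scaleR_left[OF bounded_bilinear_matrix_mult]
  bounded_bilinear.scaleR_right[OF bounded_bilinear_matrix_mult]
  bounded_bilinear.sum_left[OF bounded_bilinear_matrix_mult]
  bounded_bilinear.sum_right[OF bounded_bilinear_matrix_mult]
  matrix_mul_assoc[symmetric]

lemma matrix_mult_nth: "(A ** B) $ i $ j = (\<Sum>k\<in>UNIV. A $ i $ k * B $ k $ j)"
  by (simp add: matrix_matrix_mult_def)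

lemma bounded_linear_trace: "bounded_linear (trace :: real ^ 'n ^ 'n \<Rightarrow> real)"
  unfolding linear_conv_bounded_linear[symmetric] linear_iff
  by (simp add: trace_def sum.distrib sum_distrib_left)

lemmas trace_simps =
  linear_add[OF bounded_linear.linear[OF bounded_linear_trace]]
  linear_diff[OF bounded_linear.linear[OF bounded_linear_trace]]
  linear_neg[OF bounded_linear.linear[OF bounded_linear_trace]]
  linear_cmul[OF bounded_linear.linear[OF bounded_linear_trace]]
  linear_sum[OF bounded_linear.linear[OF bounded_linear_trace]]

lemma trace_transpose: "trace (transpose A) = trace A"
  by (simp add: trace_def transpose_def)

lemma trace_mult: "trace (A ** B) = (\<Sum>a\<in>UNIV. \<Sum>b\<in>UNIV. A $ a $ b * B $ b $ a)"
  by (simp add: trace_def matrix_mult_nth)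

lemma transpose_diff: "transpose (A - B) = transpose A - transpose B" for A B :: "real ^ 'n ^ 'm"
  by (simp add: transpose_def vec_eq_iff)

lemma sum_UNIV_prod: "(\<Sum>p\<in>UNIV. case_prod f p) = (\<Sum>a\<in>UNIV. \<Sum>b\<in>UNIV. f a b)"
  by (simp add: sum.cartesian_product)

text \<open>Contracts a curvature-type expression with the inverse metric. Simons' identity uses it
  with \<open>U = S\<close>, \<open>V = h ** S\<close> and with \<open>U = S ** S\<close>,
  \<open>V = h\<close>.\<close>

lemma sum_curvature_contraction:
  fixes G U V :: "real ^ 'n ^ 'n"
  assumes "transpose G = G"
  shows "(\<Sum>i\<in>UNIV. \<Sum>j\<in>UNIV. G $ i $ j * (U $ a $ i * V $ b $ j - U $ a $ b * V $ i $ j)) =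
    (U ** G ** transpose V) $ a $ b - U $ a $ b * trace (G ** V)"
proof -
  have "(U ** G ** transpose V) $ a $ b =
      (\<Sum>i\<in>UNIV. \<Sum>j\<in>UNIV. G $ i $ j * (U $ a $ i * V $ b $ j))"
    by (simp add: matrix_mult_simps matrix_mult_nth transpose_def sum_distrib_left mult_ac)
  moreover have "trace (G ** V) = (\<Sum>i\<in>UNIV. \<Sum>j\<in>UNIV. G $ i $ j * V $ i $ j)"
  proof -
    have "trace (G ** V) = trace (transpose G ** V)" by (simp add: assms)
    also have "\<dots> = (\<Sum>i\<in>UNIV. \<Sum>j\<in>UNIV. G $ j $ i * V $ j $ i)"
      by (simp add: trace_mult transpose_def)
    finally show ?thesis by (subst sum.swap)
  qed
  ultimately show ?thesis
    by (simp add: right_diff_distrib sum_subtractf sum_distrib_left mult_ac)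
qed

text \<open>The algebraic part of Simons' identity: \<open>P i j\<close> plays the role of the second covariant
  derivative of the shape operator \<open>S\<close>, whose total symmetry holds up to the curvature \<open>R\<close>.\<close>

lemma simons_contraction:
  fixes G h S :: "real ^ 'n ^ 'n" and P C R :: "'n \<Rightarrow> 'n \<Rightarrow> real ^ 'n ^ 'n"
  assumes G: "transpose G = G" and h: "transpose h = h" and S: "S = G ** h"
    and P: "\<And>i j. P i j = G ** C i j" and C: "\<And>i j. transpose (C i j) = C i j"
    and codazzi: "\<And>i j a b. P i j $ a $ b = P i b $ a $ j"
    and commute: "\<And>i j. P i j - P j i = R i j ** S - S ** R i j"
    and R: "\<And>i j k l. R i j $ k $ l = S $ k $ i * h $ j $ l - S $ k $ j * h $ i $ l"
  shows "(\<Sum>i\<in>UNIV. \<Sum>j\<in>UNIV. G $ i $ j * trace (S ** P i j)) =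
    trace (S ** G ** (\<chi> i j. trace (P j i))) + trace S * trace (S ** S ** S)
      - (trace (S ** S))\<^sup>2"
proof -
  define K where "K = (\<chi> i j. trace (P j i))"
  have P_sym: "P i b $ a $ j = P b i $ a $ j + (R i b ** S) $ a $ j - (S ** R i b) $ a $ j" for i b a j
    using arg_cong[OF commute[of i b], of "\<lambda>A. A $ a $ j"] by simp
  \<comment> \<open>Symmetry of \<open>C\<close> lets the contraction with \<open>G\<close> act on
    the row index, giving \<open>P b i $ i $ c\<close>; Codazzi turns this into
    \<open>P b c $ i $ i\<close>, whose sum over \<open>i\<close> is a trace.\<close>
  have first: "(\<Sum>i\<in>UNIV. \<Sum>j\<in>UNIV. G $ i $ j * P b i $ a $ j) = (G ** K) $ a $ b" for a b
  proof -
    have "(\<Sum>i\<in>UNIV. \<Sum>j\<in>UNIV. G $ i $ j * P b i $ a $ j) =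
        (\<Sum>i\<in>UNIV. \<Sum>j\<in>UNIV. \<Sum>c\<in>UNIV. G $ a $ c * (G $ i $ j * C b i $ j $ c))"
    proof (intro sum.cong refl)
      fix i j
      have "C b i $ c $ j = C b i $ j $ c" for c
        using arg_cong[OF C[of b i], of "\<lambda>A. A $ j $ c"] by (simp add: transpose_def)
      then show "G $ i $ j * P b i $ a $ j = (\<Sum>c\<in>UNIV. G $ a $ c * (G $ i $ j * C b i $ j $ c))"
        by (simp add: P matrix_mult_nth sum_distrib_left mult_ac)
    qed
    also have "\<dots> = (\<Sum>i\<in>UNIV. \<Sum>c\<in>UNIV. \<Sum>j\<in>UNIV. G $ a $ c * (G $ i $ j * C b i $ j $ c))"
      by (intro sum.cong refl sum.swap)
    also have "\<dots> = (\<Sum>c\<in>UNIV. \<Sum>i\<in>UNIV. \<Sum>j\<in>UNIV. G $ a $ c * (G $ i $ j * C b i $ j $ c))"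
      by (rule sum.swap)
    also have "\<dots> = (\<Sum>c\<in>UNIV. G $ a $ c * (\<Sum>i\<in>UNIV. P b i $ i $ c))"
      by (simp add: P matrix_mult_nth sum_distrib_left)
    also have "\<dots> = (\<Sum>c\<in>UNIV. G $ a $ c * trace (P b c))"
    proof -
      have "P b i $ i $ c = P b c $ i $ i" for i c by (rule codazzi)
      then show ?thesis by (simp only: trace_def)
    qed
    finally show ?thesis by (simp add: K_def matrix_mult_nth)
  qed
  have hS: "transpose (h ** S) = h ** S"
    by (simp add: S matrix_transpose_mul G h matrix_mul_assoc)
  have RS: "(\<Sum>i\<in>UNIV. \<Sum>j\<in>UNIV. G $ i $ j * (R i b ** S) $ a $ j) =
      (S ** S ** S) $ a $ b - S $ a $ b * trace (S ** S)" for a b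
  proof -
    have "(R i b ** S) $ a $ j = S $ a $ i * (h ** S) $ b $ j - S $ a $ b * (h ** S) $ i $ j" for i j
      by (simp add: matrix_mult_nth R left_diff_distrib sum_subtractf sum_distrib_left mult.assoc)
    then have "(\<Sum>i\<in>UNIV. \<Sum>j\<in>UNIV. G $ i $ j * (R i b ** S) $ a $ j) =
        (S ** G ** transpose (h ** S)) $ a $ b - S $ a $ b * trace (G ** (h ** S))"
      by (simp add: sum_curvature_contraction[OF G])
    also have "S ** G ** transpose (h ** S) = S ** S ** S"
      by (simp add: hS, simp add: S matrix_mul_assoc)
    also have "G ** (h ** S) = S ** S" by (simp add: S matrix_mul_assoc)
    finally show ?thesis .
  qed
  have SR: "(\<Sum>i\<in>UNIV. \<Sum>j\<in>UNIV. G $ i $ j * (S ** R i b) $ a $ j) =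
      (S ** S ** S) $ a $ b - (S ** S) $ a $ b * trace S" for a b
  proof -
    have "(S ** R i b) $ a $ j = (S ** S) $ a $ i * h $ b $ j - (S ** S) $ a $ b * h $ i $ j" for i j
      by (simp add: matrix_mult_nth R right_diff_distrib sum_subtractf sum_distrib_right mult.assoc)
    then have "(\<Sum>i\<in>UNIV. \<Sum>j\<in>UNIV. G $ i $ j * (S ** R i b) $ a $ j) =
        (S ** S ** G ** transpose h) $ a $ b - (S ** S) $ a $ b * trace (G ** h)"
      by (simp add: sum_curvature_contraction[OF G])
    also have "S ** S ** G ** transpose h = S ** S ** S" by (simp add: h, simp add: S matrix_mul_assoc)
    also have "G ** h = S" by (simp add: S)
    finally show ?thesis .
  qed
  \<comment> \<open>The cubic terms of \<open>RS\<close> and \<open>SR\<close> are equal and cancel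
    in the commutator; only multiples of \<open>S\<close> and \<open>S ** S\<close> survive.\<close>
  have inner: "(\<Sum>i\<in>UNIV. \<Sum>j\<in>UNIV. G $ i $ j * P i b $ a $ j) =
      (G ** K - trace (S ** S) *\<^sub>R S + trace S *\<^sub>R (S ** S)) $ a $ b" for a b
    by (simp add: P_sym[of _ b a] distrib_left right_diff_distrib sum.distrib sum_subtractf first RS SR)
  \<comment> \<open>Codazzi moves the contracted index \<open>j\<close> into the last slot; the sums
    are then reordered until the contraction computed in \<open>inner\<close> is innermost.\<close>
  have "(\<Sum>i\<in>UNIV. \<Sum>j\<in>UNIV. G $ i $ j * trace (S ** P i j)) =
      (\<Sum>i\<in>UNIV. \<Sum>j\<in>UNIV. \<Sum>b\<in>UNIV. \<Sum>a\<in>UNIV. S $ b $ a * (G $ i $ j * P i b $ a $ j))"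
    unfolding trace_mult sum_distrib_left
  proof (intro sum.cong refl)
    fix i j b a
    show "G $ i $ j * (S $ b $ a * P i j $ a $ b) = S $ b $ a * (G $ i $ j * P i b $ a $ j)"
      using codazzi[of i j a b] by simp
  qed
  also have "\<dots> = (\<Sum>i\<in>UNIV. \<Sum>b\<in>UNIV. \<Sum>j\<in>UNIV. \<Sum>a\<in>UNIV. S $ b $ a * (G $ i $ j * P i b $ a $ j))"
    by (intro sum.cong refl sum.swap)
  also have "\<dots> = (\<Sum>b\<in>UNIV. \<Sum>i\<in>UNIV. \<Sum>j\<in>UNIV. \<Sum>a\<in>UNIV. S $ b $ a * (G $ i $ j * P i b $ a $ j))"
    by (rule sum.swap)
  also have "\<dots> = (\<Sum>b\<in>UNIV. \<Sum>i\<in>UNIV. \<Sum>a\<in>UNIV. \<Sum>j\<in>UNIV. S $ b $ a * (G $ i $ j * P i b $ a $ j))"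
    by (intro sum.cong refl sum.swap)
  also have "\<dots> = (\<Sum>b\<in>UNIV. \<Sum>a\<in>UNIV. \<Sum>i\<in>UNIV. \<Sum>j\<in>UNIV. S $ b $ a * (G $ i $ j * P i b $ a $ j))"
    by (intro sum.cong refl sum.swap)
  also have "\<dots> = (\<Sum>b\<in>UNIV. \<Sum>a\<in>UNIV. S $ b $ a *
      (G ** K - trace (S ** S) *\<^sub>R S + trace S *\<^sub>R (S ** S)) $ a $ b)"
    by (simp only: sum_distrib_left[symmetric] inner)
  also have "\<dots> = trace (S ** (G ** K - trace (S ** S) *\<^sub>R S + trace S *\<^sub>R (S ** S)))"
    by (simp only: trace_mult)
  also have "\<dots> = trace (S ** G ** K) + trace S * trace (S ** S ** S) - (trace (S ** S))\<^sup>2"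
    by (simp add: matrix_mult_simps trace_simps power2_eq_square)
  finally show ?thesis by (simp add: K_def)
qed

context hypersurface
begin

section \<open>The structure equations\<close>

definition covdA :: "'n \<Rightarrow> real ^ 'n \<Rightarrow> real ^ 'n ^ 'n" where
  "covdA i v = (\<chi> j l. nabla_A F N i j l v)"

lemma pd_third:
  assumes v: "v \<in> W"
  shows "pd i (pd j (pd l F)) v = (\<Sum>k\<in>UNIV. pd i (conn F j) v $ k $ l *\<^sub>R pd k F v
      + conn F j v $ k $ l *\<^sub>R pd i (pd k F) v)
    + (pd i (second_form F N) v $ j $ l *\<^sub>R N v + second_form F N v $ j $ l *\<^sub>R pd i N v)"
proof -
  have c: "(\<lambda>v. conn F j v $ k $ l) differentiable (at v)" for k
    by (intro differentiable_bounded_linear[OF bounded_linear_vec_nth]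
        kdiff_differentiable[OF kdiff_conn v])
  have h: "(\<lambda>v. second_form F N v $ j $ l) differentiable (at v)"
    by (intro differentiable_bounded_linear[OF bounded_linear_vec_nth]
        kdiff_differentiable[OF kdiff_second_form v])
  have nth: "pd i (\<lambda>v. M v $ k $ l) v = pd i M v $ k $ l"
    if "M differentiable (at v)" for M :: "real ^ 'n \<Rightarrow> real ^ 'n ^ 'n" and k l
    using that by (simp add: pd_nth differentiable_bounded_linear[OF bounded_linear_vec_nth])
  have "pd i (pd j (pd l F)) v = pd i (\<lambda>v. (\<Sum>k\<in>UNIV. conn F j v $ k $ l *\<^sub>R pd k F v)
      + second_form F N v $ j $ l *\<^sub>R N v) v"
    by (rule pd_cong[OF W v gauss_formula])
  then show ?thesis
    using c h kdiff_differentiable[OF kdiff_pd_F v] N_differentiable[OF v]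
    by (simp add: pd_add pd_sum pd_bilinear[OF bounded_bilinear_scaleR] differentiable_sum
        differentiable_bilinear[OF bounded_bilinear_scaleR] nth
        kdiff_differentiable[OF kdiff_conn v] kdiff_differentiable[OF kdiff_second_form v] add_ac)
qed

lemma pd_third_commute: "v \<in> W \<Longrightarrow> pd i (pd j (pd l F)) v = pd j (pd i (pd l F)) v"
  by (rule kdiff_pd_commute[OF kdiff_pd_F])

lemma pd_second_form_commute:
  assumes v: "v \<in> W"
  shows "pd i (second_form F N) v $ j $ l + (\<Sum>k\<in>UNIV. conn F j v $ k $ l * second_form F N v $ i $ k)
    = pd j (second_form F N) v $ i $ l + (\<Sum>k\<in>UNIV. conn F i v $ k $ l * second_form F N v $ j $ k)"
proof -
  interpret adapted_frame "\<lambda>i. pd i F v" "N v" by (rule frame[OF v])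
  have "pd i (pd j (pd l F)) v \<bullet> N v = pd i (second_form F N) v $ j $ l
      + (\<Sum>k\<in>UNIV. conn F j v $ k $ l * second_form F N v $ i $ k)" for i j
    by (simp add: pd_third[OF v] inner_add_left inner_sum_left e_N N_N pd_N_N[OF v] second_form_def
        inner_commute[of "pd _ (pd _ F) v" "N v"])
  then show ?thesis using pd_third_commute[OF v] by metis
qed

text \<open>The Gauss equation with the curvature as a matrix. Pairing \<open>pd_third\<close> with
  the dual frame keeps the tangential coefficients, and the term with \<open>pd i N\<close> supplies
  the product of shape operator and second fundamental form.\<close>

lemma pd_conn_commute:
  assumes v: "v \<in> W"
  shows "pd i (conn F j) v + conn F i v ** conn F j v - (pd j (conn F i) v + conn F j v ** conn F i v)
    = (\<chi> k l. shape F N v $ k $ i * second_form F N v $ j $ l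
        - shape F N v $ k $ j * second_form F N v $ i $ l)"
proof -
  interpret adapted_frame "\<lambda>i. pd i F v" "N v" by (rule frame[OF v])
  have eq: "pd i (pd j (pd l F)) v \<bullet> dual (\<lambda>i. pd i F v) m = (pd i (conn F j) v
      + conn F i v ** conn F j v) $ m $ l - shape F N v $ m $ i * second_form F N v $ j $ l" for i j l m
  proof -
    have "pd i (pd k F) v \<bullet> dual (\<lambda>i. pd i F v) m = conn F i v $ m $ k" for k
      by (simp add: conn_def christoffel_eq_dual)
    then show ?thesis
      by (simp add: pd_third[OF v] inner_add_left inner_sum_left sum.distrib
          inner_commute[of "pd _ F v" "dual _ _"] inner_commute[of "N v" "dual _ _"] dual_e dual_N
          pd_N_dual[OF v] matrix_mult_nth if_distrib mult_ac cong: if_cong)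
  qed
  show ?thesis
    unfolding vec_eq_iff
  proof (intro allI)
    fix m l
    show "(pd i (conn F j) v + conn F i v ** conn F j v
        - (pd j (conn F i) v + conn F j v ** conn F i v)) $ m $ l =
      (\<chi> k l. shape F N v $ k $ i * second_form F N v $ j $ l
        - shape F N v $ k $ j * second_form F N v $ i $ l) $ m $ l"
      using eq[of i j l m] eq[of j i l m] pd_third_commute[OF v, of i j l] by simp
  qed
qed

text \<open>The connection is compatible with the metric: the normal part of the Gauss formula is
  orthogonal to the frame and drops out.\<close>

lemma pd_first_form:
  assumes v: "v \<in> W"
  shows "pd i (first_form F) v = first_form F v ** conn F i v + transpose (conn F i v) ** first_form F v"
proof -
  interpret adapted_frame "\<lambda>i. pd i F v" "N v" by (rule frame[OF v])
  have d: "first_form F differentiable (at v)" by (rule kdiff_differentiable[OF kdiff_first_form v])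
  have entry: "pd i (first_form F) v $ a $ b = pd i (pd a F) v \<bullet> pd b F v + pd a F v \<bullet> pd i (pd b F) v"
    for a b
  proof -
    have "pd i (first_form F) v $ a $ b = pd i (\<lambda>v. first_form F v $ a $ b) v"
      using d by (simp add: pd_nth differentiable_bounded_linear[OF bounded_linear_vec_nth])
    then show ?thesis
      by (simp add: first_form_def pd_bilinear[OF bounded_bilinear_inner]
          kdiff_differentiable[OF kdiff_pd_F v])
  qed
  have *: "pd i (pd a F) v \<bullet> pd b F v = (\<Sum>k\<in>UNIV. conn F i v $ k $ a * first_form F v $ k $ b)" for a b
    by (simp add: gauss_formula[OF v] inner_add_left inner_sum_left N_e first_form_def)
  show ?thesis
    by (simp add: vec_eq_iff entry inner_commute[of "pd _ F v" "pd i _ v"] *,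
        simp add: matrix_mult_nth transpose_def first_form_def inner_commute mult_ac)
qed

lemma inv_form_mult: "v \<in> W \<Longrightarrow> inv_form F v ** first_form F v = mat 1"
  "v \<in> W \<Longrightarrow> first_form F v ** inv_form F v = mat 1"
  unfolding inv_form_def using matrix_inv_left_right det_first_form by blast+

lemma pd_inv_form:
  assumes v: "v \<in> W"
  shows "pd i (inv_form F) v = - (conn F i v ** inv_form F v + inv_form F v ** transpose (conn F i v))"
proof -
  have "pd i (inv_form F) v = - (inv_form F v ** pd i (first_form F) v ** inv_form F v)"
    unfolding inv_form_def[abs_def]
    by (rule pd_matrix_inv[OF kdiff_differentiable[OF kdiff_first_form v] det_first_form[OF v]])
  also have "inv_form F v ** pd i (first_form F) v ** inv_form F v =
     (inv_form F v ** first_form F v) ** conn F i v ** inv_form F v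
       + inv_form F v ** transpose (conn F i v) ** (first_form F v ** inv_form F v)"
    by (simp add: pd_first_form[OF v] matrix_mult_simps)
  finally show ?thesis by (simp add: inv_form_mult[OF v])
qed

lemma covdA_eq: "v \<in> W \<Longrightarrow> covdA i v = pd i (second_form F N) v
    - transpose (conn F i v) ** second_form F N v - second_form F N v ** conn F i v"
  using kdiff_differentiable[OF kdiff_second_form]
  by (simp add: covdA_def vec_eq_iff nabla_A_def matrix_mult_nth conn_def transpose_def
      pd_nth differentiable_bounded_linear[OF bounded_linear_vec_nth] mult_ac)

lemma kdiff_diff: "kdiff k W f \<Longrightarrow> kdiff k W g \<Longrightarrow> kdiff k W (\<lambda>v. f v - g v)"
  using kdiff_add[OF W, of k f "\<lambda>v. - g v"]
    kdiff_linear[OF W bounded_linear_minus[OF bounded_linear_ident], of k g] by simp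

lemma kdiff_pd: "(\<And>k. kdiff k W f) \<Longrightarrow> kdiff k W (pd i f)"
  using kdiff.simps(2) by blast

lemma bounded_linear_transpose: "bounded_linear (transpose :: real ^ 'n ^ 'n \<Rightarrow> _)"
  unfolding linear_conv_bounded_linear[symmetric] linear_iff
  by (simp add: transpose_def vec_eq_iff)

lemma transpose_pd:
  fixes M :: "real ^ 'n \<Rightarrow> real ^ 'n ^ 'n"
  assumes "\<And>k. kdiff k W M" "\<And>v. v \<in> W \<Longrightarrow> transpose (M v) = M v" "v \<in> W"
  shows "transpose (pd i M v) = pd i M v"
proof -
  have "transpose (pd i M v) = pd i (\<lambda>v. transpose (M v)) v"
    by (rule pd_linear[OF bounded_linear_transpose kdiff_differentiable[OF assms(1,3)], symmetric])
  also have "\<dots> = pd i M v"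
    by (rule pd_cong[OF W assms(3,2)])
  finally show ?thesis .
qed

lemma transpose_covdA: "v \<in> W \<Longrightarrow> transpose (covdA i v) = covdA i v"
  by (simp add: covdA_eq transpose_diff
      transpose_pd[OF kdiff_second_form transpose_second_form] matrix_transpose_mul
      transpose_second_form)

text \<open>Of the two connection terms in \<open>covdA_eq\<close>, one is symmetric in
  \<open>i\<close> and \<open>a\<close> because the connection is torsion free; the other is the one
  occurring in \<open>pd_second_form_commute\<close>.\<close>

lemma codazzi:
  assumes v: "v \<in> W"
  shows "covdA i v $ a $ b = covdA a v $ i $ b"
  using pd_second_form_commute[OF v, of i a b]
  by (simp add: covdA_eq[OF v] matrix_mult_nth transpose_def conn_sym[OF v, of i _ a] mult_ac)

section \<open>Simons' identity\<close>

definition covdS :: "'n \<Rightarrow> real ^ 'n \<Rightarrow> real ^ 'n ^ 'n" where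
  "covdS i v = inv_form F v ** covdA i v"

text \<open>The sum over \<open>k\<close> corrects for the direction index \<open>j\<close>. It
  makes this the second covariant derivative as a tensor, so that the Codazzi symmetry extends to
  \<open>j\<close>.\<close>

definition covd2A :: "'n \<Rightarrow> 'n \<Rightarrow> real ^ 'n \<Rightarrow> real ^ 'n ^ 'n" where
  "covd2A i j v = pd i (covdA j) v - transpose (conn F i v) ** covdA j v - covdA j v ** conn F i v
     - (\<Sum>k\<in>UNIV. conn F i v $ k $ j *\<^sub>R covdA k v)"

definition covd2S :: "'n \<Rightarrow> 'n \<Rightarrow> real ^ 'n \<Rightarrow> real ^ 'n ^ 'n" where
  "covd2S i j v = pd i (covdS j) v + conn F i v ** covdS j v - covdS j v ** conn F i v
     - (\<Sum>k\<in>UNIV. conn F i v $ k $ j *\<^sub>R covdS k v)"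

definition hessian :: "(real ^ 'n \<Rightarrow> real) \<Rightarrow> real ^ 'n \<Rightarrow> real ^ 'n ^ 'n" where
  "hessian f v = (\<chi> i j. pd i (pd j f) v - (\<Sum>k\<in>UNIV. christoffel F k i j v * pd k f v))"

lemma kdiff_covdA: "kdiff k W (covdA i)"
proof (rule kdiff_cong[OF W])
  show "kdiff k W (\<lambda>v. pd i (second_form F N) v
    - transpose (conn F i v) ** second_form F N v - second_form F N v ** conn F i v)"
    by (intro kdiff_diff kdiff_pd kdiff_second_form kdiff_bilinear[OF W bounded_bilinear_matrix_mult]
        kdiff_conn kdiff_linear[OF W bounded_linear_transpose])
qed (simp add: covdA_eq)

lemma kdiff_covdS: "kdiff k W (covdS i)"
  unfolding covdS_def[abs_def]
  by (intro kdiff_bilinear[OF W bounded_bilinear_matrix_mult] kdiff_inv_form kdiff_covdA)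

lemma pd_shape:
  assumes v: "v \<in> W"
  shows "pd i (shape F N) v = covdS i v - conn F i v ** shape F N v + shape F N v ** conn F i v"
proof -
  have "pd i (shape F N) v = pd i (inv_form F) v ** second_form F N v
      + inv_form F v ** pd i (second_form F N) v"
    unfolding shape_def[abs_def]
    by (intro pd_bilinear[OF bounded_bilinear_matrix_mult] kdiff_differentiable[OF kdiff_inv_form v]
        kdiff_differentiable[OF kdiff_second_form v])
  then show ?thesis
    by (simp add: pd_inv_form[OF v] covdS_def covdA_eq[OF v] shape_def matrix_mult_simps)
qed

lemma transpose_covd2A:
  assumes v: "v \<in> W"
  shows "transpose (covd2A i j v) = covd2A i j v"
  by (simp add: covd2A_def transpose_diff transpose_pd[OF kdiff_covdA transpose_covdA v]
      matrix_transpose_mul transpose_covdA[OF v]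
      linear_sum[OF bounded_linear.linear[OF bounded_linear_transpose]]
      linear_cmul[OF bounded_linear.linear[OF bounded_linear_transpose]])

text \<open>The inverse metric is parallel, so raising an index commutes with covariant
  differentiation: \<open>pd_inv_form\<close> converts the connection term of a lower index into
  that of an upper one.\<close>

lemma covd2S_eq:
  assumes v: "v \<in> W"
  shows "covd2S i j v = inv_form F v ** covd2A i j v"
proof -
  have "pd i (covdS j) v = pd i (inv_form F) v ** covdA j v + inv_form F v ** pd i (covdA j) v"
    unfolding covdS_def[abs_def]
    by (intro pd_bilinear[OF bounded_bilinear_matrix_mult] kdiff_differentiable[OF kdiff_inv_form v]
        kdiff_differentiable[OF kdiff_covdA v])
  then show ?thesis
    by (simp add: covd2S_def covd2A_def pd_inv_form[OF v] covdS_def matrix_mult_simps)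
qed

lemma covdS_codazzi:
  assumes v: "v \<in> W"
  shows "covdS j v $ a $ b = covdS b v $ a $ j"
proof -
  have sym: "covdA i v $ a $ b = covdA i v $ b $ a" for i a b
    using arg_cong[OF transpose_covdA[OF v], of "\<lambda>A. A $ b $ a" i] by (simp add: transpose_def)
  have "covdA j v $ c $ b = covdA b v $ c $ j" for c
    using sym[of j c b] codazzi[OF v, of j b c] sym[of b j c] by simp
  then show ?thesis by (simp add: covdS_def matrix_mult_nth)
qed

lemma covd2S_codazzi:
  assumes v: "v \<in> W"
  shows "covd2S i j v $ a $ b = covd2S i b v $ a $ j"
proof -
  have nth: "pd i (covdS j) v $ a $ b = pd i (\<lambda>v. covdS j v $ a $ b) v" for j b
    using kdiff_differentiable[OF kdiff_covdS v]
    by (simp add: pd_nth differentiable_bounded_linear[OF bounded_linear_vec_nth])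
  have "pd i (\<lambda>v. covdS j v $ a $ b) v = pd i (\<lambda>v. covdS b v $ a $ j) v"
    by (rule pd_cong[OF W v covdS_codazzi])
  then have "pd i (covdS j) v $ a $ b = pd i (covdS b) v $ a $ j" by (simp add: nth)
  then show ?thesis
    by (simp add: covd2S_def matrix_mult_nth covdS_codazzi[OF v, of j _ b]
        covdS_codazzi[OF v, of j a] covdS_codazzi[OF v, of b a] mult_ac)
qed

text \<open>The Ricci identity: operators of the form \<open>pd i\<close> plus a commutator with
  \<open>conn F i\<close> commute up to the commutator with the curvature, which
  \<open>pd_conn_commute\<close> identifies as \<open>R\<close>. The corrections for the direction
  index are symmetric in \<open>i\<close> and \<open>j\<close> and cancel.\<close>

lemma covd2S_commute:
  assumes v: "v \<in> W"
  defines "R \<equiv> \<lambda>i j. \<chi> k l. shape F N v $ k $ i * second_form F N v $ j $ l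
        - shape F N v $ k $ j * second_form F N v $ i $ l"
  shows "covd2S i j v - covd2S j i v = R i j ** shape F N v - shape F N v ** R i j"
proof -
  have T: "pd i (covdS j) v = pd i (pd j (shape F N)) v
      + (pd i (conn F j) v ** shape F N v + conn F j v ** pd i (shape F N) v)
      - (pd i (shape F N) v ** conn F j v + shape F N v ** pd i (conn F j) v)" for i j
  proof -
    have dS: "shape F N differentiable (at v)" "pd j (shape F N) differentiable (at v)"
      and dc: "conn F j differentiable (at v)"
      using kdiff_differentiable[OF kdiff_shape v] kdiff_differentiable[OF kdiff_pd[OF kdiff_shape] v]
        kdiff_differentiable[OF kdiff_conn v] by auto
    have "pd i (covdS j) v = pd i (\<lambda>v. pd j (shape F N) v
        + (conn F j v ** shape F N v + (- shape F N v) ** conn F j v)) v"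
      by (rule pd_cong[OF W v]) (simp add: pd_shape matrix_mult_simps)
    also have "\<dots> = pd i (pd j (shape F N)) v
        + ((pd i (conn F j) v ** shape F N v + conn F j v ** pd i (shape F N) v)
        + (- pd i (shape F N) v ** conn F j v + (- shape F N v) ** pd i (conn F j) v))"
      using dS dc
      by (simp add: pd_add pd_bilinear[OF bounded_bilinear_matrix_mult] differentiable_add
          differentiable_bilinear[OF bounded_bilinear_matrix_mult] differentiable_minus
          pd_linear[OF bounded_linear_minus[OF bounded_linear_ident]])
    finally show ?thesis by (simp add: matrix_mult_simps)
  qed
  have R: "R i j = pd i (conn F j) v + conn F i v ** conn F j v
      - (pd j (conn F i) v + conn F j v ** conn F i v)"
    unfolding R_def by (rule pd_conn_commute[OF v, symmetric])
  have sym: "(\<Sum>k\<in>UNIV. conn F i v $ k $ j *\<^sub>R covdS k v) = (\<Sum>k\<in>UNIV. conn F j v $ k $ i *\<^sub>R covdS k v)"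
    by (simp add: conn_sym[OF v, of i _ j])
  have S2: "pd i (pd j (shape F N)) v = pd j (pd i (shape F N)) v"
    by (rule kdiff_pd_commute[OF kdiff_shape v])
  have cS: "covdS j v = pd j (shape F N) v + conn F j v ** shape F N v - shape F N v ** conn F j v" for j
    by (simp add: pd_shape[OF v])
  show ?thesis
    unfolding covd2S_def sym unfolding T R S2 unfolding cS
    by (simp add: matrix_mult_simps algebra_simps)
qed

section \<open>Mean curvature, |A|^2 and their Hessians as traces\<close>

lemma mean_curv_eq_trace: "v \<in> W \<Longrightarrow> mean_curv F N v = trace (shape F N v)"
  by (simp add: mean_curv_def sum_UNIV_prod shape_def trace_mult second_form_sym[of v])

lemma norm_A_sq_eq_trace:
  assumes v: "v \<in> W"
  shows "norm_A_sq F N v = trace (shape F N v ** shape F N v)"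
proof -
  have "trace (shape F N v ** shape F N v) = (\<Sum>(a, b, c, d)\<in>UNIV. inv_form F v $ a $ b *
      (second_form F N v $ b $ c * (inv_form F v $ c $ d * second_form F N v $ d $ a)))"
    by (simp add: shape_def matrix_mult_simps trace_def matrix_mult_nth sum_UNIV_prod
        sum_distrib_left)
  also have "\<dots> = norm_A_sq F N v"
    unfolding norm_A_sq_def
    by (rule sum.reindex_bij_witness[where i = "\<lambda>(i, j, k, l). (i, j, l, k)" and
          j = "\<lambda>(a, b, c, d). (a, b, d, c)"])
      (auto simp: inv_form_sym[OF v] second_form_sym[OF v])
  finally show ?thesis by simp
qed

lemma norm_nabla_A_sq_eq_trace:
  assumes v: "v \<in> W"
  shows "norm_nabla_A_sq F N v =
    (\<Sum>k\<in>UNIV. \<Sum>r\<in>UNIV. inv_form F v $ k $ r * trace (covdS k v ** covdS r v))"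
proof -
  have sym: "nabla_A F N i a b v = nabla_A F N i b a v" for i a b
    using arg_cong[OF transpose_covdA[OF v], of "\<lambda>A. A $ b $ a" i]
    by (simp add: transpose_def covdA_def)
  have "(\<Sum>k\<in>UNIV. \<Sum>r\<in>UNIV. inv_form F v $ k $ r * trace (covdS k v ** covdS r v)) =
      (\<Sum>(k, r, p, i, j, q)\<in>UNIV. inv_form F v $ k $ r * (inv_form F v $ p $ i *
        (nabla_A F N k i j v * (inv_form F v $ j $ q * nabla_A F N r q p v))))"
    by (simp add: covdS_def covdA_def matrix_mult_simps trace_def matrix_mult_nth sum_UNIV_prod
        sum_distrib_left)
  \<comment> \<open>The renaming follows the cyclic chain of the trace; symmetry of the inverse
    metric and of \<open>nabla_A\<close> in its tensor indices matches the factors.\<close>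
  also have "\<dots> = norm_nabla_A_sq F N v"
    unfolding norm_nabla_A_sq_def
    by (rule sum.reindex_bij_witness[where i = "\<lambda>(i, p, j, q, k, r). (k, r, p, i, j, q)" and
          j = "\<lambda>(k, r, p, i, j, q). (i, p, j, q, k, r)"])
      (auto simp: inv_form_sym[OF v] sym)
  finally show ?thesis by simp
qed

lemma pd_trace:
  fixes M :: "real ^ 'n \<Rightarrow> real ^ 'n ^ 'n"
  shows "M differentiable (at v) \<Longrightarrow> pd i (\<lambda>v. trace (M v)) v = trace (pd i M v)"
  by (rule pd_linear[OF bounded_linear_trace])

text \<open>In \<open>pd_shape\<close> the connection occurs as a commutator, whose trace
  vanishes.\<close>

lemma pd_mean_curv:
  assumes v: "v \<in> W"
  shows "pd i (mean_curv F N) v = trace (covdS i v)"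
proof -
  have "pd i (mean_curv F N) v = pd i (\<lambda>v. trace (shape F N v)) v"
    by (rule pd_cong[OF W v mean_curv_eq_trace])
  then show ?thesis
    by (simp add: pd_trace kdiff_differentiable[OF kdiff_shape v] pd_shape[OF v] trace_simps
        trace_mul_sym[of "conn F i v"])
qed

lemma pd_norm_A_sq:
  assumes v: "v \<in> W"
  shows "pd i (norm_A_sq F N) v = 2 * trace (shape F N v ** covdS i v)"
proof -
  have d: "shape F N differentiable (at v)" by (rule kdiff_differentiable[OF kdiff_shape v])
  have "pd i (norm_A_sq F N) v = pd i (\<lambda>v. trace (shape F N v ** shape F N v)) v"
    by (rule pd_cong[OF W v norm_A_sq_eq_trace])
  also have "\<dots> = trace (pd i (shape F N) v ** shape F N v + shape F N v ** pd i (shape F N) v)"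
    by (simp add: pd_trace d pd_bilinear[OF bounded_bilinear_matrix_mult]
        differentiable_bilinear[OF bounded_bilinear_matrix_mult])
  also have "\<dots> = 2 * trace (shape F N v ** pd i (shape F N) v)"
    by (simp add: trace_simps trace_mul_sym[of "pd i (shape F N) v"])
  also have "trace (shape F N v ** pd i (shape F N) v) = trace (shape F N v ** covdS i v)"
    using trace_mul_sym[of "shape F N v" "conn F i v ** shape F N v"]
      trace_mul_sym[of "shape F N v ** shape F N v" "conn F i v"]
    by (simp add: pd_shape[OF v] trace_simps matrix_mult_simps)
  finally show ?thesis .
qed

lemma hessian_mean_curv:
  assumes v: "v \<in> W"
  shows "hessian (mean_curv F N) v $ i $ j = trace (covd2S i j v)"
proof -
  have "pd i (pd j (mean_curv F N)) v = pd i (\<lambda>v. trace (covdS j v)) v"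
    by (rule pd_cong[OF W v pd_mean_curv])
  also have "\<dots> = trace (pd i (covdS j) v)"
    by (rule pd_trace[OF kdiff_differentiable[OF kdiff_covdS v]])
  finally show ?thesis
    by (simp add: hessian_def covd2S_def pd_mean_curv[OF v] trace_simps conn_def
        trace_mul_sym[of "_ :: real^'n^'n" "covdS j v"])
qed

lemma hessian_norm_A_sq:
  assumes v: "v \<in> W"
  shows "hessian (norm_A_sq F N) v $ i $ j =
    2 * trace (covdS i v ** covdS j v) + 2 * trace (shape F N v ** covd2S i j v)"
proof -
  have dS: "shape F N differentiable (at v)" and dT: "covdS j differentiable (at v)"
    using kdiff_differentiable[OF kdiff_shape v] kdiff_differentiable[OF kdiff_covdS v] by auto
  then have dST: "(\<lambda>v. shape F N v ** covdS j v) differentiable (at v)"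
    by (rule differentiable_bilinear[OF bounded_bilinear_matrix_mult])
  have "pd i (pd j (norm_A_sq F N)) v = pd i (\<lambda>v. trace (2 *\<^sub>R (shape F N v ** covdS j v))) v"
    by (rule pd_cong[OF W v]) (simp add: pd_norm_A_sq trace_simps)
  also have "\<dots> = trace (2 *\<^sub>R (pd i (shape F N) v ** covdS j v + shape F N v ** pd i (covdS j) v))"
    using differentiable_bounded_linear[OF bounded_linear_scaleR_right dST]
      pd_linear[OF bounded_linear_scaleR_right dST]
    by (simp add: pd_trace pd_bilinear[OF bounded_bilinear_matrix_mult dS dT])
  finally show ?thesis
    using trace_mul_sym[of "conn F i v" "shape F N v ** covdS j v"]
    by (simp add: hessian_def covd2S_def pd_norm_A_sq[OF v] trace_simps conn_def pd_shape[OF v]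
        matrix_mult_simps sum_distrib_left algebra_simps)
qed

lemma laplace_form_eq:
  "laplace_form F f v = (\<Sum>i\<in>UNIV. \<Sum>j\<in>UNIV. inv_form F v $ i $ j * hessian f v $ i $ j)"
  by (simp add: laplace_form_def hessian_def sum_UNIV_prod)

text \<open>By the Ricci identity the antisymmetric part is the trace of a commutator.\<close>

lemma hessian_mean_curv_sym:
  assumes "v \<in> W"
  shows "hessian (mean_curv F N) v $ i $ j = hessian (mean_curv F N) v $ j $ i"
  using arg_cong[OF covd2S_commute[OF assms, of i j], of trace]
  by (simp add: hessian_mean_curv[OF assms] trace_simps trace_mul_sym[of "shape F N v"])

theorem simons:
  assumes v: "v \<in> W"
  shows "laplace_form F (norm_A_sq F N) v = 2 * norm_nabla_A_sq F N v
    + 2 * trace (shape F N v ** inv_form F v ** hessian (mean_curv F N) v)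
    + 2 * mean_curv F N v * trace (shape F N v ** shape F N v ** shape F N v)
    - 2 * (norm_A_sq F N v)\<^sup>2"
proof -
  have "(\<Sum>i\<in>UNIV. \<Sum>j\<in>UNIV. inv_form F v $ i $ j * trace (shape F N v ** covd2S i j v)) =
      trace (shape F N v ** inv_form F v ** (\<chi> i j. trace (covd2S j i v)))
      + trace (shape F N v) * trace (shape F N v ** shape F N v ** shape F N v)
      - (trace (shape F N v ** shape F N v))\<^sup>2"
    by (rule simons_contraction[where h = "second_form F N v" and C = "\<lambda>i j. covd2A i j v",
          OF transpose_inv_form[OF v] transpose_second_form[OF v] shape_def covd2S_eq[OF v]
          transpose_covd2A[OF v] covd2S_codazzi[OF v] covd2S_commute[OF v]]) simp
  also have "(\<chi> i j. trace (covd2S j i v)) = hessian (mean_curv F N) v"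
    using hessian_mean_curv[OF v] hessian_mean_curv_sym[OF v] by (simp add: vec_eq_iff)
  finally show ?thesis
    by (simp add: laplace_form_eq hessian_norm_A_sq[OF v] norm_nabla_A_sq_eq_trace[OF v]
        distrib_left sum.distrib mean_curv_eq_trace[OF v] norm_A_sq_eq_trace[OF v]
        sum_distrib_left[symmetric] mult.left_commute[of _ 2])
qed

end

section \<open>Evolution in time\<close>

lemma dt_eq:
  "at t within I \<noteq> bot \<Longrightarrow> (f has_vector_derivative D) (at t within I) \<Longrightarrow> dt I f t = D"
  unfolding dt_def by (rule vector_derivative_within)

lemma dt_works:
  "f differentiable (at t within I) \<Longrightarrow> (f has_vector_derivative dt I f t) (at t within I)"
  unfolding dt_def by (simp add: vector_derivative_works)

lemma has_vector_derivative_imp_differentiable: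
  "(f has_vector_derivative D) (at t within I) \<Longrightarrow> f differentiable (at t within I)"
  unfolding has_vector_derivative_def differentiable_def by blast

lemmas has_vector_derivative_inner = bounded_bilinear.has_vector_derivative[OF bounded_bilinear_inner]
lemmas has_vector_derivative_matrix_mult =
  bounded_bilinear.has_vector_derivative[OF bounded_bilinear_matrix_mult]
lemmas has_vector_derivative_scaleR_vec =
  bounded_bilinear.has_vector_derivative[OF bounded_bilinear_scaleR]
lemmas has_vector_derivative_trace = bounded_linear.has_vector_derivative[OF bounded_linear_trace]

lemma has_second_derivativeI:
  assumes "\<And>s. s \<in> I \<Longrightarrow> f s = g s" "\<And>s. s \<in> I \<Longrightarrow> (g has_vector_derivative g' s) (at s within I)"
    "(g' has_vector_derivative D) (at t within I)"
  shows "has_second_derivative f D t I"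
  unfolding has_second_derivative_def
proof (intro exI conjI ballI)
  show "(f has_vector_derivative g' s) (at s within I)" if "s \<in> I" for s
    by (rule has_vector_derivative_transform[OF that assms(1) assms(2)[OF that]])
qed (rule assms(3))

text \<open>The flow in one coordinate domain, without the manifold. \<open>nontrivial\<close> makes
  derivatives within \<open>I\<close> unique, also at end points. Continuity of the normal is
  recorded in each variable separately, as its differentiability is derived separately in space and
  in time.\<close>

locale flow_patch =
  fixes W :: "(real ^ 'n::finite) set" and I :: "real set"
    and Y N :: "real \<Rightarrow> real ^ 'n \<Rightarrow> real ^ 'k::finite" and c :: "real \<Rightarrow> real"
  assumes W: "open W" and I: "convex I" and nontrivial: "t \<in> I \<Longrightarrow> at t within I \<noteq> bot"
    and family: "smooth_family_on W I Y"
    and cont_space: "t \<in> I \<Longrightarrow> continuous_on W (N t)"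
    and cont_time: "v \<in> W \<Longrightarrow> continuous_on I (\<lambda>t. N t v)"
    and frame: "t \<in> I \<Longrightarrow> v \<in> W \<Longrightarrow> adapted_frame (\<lambda>i. pd i (Y t) v) (N t v)"
    and flow: "t \<in> I \<Longrightarrow> v \<in> W \<Longrightarrow> has_second_derivative (\<lambda>s. Y s v)
      (mean_curv (Y t) (N t) v *\<^sub>R N t v + c t *\<^sub>R Y t v) t I"
begin

lemma hypersurface_at: "t \<in> I \<Longrightarrow> hypersurface W (Y t) (N t)"
  using family W cont_space frame unfolding smooth_family_on_def by (intro hypersurface.intro) auto

text \<open>\<open>smooth_family_on\<close> provides time derivatives existentially, for each list
  of directions anew. Naming them by \<open>dt\<close> makes them functions of the list, so that
  those for \<open>is\<close> and \<open>i # is\<close> can be compared.\<close>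

definition y1 :: "'n list \<Rightarrow> real ^ 'n \<Rightarrow> real \<Rightarrow> real ^ 'k" where
  "y1 is v = dt I (\<lambda>s. iter_pd is (Y s) v)"

definition y2 :: "'n list \<Rightarrow> real ^ 'n \<Rightarrow> real \<Rightarrow> real ^ 'k" where
  "y2 is v = dt I (y1 is v)"

lemma y_family:
  shows y1: "\<And>v t. v \<in> W \<Longrightarrow> t \<in> I \<Longrightarrow>
      ((\<lambda>s. iter_pd is (Y s) v) has_vector_derivative y1 is v t) (at t within I)"
    and y2: "\<And>v t. v \<in> W \<Longrightarrow> t \<in> I \<Longrightarrow> (y1 is v has_vector_derivative y2 is v t) (at t within I)"
    and cont_y1: "continuous_on (W \<times> I) (\<lambda>(v, t). y1 is v t)"
    and cont_y2: "continuous_on (W \<times> I) (\<lambda>(v, t). y2 is v t)"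
proof -
  obtain D1 D2 where D:
    "\<And>v t. v \<in> W \<Longrightarrow> t \<in> I \<Longrightarrow> ((\<lambda>s. iter_pd is (Y s) v) has_vector_derivative D1 v t) (at t within I)"
    "\<And>v t. v \<in> W \<Longrightarrow> t \<in> I \<Longrightarrow> (D1 v has_vector_derivative D2 v t) (at t within I)"
    "continuous_on (W \<times> I) (\<lambda>(v, t). D1 v t)" "continuous_on (W \<times> I) (\<lambda>(v, t). D2 v t)"
    using family[unfolded smooth_family_on_def, THEN conjunct2, THEN spec[of _ "is"]] by auto
  have 1: "y1 is v t = D1 v t" if "v \<in> W" "t \<in> I" for v t
    unfolding y1_def by (rule dt_eq[OF nontrivial[OF that(2)] D(1)[OF that]])
  have hv: "(y1 is v has_vector_derivative D2 v t) (at t within I)" if "v \<in> W" "t \<in> I" for v t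
    by (rule has_vector_derivative_transform[OF that(2) 1 D(2)[OF that]]) (use that in auto)
  have 2: "y2 is v t = D2 v t" if "v \<in> W" "t \<in> I" for v t
    unfolding y2_def by (rule dt_eq[OF nontrivial[OF that(2)] hv[OF that]])
  show "((\<lambda>s. iter_pd is (Y s) v) has_vector_derivative y1 is v t) (at t within I)"
    "(y1 is v has_vector_derivative y2 is v t) (at t within I)" if "v \<in> W" "t \<in> I" for v t
    using D(1)[OF that] hv[OF that] 1[OF that] 2[OF that] by simp_all
  show "continuous_on (W \<times> I) (\<lambda>(v, t). y1 is v t)"
    by (rule continuous_on_eq[OF D(3)]) (auto simp: 1)
  show "continuous_on (W \<times> I) (\<lambda>(v, t). y2 is v t)"
    by (rule continuous_on_eq[OF D(4)]) (auto simp: 2)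
qed

lemma y1_directional:
  assumes "t \<in> I" "v \<in> W"
  shows "((\<lambda>h. y1 is (v + h *\<^sub>R axis i 1) t) has_vector_derivative y1 (i # is) v t) (at 0)"
proof (rule directional_derivative_exchange[where W = W and I = I and
      f = "\<lambda>t v. iter_pd is (Y t) v" and fe = "\<lambda>t v. iter_pd (i # is) (Y t) v" and
      ?f1.0 = "\<lambda>t v. y1 is v t" and ?fe1.0 = "\<lambda>t v. y1 (i # is) v t"])
  have diff: "iter_pd js (Y t) differentiable (at v)" if "t \<in> I" "v \<in> W" for js t v
    using family that W unfolding smooth_family_on_def smooth_on_def
    by (meson differentiable_on_eq_differentiable_at)
  show "((\<lambda>h. iter_pd is (Y t) (v + h *\<^sub>R axis i 1)) has_vector_derivative
      iter_pd (i # is) (Y t) v) (at 0)" if "v \<in> W" "t \<in> I" for v t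
    using pd_has_vector_derivative[OF diff] that by simp
  show "continuous_on W (iter_pd (i # is) (Y t))" if "t \<in> I" for t
    using diff[OF that] W
    by (meson continuous_at_imp_continuous_on differentiable_imp_continuous_within)
qed (use assms W I nontrivial y1 y1[where ?is = "i # is", simplified] cont_y1 in auto)

text \<open>The exchange is applied a second time, one time derivative higher;
  \<open>y1_directional\<close> now provides its spatial hypothesis.\<close>

lemma y2_directional:
  assumes "t \<in> I" "v \<in> W"
  shows "((\<lambda>h. y2 is (v + h *\<^sub>R axis i 1) t) has_vector_derivative y2 (i # is) v t) (at 0)"
proof (rule directional_derivative_exchange[where W = W and I = I and
      f = "\<lambda>t v. y1 is v t" and fe = "\<lambda>t v. y1 (i # is) v t" and
      ?f1.0 = "\<lambda>t v. y2 is v t" and ?fe1.0 = "\<lambda>t v. y2 (i # is) v t"])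
  show "continuous_on W (\<lambda>v. y1 (i # is) v t)" if "t \<in> I" for t
    using continuous_on_compose2[OF cont_y1, of W "\<lambda>v. (v, t)" "i # is"] that
    by (force intro!: continuous_intros)
qed (use assms W I nontrivial y1_directional y2 cont_y2 in auto)

definition accel :: "real \<Rightarrow> real ^ 'n \<Rightarrow> real ^ 'k" where
  "accel t v = mean_curv (Y t) (N t) v *\<^sub>R N t v + c t *\<^sub>R Y t v"

lemma y2_Nil:
  assumes t: "t \<in> I" and v: "v \<in> W"
  shows "y2 [] v t = accel t v"
proof -
  obtain f' where f': "\<And>s. s \<in> I \<Longrightarrow> ((\<lambda>s. Y s v) has_vector_derivative f' s) (at s within I)"
    "(f' has_vector_derivative accel t v) (at t within I)"
    using flow[OF t v] unfolding has_second_derivative_def accel_def by blast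
  have "y1 [] v s = f' s" if "s \<in> I" for s
    unfolding y1_def by (rule dt_eq[OF nontrivial[OF that]]) (simp add: f'(1)[OF that])
  then have "(y1 [] v has_vector_derivative accel t v) (at t within I)"
    by (rule has_vector_derivative_transform[OF t _ f'(2)])
  then show ?thesis
    unfolding y2_def by (rule dt_eq[OF nontrivial[OF t]])
qed

text \<open>\<open>y2_directional\<close> speaks of derivatives along lines only. Differentiability
  of \<open>y2 is\<close> comes from \<open>f\<close>, an expression for the right-hand side of the
  flow or a space derivative of it.\<close>

lemma y2_Cons:
  assumes t: "t \<in> I" and f: "\<And>v. v \<in> W \<Longrightarrow> y2 is v t = f v"
    and d: "\<And>v. v \<in> W \<Longrightarrow> f differentiable (at v)" and v: "v \<in> W"
  shows "y2 (i # is) v t = pd i f v"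
proof -
  have "(\<lambda>v. y2 is v t) differentiable (at v)"
    using d[OF v] has_derivative_transform_within_open[OF _ W v, of f _ UNIV "\<lambda>v. y2 is v t"] f
    unfolding differentiable_def by auto
  then have "pd i (\<lambda>v. y2 is v t) v = y2 (i # is) v t"
    by (rule pd_eq_directional[OF _ y2_directional[OF t v]])
  moreover have "pd i (\<lambda>v. y2 is v t) v = pd i f v"
    by (rule pd_cong[OF W v f])
  ultimately show ?thesis by simp
qed

end

section \<open>Components of the derivatives of the flow's right-hand side\<close>

context hypersurface
begin

lemma kdiff_mean_curv: "kdiff k W (mean_curv F N)"
  by (rule kdiff_cong[OF W mean_curv_eq_trace[symmetric]])
    (auto intro: kdiff_linear[OF W bounded_linear_trace] kdiff_shape)

text \<open>This is the third fundamental form; \<open>N_pd_pd_N\<close> gets it with opposite sign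
  by differentiating the orthogonality of \<open>N\<close> and \<open>pd j N\<close>.\<close>

lemma pd_N_pd_N: "v \<in> W \<Longrightarrow> pd i N v \<bullet> pd j N v = (second_form F N v ** shape F N v) $ j $ i"
  using adapted_frame.inner_expand[OF frame, of v "pd i N v" "pd j N v"]
  by (simp add: pd_N_dual pd_N_e pd_N_N matrix_mult_nth mult.commute)

lemma N_pd_pd_N:
  assumes v: "v \<in> W"
  shows "N v \<bullet> pd i (pd j N) v = - (second_form F N v ** shape F N v) $ j $ i"
proof -
  have "pd i (\<lambda>v. N v \<bullet> pd j N v) v = pd i (\<lambda>v. 0) v"
    by (rule pd_cong[OF W v]) (metis pd_N_N inner_commute)
  then show ?thesis
    using pd_N_pd_N[OF v, of i j]
    by (simp add: pd_bilinear[OF bounded_bilinear_inner] pd_const N_differentiable[OF v]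
        kdiff_differentiable[OF kdiff_pd[OF kdiff_N] v])
qed

context
  fixes a :: real
begin

text \<open>The right-hand side of the flow at a fixed time; \<open>a\<close> stands for the forcing
  coefficient, which is constant in space. \<open>force1\<close> is its expanded first derivative,
  ready to be differentiated again.\<close>

definition force :: "real ^ 'n \<Rightarrow> real ^ 'k" where
  "force v = mean_curv F N v *\<^sub>R N v + a *\<^sub>R F v"

definition force1 :: "'n \<Rightarrow> real ^ 'n \<Rightarrow> real ^ 'k" where
  "force1 j v = pd j (mean_curv F N) v *\<^sub>R N v + mean_curv F N v *\<^sub>R pd j N v + a *\<^sub>R pd j F v"

lemmas kdiffs = kdiff_mean_curv kdiff_N kdiff_F kdiff_pd_F kdiff_pd[OF kdiff_N]
  kdiff_pd[OF kdiff_mean_curv]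

lemma kdiff_force: "kdiff k W force"
  unfolding force_def[abs_def]
  by (intro kdiff_add[OF W] kdiff_bilinear[OF W bounded_bilinear_scaleR] kdiff_const kdiffs)

lemma kdiff_force1: "kdiff k W (force1 j)"
  unfolding force1_def[abs_def]
  by (intro kdiff_add[OF W] kdiff_bilinear[OF W bounded_bilinear_scaleR] kdiff_const kdiffs)

lemma pd_force:
  assumes v: "v \<in> W"
  shows "pd j force v = force1 j v"
  using kdiffs[THEN kdiff_differentiable, OF v]
  by (simp add: force_def[abs_def] force1_def pd_add pd_bilinear[OF bounded_bilinear_scaleR] pd_const
      differentiable_bilinear[OF bounded_bilinear_scaleR])

lemma N_force1: "v \<in> W \<Longrightarrow> N v \<bullet> force1 j v = pd j (mean_curv F N) v"
  using adapted_frame.N_N[OF frame] adapted_frame.N_e[OF frame]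
  by (simp add: force1_def inner_add_right pd_N_N inner_commute[of "N v" "pd _ N v"])

lemma force1_e: "v \<in> W \<Longrightarrow> force1 j v \<bullet> pd l F v =
    - mean_curv F N v * second_form F N v $ j $ l + a * first_form F v $ j $ l"
  using adapted_frame.N_e[OF frame]
  by (simp add: force1_def inner_add_left pd_N_e first_form_def)

text \<open>The products of one derivative of \<open>H\<close> with one derivative of
  \<open>N\<close> are tangential. What remains normal comes from the second derivatives of
  \<open>H\<close>, of \<open>N\<close> and of \<open>F\<close>.\<close>

lemma N_pd_force1:
  assumes v: "v \<in> W"
  shows "N v \<bullet> pd i (force1 j) v = pd i (pd j (mean_curv F N)) v
    - mean_curv F N v * (second_form F N v ** shape F N v) $ j $ i + a * second_form F N v $ i $ j"
proof -
  interpret adapted_frame "\<lambda>i. pd i F v" "N v" by (rule frame[OF v])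
  show ?thesis
    using kdiffs[THEN kdiff_differentiable, OF v]
    by (simp add: force1_def[abs_def] pd_add pd_bilinear[OF bounded_bilinear_scaleR] pd_const
        differentiable_bilinear[OF bounded_bilinear_scaleR] differentiable_add inner_add_right N_N
        inner_commute[of "N v" "pd _ N v"] pd_N_N[OF v] N_pd_pd_N[OF v] second_form_def)
qed

end

end

context flow_patch
begin

context
  fixes t v assumes t: "t \<in> I" and v: "v \<in> W"
begin

interpretation hs: hypersurface W "Y t" "N t"
  by (rule hypersurface_at[OF t])

lemma y2_force: "y2 [j] v t = hs.force1 (c t) j v"
proof -
  have "y2 [j] v t = pd j (hs.force (c t)) v"
    by (rule y2_Cons[OF t _ hs.kdiff_differentiable[OF hs.kdiff_force] v])
      (simp_all add: y2_Nil[OF t] accel_def hs.force_def)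
  then show ?thesis by (simp add: hs.pd_force[OF v])
qed

end

lemma y2_force2:
  assumes t: "t \<in> I" and v: "v \<in> W"
  shows "y2 [i, j] v t = pd i (hypersurface.force1 (Y t) (N t) (c t) j) v"
proof -
  interpret hs: hypersurface W "Y t" "N t" by (rule hypersurface_at[OF t])
  show ?thesis
    by (rule y2_Cons[OF t y2_force[OF t] hs.kdiff_differentiable[OF hs.kdiff_force1] v])
qed

lemma const_derivative:
  assumes "(f has_vector_derivative D) (at t within I)" "\<And>s. s \<in> I \<Longrightarrow> f s = k" "t \<in> I"
  shows "D = 0"
proof -
  have "(f has_vector_derivative 0) (at t within I)"
    by (rule has_vector_derivative_transform[OF assms(3,2) has_vector_derivative_const])
  then show ?thesis
    by (rule vector_derivative_unique_within[OF nontrivial[OF assms(3)] assms(1)])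
qed

section \<open>Time derivatives of the unit normal\<close>

definition N1 :: "real ^ 'n \<Rightarrow> real \<Rightarrow> real ^ 'k" where
  "N1 v = dt I (\<lambda>s. N s v)"

definition N2 :: "real ^ 'n \<Rightarrow> real \<Rightarrow> real ^ 'k" where
  "N2 v = dt I (N1 v)"

definition Nt :: "real ^ 'n \<Rightarrow> 'n \<Rightarrow> real \<Rightarrow> real" where
  "Nt v l t = N t v \<bullet> y1 [l] v t"

lemma y1_pd: "v \<in> W \<Longrightarrow> t \<in> I \<Longrightarrow>
    ((\<lambda>s. pd i (Y s) v) has_vector_derivative y1 [i] v t) (at t within I)"
  and y1_pd_pd: "v \<in> W \<Longrightarrow> t \<in> I \<Longrightarrow>
    ((\<lambda>s. pd i (pd j (Y s)) v) has_vector_derivative y1 [i, j] v t) (at t within I)"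
  using y1[of v t "[i]"] y1[of v t "[i, j]"] by simp_all

lemmas y1_diff = y1_pd[THEN has_vector_derivative_imp_differentiable]
  y1_pd_pd[THEN has_vector_derivative_imp_differentiable]
  y2[THEN has_vector_derivative_imp_differentiable]

text \<open>The criterion used for space derivatives of the normal applies again, with the frame at
  a fixed point moving in time.\<close>

lemma N1:
  assumes t: "t \<in> I" and v: "v \<in> W"
  shows "((\<lambda>s. N s v) has_vector_derivative N1 v t) (at t within I)"
  unfolding N1_def
proof (rule dt_works, rule unit_normal_differentiable[where e = "\<lambda>i s. pd i (Y s) v"])
  show "continuous (at t within I) (\<lambda>s. N s v)"
    using cont_time[OF v] t by (simp add: continuous_on_eq_continuous_within)
qed (use t v frame y1_diff in auto)

lemma inv_form_differentiable:
  assumes t: "t \<in> I" and v: "v \<in> W"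
  shows "(\<lambda>s. inv_form (Y s) v) differentiable (at t within I)"
  unfolding inv_form_def first_form_eq_gram
  by (intro differentiable_matrix_inv differentiable_gram y1_diff v t
      adapted_frame.det_gram[OF frame[OF t v]])

lemma N1_N:
  assumes t: "t \<in> I" and v: "v \<in> W"
  shows "N1 v t \<bullet> N t v = 0"
proof -
  have "N t v \<bullet> N1 v t + N1 v t \<bullet> N t v = 0"
    by (rule const_derivative[OF has_vector_derivative_inner[OF N1 N1] _ t])
      (use t v adapted_frame.N_N[OF frame] in auto)
  then show ?thesis by (simp add: inner_commute)
qed

lemma N1_e:
  assumes t: "t \<in> I" and v: "v \<in> W"
  shows "N1 v t \<bullet> pd l (Y t) v = - Nt v l t"
proof -
  have "N t v \<bullet> y1 [l] v t + N1 v t \<bullet> pd l (Y t) v = 0"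
    by (rule const_derivative[OF has_vector_derivative_inner[OF N1 y1_pd] _ t])
      (use t v adapted_frame.N_e[OF frame] in auto)
  then show ?thesis by (simp add: Nt_def)
qed

lemma N1_dual:
  assumes t: "t \<in> I" and v: "v \<in> W"
  shows "N1 v t \<bullet> dual (\<lambda>i. pd i (Y t) v) k = - (\<Sum>l\<in>UNIV. inv_form (Y t) v $ k $ l * Nt v l t)"
  by (simp add: adapted_frame.inner_dual[OF frame[OF t v]] N1_e[OF t v] inv_form_def
      first_form_eq_gram sum_negf)

lemma N1_eq:
  assumes t: "t \<in> I" and v: "v \<in> W"
  shows "N1 v t =
    (\<Sum>k\<in>UNIV. (- (\<Sum>l\<in>UNIV. inv_form (Y t) v $ k $ l * Nt v l t)) *\<^sub>R pd k (Y t) v)"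
  using adapted_frame.expand[OF frame[OF t v], of "N1 v t"] by (simp add: N1_dual[OF t v] N1_N[OF t v])

text \<open>\<open>N1_eq\<close> is the counterpart of Weingarten's equation in time: it expresses
  \<open>N1\<close> through the inverse metric, the frame, the normal and \<open>y1\<close>, all of
  which are differentiable in time.\<close>

lemma N2:
  assumes t: "t \<in> I" and v: "v \<in> W"
  shows "(N1 v has_vector_derivative N2 v t) (at t within I)"
  unfolding N2_def
proof (rule dt_works)
  have "(\<lambda>t. \<Sum>k\<in>UNIV. (- (\<Sum>l\<in>UNIV. inv_form (Y t) v $ k $ l * Nt v l t)) *\<^sub>R pd k (Y t) v)
      differentiable (at t within I)"
    unfolding Nt_def
    by (intro differentiable_sum ballI finite differentiable_bilinear[OF bounded_bilinear_scaleR]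
        differentiable_minus differentiable_mult differentiable_bilinear[OF bounded_bilinear_inner]
        differentiable_bounded_linear[OF bounded_linear_vec_nth] inv_form_differentiable t v y1_diff
        has_vector_derivative_imp_differentiable[OF N1])
  then show "N1 v differentiable (at t within I)"
    by (rule differentiable_transform_within[OF _ zero_less_one t]) (simp add: N1_eq v)
qed

lemma N2_N:
  assumes t: "t \<in> I" and v: "v \<in> W"
  shows "N2 v t \<bullet> N t v = - (N1 v t \<bullet> N1 v t)"
proof -
  have "N1 v t \<bullet> N1 v t + N2 v t \<bullet> N t v = 0"
    by (rule const_derivative[OF has_vector_derivative_inner[OF N2 N1] _ t]) (use t v N1_N in auto)
  then show ?thesis by simp
qed

lemma N2_e:
  assumes t: "t \<in> I" and v: "v \<in> W"
  shows "N2 v t \<bullet> pd l (Y t) v = - (2 * (N1 v t \<bullet> y1 [l] v t)) - N t v \<bullet> y2 [l] v t"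
proof -
  have "(N1 v t \<bullet> y1 [l] v t + N2 v t \<bullet> pd l (Y t) v) + (N t v \<bullet> y2 [l] v t + N1 v t \<bullet> y1 [l] v t) = 0"
  proof (rule const_derivative[OF has_vector_derivative_add[OF
          has_vector_derivative_inner[OF N2 y1_pd] has_vector_derivative_inner[OF N1 y2]] _ t])
    show "N1 v s \<bullet> pd l (Y s) v + N s v \<bullet> y1 [l] v s = 0" if "s \<in> I" for s
      using N1_e[OF that v] by (simp add: Nt_def)
  qed (use t v in auto)
  then show ?thesis by simp
qed

lemma N1_N1:
  assumes t: "t \<in> I" and v: "v \<in> W"
  shows "N1 v t \<bullet> N1 v t =
    (\<Sum>k\<in>UNIV. \<Sum>l\<in>UNIV. inv_form (Y t) v $ k $ l * Nt v k t * Nt v l t)"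
  using adapted_frame.inner_expand[OF frame[OF t v], of "N1 v t" "N1 v t"]
  by (simp add: N1_dual[OF t v] N1_N[OF t v] N1_e[OF t v] sum_distrib_right sum_distrib_left
      sum_negf mult_ac)

section \<open>Time derivatives of the fundamental forms\<close>

definition g1 :: "real ^ 'n \<Rightarrow> real \<Rightarrow> real ^ 'n ^ 'n" where
  "g1 v t = (\<chi> i j. pd i (Y t) v \<bullet> y1 [j] v t + y1 [i] v t \<bullet> pd j (Y t) v)"

definition g2 :: "real ^ 'n \<Rightarrow> real \<Rightarrow> real ^ 'n ^ 'n" where
  "g2 v t = (\<chi> i j. (pd i (Y t) v \<bullet> y2 [j] v t + y1 [i] v t \<bullet> y1 [j] v t)
      + (y1 [i] v t \<bullet> y1 [j] v t + y2 [i] v t \<bullet> pd j (Y t) v))"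

definition h1 :: "real ^ 'n \<Rightarrow> real \<Rightarrow> real ^ 'n ^ 'n" where
  "h1 v t = (\<chi> i j. N t v \<bullet> y1 [i, j] v t + N1 v t \<bullet> pd i (pd j (Y t)) v)"

definition h2 :: "real ^ 'n \<Rightarrow> real \<Rightarrow> real ^ 'n ^ 'n" where
  "h2 v t = (\<chi> i j. (N t v \<bullet> y2 [i, j] v t + N1 v t \<bullet> y1 [i, j] v t)
      + (N1 v t \<bullet> y1 [i, j] v t + N2 v t \<bullet> pd i (pd j (Y t)) v))"

text \<open>The definitions of \<open>g1\<close>, \<open>g2\<close>, \<open>h1\<close> and
  \<open>h2\<close> are bracketed exactly as the product rule produces them, so the proof follows
  their structure.\<close>

lemma forms_time:
  assumes t: "t \<in> I" and v: "v \<in> W"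
  shows g1: "((\<lambda>s. first_form (Y s) v) has_vector_derivative g1 v t) (at t within I)"
    and g2: "(g1 v has_vector_derivative g2 v t) (at t within I)"
    and h1: "((\<lambda>s. second_form (Y s) (N s) v) has_vector_derivative h1 v t) (at t within I)"
    and h2: "(h1 v has_vector_derivative h2 v t) (at t within I)"
  unfolding first_form_def second_form_def g1_def g2_def h1_def h2_def
  by (intro has_vector_derivative_vec_lambda, simp only: vec_lambda_beta,
      intro has_vector_derivative_add has_vector_derivative_inner y1_pd y1_pd_pd y2 N1 N2 t v)+

definition christoffel1 :: "real ^ 'n \<Rightarrow> 'n \<Rightarrow> 'n \<Rightarrow> 'n \<Rightarrow> real \<Rightarrow> real" where
  "christoffel1 v k i j = dt I (\<lambda>s. christoffel (Y s) k i j v)"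

lemma christoffel1:
  assumes t: "t \<in> I" and v: "v \<in> W"
  shows "((\<lambda>s. christoffel (Y s) k i j v) has_vector_derivative christoffel1 v k i j t) (at t within I)"
  unfolding christoffel1_def christoffel_def
  by (intro dt_works differentiable_sum ballI finite differentiable_mult
      differentiable_bilinear[OF bounded_bilinear_inner]
      differentiable_bounded_linear[OF bounded_linear_vec_nth] inv_form_differentiable t v y1_diff)

text \<open>Using the Gauss formula for the mixed derivative brings in the time derivatives of the Christoffel
  symbols without computing them.\<close>

lemma y1_gauss_formula:
  assumes t: "t \<in> I" and v: "v \<in> W"
  shows "y1 [i, j] v t =
    (\<Sum>k\<in>UNIV. christoffel (Y t) k i j v *\<^sub>R y1 [k] v t + christoffel1 v k i j t *\<^sub>R pd k (Y t) v)
      + (second_form (Y t) (N t) v $ i $ j *\<^sub>R N1 v t + h1 v t $ i $ j *\<^sub>R N t v)"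
proof -
  have "((\<lambda>s. (\<Sum>k\<in>UNIV. christoffel (Y s) k i j v *\<^sub>R pd k (Y s) v)
      + second_form (Y s) (N s) v $ i $ j *\<^sub>R N s v) has_vector_derivative
    (\<Sum>k\<in>UNIV. christoffel (Y t) k i j v *\<^sub>R y1 [k] v t + christoffel1 v k i j t *\<^sub>R pd k (Y t) v)
      + (second_form (Y t) (N t) v $ i $ j *\<^sub>R N1 v t + h1 v t $ i $ j *\<^sub>R N t v)) (at t within I)"
    by (intro has_vector_derivative_add has_vector_derivative_sum has_vector_derivative_scaleR_vec
        christoffel1 y1_pd N1 t v bounded_linear.has_vector_derivative[OF bounded_linear_vec_nth] h1)
  then have "((\<lambda>s. pd i (pd j (Y s)) v) has_vector_derivative
    (\<Sum>k\<in>UNIV. christoffel (Y t) k i j v *\<^sub>R y1 [k] v t + christoffel1 v k i j t *\<^sub>R pd k (Y t) v)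
      + (second_form (Y t) (N t) v $ i $ j *\<^sub>R N1 v t + h1 v t $ i $ j *\<^sub>R N t v)) (at t within I)"
    by (rule has_vector_derivative_transform[OF t, rotated])
      (simp add: hypersurface.gauss_formula[OF hypersurface_at v] conn_def)
  then show ?thesis
    by (rule vector_derivative_unique_within[OF nontrivial[OF t] y1_pd_pd[OF v t]])
qed

text \<open>The terms with \<open>N1 v t \<bullet> y1 [k] v t\<close> cancel between twice the mixed
  product \<open>N1 v t \<bullet> y1 [i, j] v t\<close> and the product with \<open>N2 v t\<close>;
  of the two copies of the squared length of \<open>N1 v t\<close>, one survives.\<close>

lemma h2_formula:
  assumes t: "t \<in> I" and v: "v \<in> W"
  shows "h2 v t $ i $ j = N t v \<bullet> y2 [i, j] v t
    - (\<Sum>k\<in>UNIV. christoffel (Y t) k i j v * (N t v \<bullet> y2 [k] v t))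
    - 2 * (\<Sum>k\<in>UNIV. christoffel1 v k i j t * Nt v k t)
    + second_form (Y t) (N t) v $ i $ j * (N1 v t \<bullet> N1 v t)"
proof -
  have "N1 v t \<bullet> y1 [i, j] v t = (\<Sum>k\<in>UNIV. christoffel (Y t) k i j v * (N1 v t \<bullet> y1 [k] v t))
      - (\<Sum>k\<in>UNIV. christoffel1 v k i j t * Nt v k t) + second_form (Y t) (N t) v $ i $ j * (N1 v t \<bullet> N1 v t)"
    by (simp add: y1_gauss_formula[OF t v] inner_add_right inner_sum_right N1_e[OF t v] N1_N[OF t v]
        sum.distrib sum_negf)
  moreover have "N2 v t \<bullet> pd i (pd j (Y t)) v =
      - 2 * (\<Sum>k\<in>UNIV. christoffel (Y t) k i j v * (N1 v t \<bullet> y1 [k] v t))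
      - (\<Sum>k\<in>UNIV. christoffel (Y t) k i j v * (N t v \<bullet> y2 [k] v t))
      - second_form (Y t) (N t) v $ i $ j * (N1 v t \<bullet> N1 v t)"
    by (simp add: hypersurface.gauss_formula[OF hypersurface_at[OF t] v] conn_def inner_add_right
        inner_sum_right N2_e[OF t v] N2_N[OF t v] right_diff_distrib sum_subtractf sum_negf
        sum_distrib_left mult.left_commute[of _ 2])
  ultimately show ?thesis by (simp add: h2_def)
qed

lemma h2_eq:
  assumes t: "t \<in> I" and v: "v \<in> W"
  defines "h \<equiv> second_form (Y t) (N t) v" and "H \<equiv> mean_curv (Y t) (N t) v"
  shows "h2 v t = hypersurface.hessian (Y t) (mean_curv (Y t) (N t)) v
    - H *\<^sub>R (h ** shape (Y t) (N t) v) + (c t + N1 v t \<bullet> N1 v t) *\<^sub>R h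
    - 2 *\<^sub>R (\<chi> i j. \<Sum>k\<in>UNIV. christoffel1 v k i j t * Nt v k t)"
proof -
  interpret hs: hypersurface W "Y t" "N t" by (rule hypersurface_at[OF t])
  \<comment> \<open>\<open>N_pd_force1\<close> carries the third fundamental form with its indices
    exchanged.\<close>
  have sym: "(h ** shape (Y t) (N t) v) $ j $ i = (h ** shape (Y t) (N t) v) $ i $ j" for i j
  proof -
    have "transpose (h ** shape (Y t) (N t) v) = h ** shape (Y t) (N t) v"
      by (simp add: h_def shape_def matrix_transpose_mul hs.transpose_inv_form[OF v]
          hs.transpose_second_form[OF v] matrix_mul_assoc)
    from arg_cong[OF this, of "\<lambda>A. A $ i $ j"] show ?thesis by (simp add: transpose_def)
  qed
  show ?thesis
    unfolding vec_eq_iff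
    by (auto simp: h2_formula[OF t v] y2_force[OF t v] y2_force2[OF t v] hs.N_force1[OF v]
        hs.N_pd_force1[OF v] hs.hessian_def sym H_def[symmetric] h_def[symmetric] algebra_simps)
qed

lemma g2_eq:
  assumes t: "t \<in> I" and v: "v \<in> W"
  shows "g2 v t = 2 *\<^sub>R (\<chi> i j. y1 [i] v t \<bullet> y1 [j] v t)
    - (2 * mean_curv (Y t) (N t) v) *\<^sub>R second_form (Y t) (N t) v + (2 * c t) *\<^sub>R first_form (Y t) v"
proof -
  interpret hs: hypersurface W "Y t" "N t" by (rule hypersurface_at[OF t])
  have "pd i (Y t) v \<bullet> y2 [j] v t + y2 [i] v t \<bullet> pd j (Y t) v =
      - 2 * mean_curv (Y t) (N t) v * second_form (Y t) (N t) v $ i $ j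
      + 2 * c t * first_form (Y t) v $ i $ j" for i j
  proof -
    have "pd i (Y t) v \<bullet> y2 [j] v t = hs.force1 (c t) j v \<bullet> pd i (Y t) v"
      by (simp only: inner_commute y2_force[OF t v])
    then show ?thesis
      using hs.second_form_sym[OF v, of i j]
      by (simp add: y2_force[OF t v] hs.force1_e[OF v])
        (simp add: first_form_def inner_commute)
  qed
  then show ?thesis by (simp add: vec_eq_iff g2_def algebra_simps)
qed

end

section \<open>Index contractions as traces of matrix words\<close>

lemma trace4:
  "trace (A ** (B ** (C ** D))) = (\<Sum>(a, b, c, d)\<in>UNIV. A $ a $ b * (B $ b $ c * (C $ c $ d * D $ d $ a)))"
  for A B C D :: "real ^ 'n ^ 'n"
  by (simp add: trace_def matrix_mult_nth sum_UNIV_prod sum_distrib_left)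

lemma trace6:
  "trace (A ** (B ** (C ** (D ** (E ** F))))) = (\<Sum>(a, b, c, d, e, f)\<in>UNIV.
    A $ a $ b * (B $ b $ c * (C $ c $ d * (D $ d $ e * (E $ e $ f * F $ f $ a)))))"
  for A B C D E F :: "real ^ 'n ^ 'n"
  by (simp add: trace_def matrix_mult_nth sum_UNIV_prod sum_distrib_left)

lemma trace8:
  "trace (A ** (B ** (C ** (D ** (E ** (F ** (P ** Q))))))) = (\<Sum>(a, b, c, d, e, f, p, q)\<in>UNIV.
    A $ a $ b * (B $ b $ c * (C $ c $ d * (D $ d $ e * (E $ e $ f * (F $ f $ p * (P $ p $ q * Q $ q $ a)))))))"
  for A B C D E F P Q :: "real ^ 'n ^ 'n"
  by (simp add: trace_def matrix_mult_nth sum_UNIV_prod sum_distrib_left)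

text \<open>The factors of each contraction form a closed walk: every factor is an edge between its
  two matrix indices, and symmetry allows traversing an edge backwards. The reindexing bijections
  list the indices in the order of the walk.\<close>

lemma trace_cyclic_sums:
  fixes G h g' h' X :: "real ^ 'n ^ 'n" and \<Gamma> :: "'n \<Rightarrow> 'n \<Rightarrow> 'n \<Rightarrow> real" and a :: "'n \<Rightarrow> real"
  assumes G: "\<And>i j. G $ i $ j = G $ j $ i" and h: "\<And>i j. h $ i $ j = h $ j $ i"
    and g': "\<And>i j. g' $ i $ j = g' $ j $ i" and h': "\<And>i j. h' $ i $ j = h' $ j $ i"
  defines "M \<equiv> \<chi> i j. \<Sum>k\<in>UNIV. \<Gamma> k i j * a k"
  shows "(\<Sum>(i, j, k, l)\<in>UNIV. G $ i $ k * G $ j $ l * h $ i $ j * X $ k $ l)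
      = trace (G ** (X ** (G ** h)))" (is ?s1)
    and "(\<Sum>(i, j, k)\<in>UNIV. G $ i $ j * \<Gamma> k i j * a k) = trace (G ** M)" (is ?s2)
    and "(\<Sum>(i, j, k, l, p, q)\<in>UNIV. G $ i $ k * G $ j $ p * G $ l $ q * h $ i $ j * g' $ p $ q * g' $ k $ l)
      = trace (G ** (g' ** (G ** (g' ** (G ** h)))))" (is ?s3)
    and "(\<Sum>(i, j, k, l)\<in>UNIV. G $ i $ k * G $ j $ l * g' $ k $ l * h' $ i $ j)
      = trace (G ** (g' ** (G ** h')))" (is ?s4)
    and "(\<Sum>(i, j, k, l)\<in>UNIV. G $ i $ j * G $ k $ l * h' $ i $ k * h' $ j $ l)
      = trace (G ** (h' ** (G ** h')))" (is ?s5)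
    and "(\<Sum>(i, j, k, l, m, n)\<in>UNIV. G $ i $ m * G $ j $ n * G $ k $ l * h $ j $ l * g' $ m $ n * h' $ i $ k)
      = trace (G ** (g' ** (G ** (h ** (G ** h')))))" (is ?s6)
    and "(\<Sum>(i, j, k, l, m, n)\<in>UNIV. G $ i $ m * G $ j $ n * G $ k $ l * h $ i $ k * h $ j $ l * X $ m $ n)
      = trace (G ** (X ** (G ** (h ** (G ** h)))))" (is ?s7)
    and "(\<Sum>(i, j, k, l, m, n, p, q)\<in>UNIV. G $ i $ m * g' $ p $ q * g' $ m $ n * h $ i $ k * h $ j $ l *
        (2 * G $ j $ p * G $ n $ q * G $ k $ l + G $ j $ n * G $ k $ p * G $ l $ q))
      = 2 * trace (G ** (g' ** (G ** (g' ** (G ** (h ** (G ** h)))))))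
      + trace (G ** (g' ** (G ** (h ** (G ** (g' ** (G ** h)))))))" (is ?s8)
    and "(\<Sum>(i, j, k, l, p)\<in>UNIV. G $ i $ j * G $ k $ l * h $ j $ l * \<Gamma> p i k * a p)
      = trace (G ** (M ** (G ** h)))" (is ?s9)
proof -
  show ?s1 unfolding trace4
    by (rule sum.reindex_bij_witness[where i = "\<lambda>(a, b, c, d). (a, d, b, c)" and
          j = "\<lambda>(i, j, k, l). (i, k, l, j)"]) (auto simp: G[of _ "_ :: 'n"] h mult_ac)
  show ?s3 unfolding trace6
    by (rule sum.reindex_bij_witness[where i = "\<lambda>(a, b, c, d, e, f). (a, f, b, c, e, d)" and
          j = "\<lambda>(i, j, k, l, p, q). (i, k, l, q, p, j)"]) (auto simp: G h g' mult_ac)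
  show ?s4 unfolding trace4
    by (rule sum.reindex_bij_witness[where i = "\<lambda>(a, b, c, d). (a, d, b, c)" and
          j = "\<lambda>(i, j, k, l). (i, k, l, j)"]) (auto simp: G h' g' mult_ac)
  show ?s5 unfolding trace4
    by (rule sum.reindex_bij_witness[where i = "\<lambda>(a, b, c, d). (a, b, d, c)" and
          j = "\<lambda>(i, j, k, l). (i, j, l, k)"]) (auto simp: G h' mult_ac)
  show ?s6 unfolding trace6
    by (rule sum.reindex_bij_witness[where i = "\<lambda>(a, b, c, d, e, f). (a, d, f, e, b, c)" and
          j = "\<lambda>(i, j, k, l, m, n). (i, m, n, j, l, k)"]) (auto simp: G h g' h' mult_ac)
  show ?s7 unfolding trace6
    by (rule sum.reindex_bij_witness[where i = "\<lambda>(a, b, c, d, e, f). (a, d, f, e, b, c)" and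
          j = "\<lambda>(i, j, k, l, m, n). (i, m, n, j, l, k)"]) (auto simp: G h mult_ac)
  \<comment> \<open>The two summands join the same tensors by different walks: in \<open>T1\<close>
    the two factors \<open>g'\<close> are separated by \<open>G\<close> alone, in \<open>T2\<close>
    by a factor \<open>h\<close> as well.\<close>
  define T1 where "T1 = (\<lambda>(i, j, k, l, m, n, p, q). G $ i $ m * g' $ p $ q * g' $ m $ n * h $ i $ k * h $ j $ l *
        (G $ j $ p * G $ n $ q * G $ k $ l))"
  define T2 where "T2 = (\<lambda>(i, j, k, l, m, n, p, q). G $ i $ m * g' $ p $ q * g' $ m $ n * h $ i $ k * h $ j $ l *
        (G $ j $ n * G $ k $ p * G $ l $ q))"
  have "sum T1 UNIV = trace (G ** (g' ** (G ** (g' ** (G ** (h ** (G ** h)))))))"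
    unfolding trace8 T1_def T2_def
    by (rule sum.reindex_bij_witness
        [where i = "\<lambda>(a, b, c, d, e, f, p, q). (a, f, q, p, b, c, e, d)" and
          j = "\<lambda>(i, j, k, l, m, n, p, q). (i, m, n, q, p, j, l, k)"]) (auto simp: G h g' mult_ac)
  moreover have "sum T2 UNIV = trace (G ** (g' ** (G ** (h ** (G ** (g' ** (G ** h)))))))"
    unfolding trace8 T1_def T2_def
    by (rule sum.reindex_bij_witness
        [where i = "\<lambda>(a, b, c, d, e, f, p, q). (a, d, q, e, b, c, p, f)" and
          j = "\<lambda>(i, j, k, l, m, n, p, q). (i, m, n, j, l, q, p, k)"]) (auto simp: G h g' mult_ac)
  moreover have "(\<Sum>(i, j, k, l, m, n, p, q)\<in>UNIV. G $ i $ m * g' $ p $ q * g' $ m $ n * h $ i $ k * h $ j $ l *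
        (2 * G $ j $ p * G $ n $ q * G $ k $ l + G $ j $ n * G $ k $ p * G $ l $ q)) =
      (\<Sum>x\<in>UNIV. 2 * T1 x + T2 x)"
    by (rule sum.cong) (auto simp: T1_def T2_def algebra_simps)
  ultimately show ?s8
    by (simp add: sum.distrib sum_distrib_left[symmetric])
  have "trace (G ** M) = (\<Sum>(i, j, k)\<in>UNIV. G $ i $ j * (\<Gamma> k j i * a k))"
    by (simp add: trace_def matrix_mult_nth sum_UNIV_prod sum_distrib_left M_def)
  also have "\<dots> = (\<Sum>(i, j, k)\<in>UNIV. G $ i $ j * \<Gamma> k i j * a k)"
    by (rule sum.reindex_bij_witness[where i = "\<lambda>(i, j, k). (j, i, k)" and
          j = "\<lambda>(i, j, k). (j, i, k)"]) (auto simp: G)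
  finally show ?s2 by simp
  have "trace (G ** (M ** (G ** h))) =
      (\<Sum>(a', b, c, d, p)\<in>UNIV. G $ a' $ b * ((\<Gamma> p b c * a p) * (G $ c $ d * h $ d $ a')))"
    by (simp add: trace_def matrix_mult_nth sum_UNIV_prod sum_distrib_left sum_distrib_right M_def)
  also have "\<dots> = (\<Sum>(i, j, k, l, p)\<in>UNIV. G $ i $ j * G $ k $ l * h $ j $ l * \<Gamma> p i k * a p)"
    by (rule sum.reindex_bij_witness[where i = "\<lambda>(i, j, k, l, p). (j, i, k, l, p)" and
          j = "\<lambda>(a', b, c, d, p). (b, a', c, d, p)"]) (auto simp: G h mult_ac)
  finally show ?s9 by simp
qed

text \<open>The product rule for \<open>S = G ** h\<close> with \<open>g''\<close> and
  \<open>h''\<close> substituted. The second derivative of \<open>G\<close> contributes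
  \<open>2 * H\<close> and \<open>- 2 * c\<close> where \<open>h''\<close> contributes
  \<open>- H\<close> and \<open>c\<close>; this explains the final coefficients \<open>H\<close> and
  \<open>- c\<close>.\<close>

lemma second_derivative_shape:
  fixes G g h g' h' g'' h'' G' X K M :: "real ^ 'n ^ 'n"
  assumes Gg: "G ** g = mat 1" and G': "G' = - (G ** g' ** G)"
    and g'': "g'' = 2 *\<^sub>R X - (2 * H) *\<^sub>R h + (2 * c) *\<^sub>R g"
    and h'': "h'' = K - H *\<^sub>R (h ** (G ** h)) + (c + q) *\<^sub>R h - 2 *\<^sub>R M"
  shows "(G ** h'' + G' ** h') + (G' ** h' + (- (G ** g' ** G' + (G ** g'' + G' ** g') ** G)) ** h) =
    G ** K + H *\<^sub>R (G ** h ** G ** h) + (q - c) *\<^sub>R (G ** h) - 2 *\<^sub>R (G ** M)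
    - 2 *\<^sub>R (G ** X ** G ** h) + 2 *\<^sub>R (G ** g' ** G ** g' ** G ** h) - 2 *\<^sub>R (G ** g' ** G ** h')"
proof -
  have "G ** (g ** (G ** h)) = G ** h"
    by (simp add: matrix_mul_assoc Gg)
  then show ?thesis
    by (simp only: G' g'' h'' matrix_mult_simps) (simp add: vec_eq_iff algebra_simps)
qed

section \<open>The second time derivative of the shape operator\<close>

context flow_patch
begin

context
  fixes v assumes v: "v \<in> W"
begin

definition G' :: "real \<Rightarrow> real ^ 'n ^ 'n" where
  "G' t = - (inv_form (Y t) v ** g1 v t ** inv_form (Y t) v)"

definition S' :: "real \<Rightarrow> real ^ 'n ^ 'n" where
  "S' t = inv_form (Y t) v ** h1 v t + G' t ** second_form (Y t) (N t) v"

definition S'' :: "real \<Rightarrow> real ^ 'n ^ 'n" where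
  "S'' t = (inv_form (Y t) v ** h2 v t + G' t ** h1 v t) + (G' t ** h1 v t
    + (- (inv_form (Y t) v ** g1 v t ** G' t
        + (inv_form (Y t) v ** g2 v t + G' t ** g1 v t) ** inv_form (Y t) v))
      ** second_form (Y t) (N t) v)"

lemma inv_form_time:
  assumes t: "t \<in> I"
  shows "((\<lambda>s. inv_form (Y s) v) has_vector_derivative G' t) (at t within I)"
  unfolding G'_def inv_form_def
  by (rule has_vector_derivative_matrix_inv[OF g1[OF t v]
        hypersurface.det_first_form[OF hypersurface_at[OF t] v]])

lemma shape_time:
  assumes t: "t \<in> I"
  shows "((\<lambda>s. shape (Y s) (N s) v) has_vector_derivative S' t) (at t within I)"
    and "(S' has_vector_derivative S'' t) (at t within I)"
  unfolding shape_def S'_def S''_def G'_def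
  by (intro has_vector_derivative_add has_vector_derivative_matrix_mult has_vector_derivative_minus
      inv_form_time[unfolded G'_def] g1 g2 h1 h2 t v)+

lemma S''_eq:
  assumes t: "t \<in> I"
  defines "G \<equiv> inv_form (Y t) v" and "h \<equiv> second_form (Y t) (N t) v" and "H \<equiv> mean_curv (Y t) (N t) v"
  shows "S'' t = G ** hypersurface.hessian (Y t) (mean_curv (Y t) (N t)) v
    + H *\<^sub>R (G ** h ** G ** h) + (N1 v t \<bullet> N1 v t - c t) *\<^sub>R (G ** h)
    - 2 *\<^sub>R (G ** (\<chi> i j. \<Sum>k\<in>UNIV. christoffel1 v k i j t * Nt v k t))
    - 2 *\<^sub>R (G ** (\<chi> i j. y1 [i] v t \<bullet> y1 [j] v t) ** G ** h)
    + 2 *\<^sub>R (G ** g1 v t ** G ** g1 v t ** G ** h) - 2 *\<^sub>R (G ** g1 v t ** G ** h1 v t)"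
  unfolding S''_def G_def h_def H_def
  by (rule second_derivative_shape[OF hypersurface.inv_form_mult(1)[OF hypersurface_at[OF t] v] G'_def
        g2_eq[OF t v] h2_eq[OF t v, unfolded shape_def]])

end

end

text \<open>Here \<open>T\<close> and \<open>U\<close> are the first and second time derivatives of
  \<open>S\<close>, so the left-hand side is the second derivative of \<open>trace (S ** S)\<close>.
  The coefficient 8 combines 4 from \<open>U\<close> with 4 from the cross terms of
  \<open>T ** T\<close>.\<close>

lemma trace_shape_derivatives:
  fixes G h g' h' K X M :: "real ^ 'n ^ 'n" and H b :: real
  assumes sym: "transpose G = G" "transpose h = h" "transpose g' = g'" "transpose h' = h'"
  defines "S \<equiv> G ** h"
  defines "T \<equiv> G ** h' - G ** g' ** G ** h"
    and "U \<equiv> G ** K + H *\<^sub>R (G ** h ** G ** h) + b *\<^sub>R (G ** h) - 2 *\<^sub>R (G ** M)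
    - 2 *\<^sub>R (G ** X ** G ** h) + 2 *\<^sub>R (G ** g' ** G ** g' ** G ** h) - 2 *\<^sub>R (G ** g' ** G ** h')"
  shows "2 * trace (S ** U) + 2 * trace (T ** T) =
    2 * trace (S ** G ** K) + 2 * H * trace (S ** S ** S) + 2 * b * trace (S ** S)
    - 4 * trace (G ** (M ** (G ** h))) - 4 * trace (G ** (X ** (G ** (h ** (G ** h)))))
    + 4 * trace (G ** (g' ** (G ** (g' ** (G ** (h ** (G ** h)))))))
    - 8 * trace (G ** (g' ** (G ** (h ** (G ** h')))))
    + 2 * trace (G ** (h' ** (G ** h')))
    + 2 * trace (G ** (g' ** (G ** (h ** (G ** (g' ** (G ** h)))))))"
proof -
  have "trace (G ** h ** G ** M) = trace (G ** M ** G ** h)"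
    using trace_mul_sym[of "G ** h" "G ** M"] by (simp add: matrix_mult_simps)
  moreover have "trace (G ** h ** G ** X ** G ** h) = trace (G ** X ** G ** h ** G ** h)"
    using trace_mul_sym[of "G ** h" "G ** X ** G ** h"] by (simp add: matrix_mult_simps)
  moreover have "trace (G ** h ** G ** g' ** G ** g' ** G ** h) =
      trace (G ** g' ** G ** g' ** G ** h ** G ** h)"
    using trace_mul_sym[of "G ** h" "G ** g' ** G ** g' ** G ** h"] by (simp add: matrix_mult_simps)
  moreover have "trace (G ** h' ** G ** g' ** G ** h) = trace (G ** g' ** G ** h ** G ** h')"
    using trace_mul_sym[of "G ** h'" "G ** g' ** G ** h"] by (simp add: matrix_mult_simps)
  \<comment> \<open>Here \<open>h\<close>, \<open>g'\<close>, \<open>h'\<close> occur in the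
    opposite cyclic order. Transposition reverses the word, and only then does a cyclic shift reach
    the normal form.\<close>
  moreover have "trace (G ** h ** G ** g' ** G ** h') = trace (G ** g' ** G ** h ** G ** h')"
  proof -
    have "trace (G ** h ** G ** g' ** G ** h') = trace (h' ** (G ** g' ** G ** h ** G))"
      by (subst trace_transpose[symmetric]) (simp add: matrix_transpose_mul sym matrix_mult_simps)
    also have "\<dots> = trace (G ** g' ** G ** h ** G ** h')"
      using trace_mul_sym[of h' "G ** g' ** G ** h ** G"] by (simp add: matrix_mult_simps)
    finally show ?thesis .
  qed
  ultimately show ?thesis
    unfolding S_def T_def U_def
    by (simp only: matrix_mult_simps trace_simps) (simp add: algebra_simps)
qed

context hypersurface
begin

lemma laplace_mean_curv:
  assumes v: "v \<in> W"
  shows "laplace_form F (mean_curv F N) v = trace (inv_form F v ** hessian (mean_curv F N) v)"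
  by (simp add: laplace_form_eq trace_mult hessian_mean_curv_sym[OF v])

end

context flow_patch
begin

lemma mean_curv_second_derivative:
  assumes t: "t \<in> I" and v: "v \<in> W"
  shows "has_second_derivative (\<lambda>s. mean_curv (Y s) (N s) v) (trace (S'' v t)) t I"
  by (rule has_second_derivativeI[where g = "\<lambda>s. trace (shape (Y s) (N s) v)" and g' = "\<lambda>s. trace (S' v s)"])
    (intro hypersurface.mean_curv_eq_trace[OF hypersurface_at] has_vector_derivative_trace
      shape_time t v | assumption)+

lemma norm_A_sq_second_derivative:
  assumes t: "t \<in> I" and v: "v \<in> W"
  shows "has_second_derivative (\<lambda>s. norm_A_sq (Y s) (N s) v)
    (2 * trace (shape (Y t) (N t) v ** S'' v t) + 2 * trace (S' v t ** S' v t)) t I"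
proof (rule has_second_derivativeI[where
      g = "\<lambda>s. trace (shape (Y s) (N s) v ** shape (Y s) (N s) v)" and
      g' = "\<lambda>s. trace (shape (Y s) (N s) v ** S' v s + S' v s ** shape (Y s) (N s) v)"])
  show "norm_A_sq (Y s) (N s) v = trace (shape (Y s) (N s) v ** shape (Y s) (N s) v)" if "s \<in> I" for s
    by (rule hypersurface.norm_A_sq_eq_trace[OF hypersurface_at[OF that] v])
  show "((\<lambda>s. trace (shape (Y s) (N s) v ** shape (Y s) (N s) v)) has_vector_derivative
      trace (shape (Y s) (N s) v ** S' v s + S' v s ** shape (Y s) (N s) v)) (at s within I)"
    if "s \<in> I" for s
    by (intro has_vector_derivative_trace has_vector_derivative_matrix_mult shape_time that v)
  have "((\<lambda>s. trace (shape (Y s) (N s) v ** S' v s + S' v s ** shape (Y s) (N s) v))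
      has_vector_derivative trace ((shape (Y t) (N t) v ** S'' v t + S' v t ** S' v t)
        + (S' v t ** S' v t + S'' v t ** shape (Y t) (N t) v))) (at t within I)"
    by (intro has_vector_derivative_trace has_vector_derivative_add
        has_vector_derivative_matrix_mult shape_time t v)
  moreover have "trace ((shape (Y t) (N t) v ** S'' v t + S' v t ** S' v t)
        + (S' v t ** S' v t + S'' v t ** shape (Y t) (N t) v)) =
      2 * trace (shape (Y t) (N t) v ** S'' v t) + 2 * trace (S' v t ** S' v t)"
    by (simp only: trace_simps trace_mul_sym[of "S'' v t"])
  ultimately show "((\<lambda>s. trace (shape (Y s) (N s) v ** S' v s + S' v s ** shape (Y s) (N s) v))
      has_vector_derivative (2 * trace (shape (Y t) (N t) v ** S'' v t)
        + 2 * trace (S' v t ** S' v t))) (at t within I)"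
    by simp
qed

lemma h1_sym:
  assumes t: "t \<in> I" and v: "v \<in> W"
  shows "h1 v t $ i $ j = h1 v t $ j $ i"
proof -
  have "h1 v t $ i $ j - h1 v t $ j $ i = 0"
    by (rule const_derivative[OF has_vector_derivative_diff[OF
            bounded_linear.has_vector_derivative[OF bounded_linear_vec_nth
              bounded_linear.has_vector_derivative[OF bounded_linear_vec_nth h1[OF t v]]]
            bounded_linear.has_vector_derivative[OF bounded_linear_vec_nth
              bounded_linear.has_vector_derivative[OF bounded_linear_vec_nth h1[OF t v]]]] _ t])
      (use hypersurface.second_form_sym[OF hypersurface_at v] in simp)
  then show ?thesis by simp
qed

lemma g1_sym: "g1 v t $ i $ j = g1 v t $ j $ i"
  by (simp add: g1_def inner_commute)

theorem curvature_evolution: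
  assumes t: "t \<in> I" and u: "u \<in> W"
  defines "H \<equiv> \<lambda>s. mean_curv (Y s) (N s)" and "A2 \<equiv> \<lambda>s. norm_A_sq (Y s) (N s)"
    and "G \<equiv> \<lambda>i j. inv_form (Y t) u $ i $ j"
    and "h \<equiv> \<lambda>i j. second_form (Y t) (N t) u $ i $ j"
    and "gt \<equiv> \<lambda>i j. dt I (\<lambda>s. first_form (Y s) u $ i $ j) t"
    and "ht \<equiv> \<lambda>i j. dt I (\<lambda>s. second_form (Y s) (N s) u $ i $ j) t"
    and "\<Gamma>t \<equiv> \<lambda>k i j. dt I (\<lambda>s. christoffel (Y s) k i j u) t"
    and "Xt \<equiv> \<lambda>k. dt I (\<lambda>s. pd k (Y s) u) t"
  defines "XX \<equiv> \<lambda>k l. Xt k \<bullet> Xt l" and "Nx \<equiv> \<lambda>k. N t u \<bullet> Xt k"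
  shows "has_second_derivative (\<lambda>s. H s u)
          ( laplace_form (Y t) (H t) u + H t u * A2 t u
          - 2 * (\<Sum>(i, j, k, l)\<in>UNIV. G i k * G j l * h i j * XX k l)
          + H t u * (\<Sum>(k, l)\<in>UNIV. G k l * Nx k * Nx l)
          - 2 * (\<Sum>(i, j, k)\<in>UNIV. G i j * \<Gamma>t k i j * Nx k)
          + 2 * (\<Sum>(i, j, k, l, p, q)\<in>UNIV. G i k * G j p * G l q * h i j * gt p q * gt k l)
          - 2 * (\<Sum>(i, j, k, l)\<in>UNIV. G i k * G j l * gt k l * ht i j)
          - c t * H t u) t I
      \<and> has_second_derivative (\<lambda>s. A2 s u)
          ( laplace_form (Y t) (A2 t) u - 2 * norm_nabla_A_sq (Y t) (N t) u + 2 * (A2 t u)\<^sup>2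
          + 2 * A2 t u * (\<Sum>(p, q)\<in>UNIV. G p q * Nx p * Nx q)
          + 2 * (\<Sum>(i, j, k, l)\<in>UNIV. G i j * G k l * ht i k * ht j l)
          - 8 * (\<Sum>(i, j, k, l, m, n)\<in>UNIV. G i m * G j n * G k l * h j l * gt m n * ht i k)
          - 4 * (\<Sum>(i, j, k, l, m, n)\<in>UNIV. G i m * G j n * G k l * h i k * h j l * XX m n)
          + 2 * (\<Sum>(i, j, k, l, m, n, p, q)\<in>UNIV. G i m * gt p q * gt m n * h i k * h j l *
                  (2 * G j p * G n q * G k l + G j n * G k p * G l q))
          - 4 * (\<Sum>(i, j, k, l, p)\<in>UNIV. G i j * G k l * h j l * \<Gamma>t p i k * Nx p)
          - 2 * c t * A2 t u) t I"
proof -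
  interpret hs: hypersurface W "Y t" "N t" by (rule hypersurface_at[OF t])
  let ?G = "inv_form (Y t) u" and ?h = "second_form (Y t) (N t) u"
  let ?X = "\<chi> i j. y1 [i] u t \<bullet> y1 [j] u t" and ?q = "N1 u t \<bullet> N1 u t"
  let ?M = "\<chi> i j. \<Sum>k\<in>UNIV. christoffel1 u k i j t * Nt u k t"
  let ?K = "hs.hessian (mean_curv (Y t) (N t)) u"
  have gt: "gt i j = g1 u t $ i $ j" and ht: "ht i j = h1 u t $ i $ j" for i j
    unfolding gt_def ht_def
    by (intro dt_eq[OF nontrivial[OF t]]
        bounded_linear.has_vector_derivative[OF bounded_linear_vec_nth] g1 h1 t u)+
  have Xt: "Xt k = y1 [k] u t" for k by (simp add: Xt_def y1_def)
  have XX: "XX k l = ?X $ k $ l" for k l by (simp add: XX_def Xt)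
  have Nx: "Nx k = Nt u k t" for k by (simp add: Nx_def Nt_def Xt)
  have \<Gamma>t: "\<Gamma>t k i j = christoffel1 u k i j t" for k i j by (simp add: \<Gamma>t_def christoffel1_def)
  have q: "?q = (\<Sum>(k, l)\<in>UNIV. ?G $ k $ l * Nt u k t * Nt u l t)"
    by (simp add: N1_N1[OF t u] sum_UNIV_prod)
  note sums = trace_cyclic_sums[of ?G ?h "g1 u t" "h1 u t", OF hs.inv_form_sym[OF u]
      hs.second_form_sym[OF u] g1_sym h1_sym[OF t u]]
  note unfolds = gt ht XX Nx \<Gamma>t G_def h_def sums q[symmetric] H_def A2_def
  have S: "shape (Y t) (N t) u = ?G ** ?h" by (simp add: shape_def)
  have H: "mean_curv (Y t) (N t) u = trace (?G ** ?h)"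
    by (simp add: hs.mean_curv_eq_trace[OF u] S)
  have A2: "norm_A_sq (Y t) (N t) u = trace (?G ** ?h ** ?G ** ?h)"
    by (simp add: hs.norm_A_sq_eq_trace[OF u] S matrix_mult_simps)
  have "trace (S'' u t) = laplace_form (Y t) (mean_curv (Y t) (N t)) u
      + mean_curv (Y t) (N t) u * norm_A_sq (Y t) (N t) u
      - 2 * trace (?G ** (?X ** (?G ** ?h))) + mean_curv (Y t) (N t) u * ?q
      - 2 * trace (?G ** ?M) + 2 * trace (?G ** (g1 u t ** (?G ** (g1 u t ** (?G ** ?h)))))
      - 2 * trace (?G ** (g1 u t ** (?G ** h1 u t))) - c t * mean_curv (Y t) (N t) u"
    unfolding S''_eq[OF u t] hs.laplace_mean_curv[OF u] A2
    by (simp only: trace_simps matrix_mult_simps) (simp add: H algebra_simps)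
  then have 1: "has_second_derivative (\<lambda>s. mean_curv (Y s) (N s) u)
     (laplace_form (Y t) (mean_curv (Y t) (N t)) u
      + mean_curv (Y t) (N t) u * norm_A_sq (Y t) (N t) u
      - 2 * trace (?G ** (?X ** (?G ** ?h))) + mean_curv (Y t) (N t) u * ?q
      - 2 * trace (?G ** ?M) + 2 * trace (?G ** (g1 u t ** (?G ** (g1 u t ** (?G ** ?h)))))
      - 2 * trace (?G ** (g1 u t ** (?G ** h1 u t))) - c t * mean_curv (Y t) (N t) u) t I"
    using mean_curv_second_derivative[OF t u] by simp
  have "2 * trace (shape (Y t) (N t) u ** S'' u t) + 2 * trace (S' u t ** S' u t) =
    2 * trace (?G ** ?h ** ?G ** ?K)
    + 2 * mean_curv (Y t) (N t) u * trace (?G ** ?h ** (?G ** ?h) ** (?G ** ?h))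
    + 2 * (?q - c t) * trace (?G ** ?h ** (?G ** ?h))
    - 4 * trace (?G ** (?M ** (?G ** ?h))) - 4 * trace (?G ** (?X ** (?G ** (?h ** (?G ** ?h)))))
    + 4 * trace (?G ** (g1 u t ** (?G ** (g1 u t ** (?G ** (?h ** (?G ** ?h)))))))
    - 8 * trace (?G ** (g1 u t ** (?G ** (?h ** (?G ** h1 u t)))))
    + 2 * trace (?G ** (h1 u t ** (?G ** h1 u t)))
    + 2 * trace (?G ** (g1 u t ** (?G ** (?h ** (?G ** (g1 u t ** (?G ** ?h)))))))"
  proof -
    have T: "S' u t = ?G ** h1 u t - ?G ** g1 u t ** ?G ** ?h"
      by (simp add: S'_def[OF u] G'_def[OF u] matrix_mult_simps)
    have sym: "transpose (g1 u t) = g1 u t" "transpose (h1 u t) = h1 u t"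
      using g1_sym h1_sym[OF t u] by (simp_all add: transpose_def vec_eq_iff)
    show ?thesis
      unfolding S T S''_eq[OF u t]
      by (rule trace_shape_derivatives[OF hs.transpose_inv_form[OF u] hs.transpose_second_form[OF u] sym])
  qed
  \<comment> \<open>Simons' identity is solved for its Hessian term, which brings in the Laplacian
    of |A|^2, \<open>- 2 |nabla A|^2\<close> and \<open>2 |A|^4\<close>.\<close>
  also have "\<dots> = laplace_form (Y t) (norm_A_sq (Y t) (N t)) u
      - 2 * norm_nabla_A_sq (Y t) (N t) u + 2 * (norm_A_sq (Y t) (N t) u)\<^sup>2
      + 2 * norm_A_sq (Y t) (N t) u * ?q
      + 2 * trace (?G ** (h1 u t ** (?G ** h1 u t)))
      - 8 * trace (?G ** (g1 u t ** (?G ** (?h ** (?G ** h1 u t)))))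
      - 4 * trace (?G ** (?X ** (?G ** (?h ** (?G ** ?h)))))
      + 2 * (2 * trace (?G ** (g1 u t ** (?G ** (g1 u t ** (?G ** (?h ** (?G ** ?h)))))))
        + trace (?G ** (g1 u t ** (?G ** (?h ** (?G ** (g1 u t ** (?G ** ?h))))))))
      - 4 * trace (?G ** (?M ** (?G ** ?h))) - 2 * c t * norm_A_sq (Y t) (N t) u"
    using hs.simons[OF u] by (simp add: S A2 matrix_mult_simps algebra_simps)
  finally have "has_second_derivative (\<lambda>s. norm_A_sq (Y s) (N s) u) \<dots> t I"
    using norm_A_sq_second_derivative[OF t u] by simp
  with 1 show ?thesis
    unfolding unfolds by (rule conjI)
qed

end

section \<open>Charts\<close>

text \<open>A connected set with more than one point has no isolated points.\<close>

lemma interval_nontrivial: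
  fixes I :: "real set"
  assumes "is_interval I" "0 \<in> I" "I \<noteq> {0}" "t \<in> I"
  shows "at t within I \<noteq> bot"
proof -
  have "t islimpt I"
    using assms by (intro connected_imp_perfect) (auto simp: is_interval_connected_1)
  then show ?thesis by (simp add: trivial_limit_within)
qed

text \<open>\<open>coord_rep\<close> is written with \<open>inv_into\<close>, whereas the
  homeomorphism only provides some continuous inverse; the two agree on the image of the
  chart.\<close>

lemma chart_inverse:
  assumes "is_chart M (U, \<phi>)"
  shows "inj_on \<phi> U" "U \<subseteq> topspace M" "open (\<phi> ` U)"
    and "continuous_map (top_of_set (\<phi> ` U)) M (inv_into U \<phi>)"
proof -
  have hom: "homeomorphic_map (subtopology M U) (top_of_set (\<phi> ` U)) \<phi>"
    and U: "openin M U" and "open (\<phi> ` U)"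
    using assms by (auto simp: is_chart_def)
  then show UM: "U \<subseteq> topspace M" and "open (\<phi> ` U)" using openin_subset by auto
  then have top: "topspace (subtopology M U) = U" by auto
  show inj: "inj_on \<phi> U"
    using homeomorphic_imp_injective_map[OF hom] top by simp
  obtain g where g: "homeomorphic_maps (subtopology M U) (top_of_set (\<phi> ` U)) \<phi> g"
    using hom by (auto simp: homeomorphic_map_maps)
  then have cont: "continuous_map (top_of_set (\<phi> ` U)) M g" and gx: "\<And>x. x \<in> U \<Longrightarrow> g (\<phi> x) = x"
    using top by (auto simp: homeomorphic_maps_def dest: continuous_map_into_fulltopology)
  show "continuous_map (top_of_set (\<phi> ` U)) M (inv_into U \<phi>)"
    by (rule continuous_map_eq[OF cont]) (auto simp: inj gx)
qed

text \<open>The differential sends \<open>x\<close> to the combination of partial derivatives with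
  coefficients \<open>x\<close>, so its injectivity is their linear independence.\<close>

lemma adapted_frame_immersion:
  fixes f :: "real ^ 'n::finite \<Rightarrow> real ^ 'k::finite"
  assumes "CARD('k) = CARD('n) + 1" "f differentiable (at v)" "inj (frechet_derivative f (at v))"
    and "norm N = 1" "\<And>i. N \<bullet> pd i f v = 0"
  shows "adapted_frame (\<lambda>i. pd i f v) N"
proof
  have lin: "linear (frechet_derivative f (at v))"
    by (rule linear_frechet_derivative[OF assms(2)])
  fix x :: "real ^ 'n"
  assume "(\<Sum>i\<in>UNIV. x $ i *\<^sub>R pd i f v) = 0"
  moreover have "(\<Sum>i\<in>UNIV. x $ i *\<^sub>R pd i f v) = frechet_derivative f (at v) (\<Sum>i\<in>UNIV. x $ i *\<^sub>R axis i 1)"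
    by (simp add: linear_sum[OF lin] linear_cmul[OF lin] pd_def)
  moreover have "(\<Sum>i\<in>UNIV. x $ i *\<^sub>R axis i 1) = x"
    using basis_expansion[of x] by (simp add: scalar_mult_eq_scaleR)
  ultimately show "x = 0"
    using assms(3) linear_injective_0[OF lin] by simp
qed (use assms in auto)

(* In the sixth line of the second identity the factor is XX m n, the inner product of the mixed
   derivatives of X, as in the third term of the first identity. The printed source has Nt m * Nt n
   there, which is a misprint: with it the identity fails already for a circle of radius r(t). *)

theorem theorem7p3:
  fixes M :: "'m topology"
    and \<A> :: "('m, 'n::finite) chart set"
    and I :: "real set"
    and X \<nu> :: "'m \<Rightarrow> real \<Rightarrow> real ^ 'k::finite"
    and X0 X1 :: "'m \<Rightarrow> real ^ 'k"
    and c1 :: "real \<Rightarrow> real"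
  assumes dim: "CARD('k) = CARD('n) + 1"
    and manifold: "smooth_manifold M \<A>"
    and time: "is_interval I" "0 \<in> I" "I \<subseteq> {0..}" "I \<noteq> {0}"
    and family: "smooth_map_family \<A> I X"
    and immersions: "\<And>t. t \<in> I \<Longrightarrow> smooth_immersion \<A> (\<lambda>x. X x t)"
    and normal: "unit_normal_field M \<A> I X \<nu>"
    and c1: "continuous_on I c1" "bounded (c1 ` I)"
    and X0: "smooth_immersion \<A> X0"
    and X1: "smooth_map \<A> X1"
    and flow: "\<And>U \<phi> x t. (U, \<phi>) \<in> \<A> \<Longrightarrow> x \<in> U \<Longrightarrow> t \<in> I \<Longrightarrow>
      has_second_derivative (X x)
        (mean_curv (coord_rep (U, \<phi>) (\<lambda>y. X y t)) (coord_rep (U, \<phi>) (\<lambda>y. \<nu> y t)) (\<phi> x) *\<^sub>R \<nu> x t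
          + c1 t *\<^sub>R X x t) t I"
    and init: "\<And>x. x \<in> topspace M \<Longrightarrow> X x 0 = X0 x"
      "\<And>x. x \<in> topspace M \<Longrightarrow> (X x has_vector_derivative X1 x) (at 0 within I)"
  shows "\<forall>(U, \<phi>)\<in>\<A>. \<forall>x\<in>U. \<forall>t\<in>I.
    (let u = \<phi> x;
         Y = (\<lambda>s. coord_rep (U, \<phi>) (\<lambda>y. X y s));
         N = (\<lambda>s. coord_rep (U, \<phi>) (\<lambda>y. \<nu> y s));
         H = (\<lambda>s. mean_curv (Y s) (N s));
         A2 = (\<lambda>s. norm_A_sq (Y s) (N s));
         G = (\<lambda>i j. inv_form (Y t) u $ i $ j);
         h = (\<lambda>i j. second_form (Y t) (N t) u $ i $ j);
         gt = (\<lambda>i j. dt I (\<lambda>s. first_form (Y s) u $ i $ j) t);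
         ht = (\<lambda>i j. dt I (\<lambda>s. second_form (Y s) (N s) u $ i $ j) t);
         \<Gamma>t = (\<lambda>k i j. dt I (\<lambda>s. christoffel (Y s) k i j u) t);
         Xt = (\<lambda>k. dt I (\<lambda>s. pd k (Y s) u) t);
         XX = (\<lambda>k l. Xt k \<bullet> Xt l);
         Nt = (\<lambda>k. N t u \<bullet> Xt k)
     in has_second_derivative (\<lambda>s. H s u)
          ( laplace_form (Y t) (H t) u + H t u * A2 t u
          - 2 * (\<Sum>(i, j, k, l)\<in>UNIV. G i k * G j l * h i j * XX k l)
          + H t u * (\<Sum>(k, l)\<in>UNIV. G k l * Nt k * Nt l)
          - 2 * (\<Sum>(i, j, k)\<in>UNIV. G i j * \<Gamma>t k i j * Nt k)
          + 2 * (\<Sum>(i, j, k, l, p, q)\<in>UNIV. G i k * G j p * G l q * h i j * gt p q * gt k l)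
          - 2 * (\<Sum>(i, j, k, l)\<in>UNIV. G i k * G j l * gt k l * ht i j)
          - c1 t * H t u) t I
      \<and> has_second_derivative (\<lambda>s. A2 s u)
          ( laplace_form (Y t) (A2 t) u - 2 * norm_nabla_A_sq (Y t) (N t) u + 2 * (A2 t u)\<^sup>2
          + 2 * A2 t u * (\<Sum>(p, q)\<in>UNIV. G p q * Nt p * Nt q)
          + 2 * (\<Sum>(i, j, k, l)\<in>UNIV. G i j * G k l * ht i k * ht j l)
          - 8 * (\<Sum>(i, j, k, l, m, n)\<in>UNIV. G i m * G j n * G k l * h j l * gt m n * ht i k)
          - 4 * (\<Sum>(i, j, k, l, m, n)\<in>UNIV. G i m * G j n * G k l * h i k * h j l * XX m n)
          + 2 * (\<Sum>(i, j, k, l, m, n, p, q)\<in>UNIV. G i m * gt p q * gt m n * h i k * h j l *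
                  (2 * G j p * G n q * G k l + G j n * G k p * G l q))
          - 4 * (\<Sum>(i, j, k, l, p)\<in>UNIV. G i j * G k l * h j l * \<Gamma>t p i k * Nt p)
          - 2 * c1 t * A2 t u) t I)"
proof -
  \<comment> \<open>The claim is local: it suffices that each chart turns the flow into a
    \<open>flow_patch\<close> on the image of that chart.\<close>
  have patch: "flow_patch (\<phi> ` U) I (\<lambda>s. coord_rep (U, \<phi>) (\<lambda>y. X y s))
      (\<lambda>s. coord_rep (U, \<phi>) (\<lambda>y. \<nu> y s)) c1" if chart: "(U, \<phi>) \<in> \<A>" for U \<phi>
  proof -
  define W where "W = \<phi> ` U"
  define Y where "Y = (\<lambda>s. coord_rep (U, \<phi>) (\<lambda>y. X y s))"
  define N where "N = (\<lambda>s. coord_rep (U, \<phi>) (\<lambda>y. \<nu> y s))"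
  have "is_chart M (U, \<phi>)" using manifold chart by (auto simp: smooth_manifold_def)
  note inv = chart_inverse[OF this, folded W_def]
  have W: "inv_into U \<phi> v \<in> U" "\<phi> (inv_into U \<phi> v) = v" if "v \<in> W" for v
    using that by (auto simp: W_def inv_into_into f_inv_into_f)
  have N_cont: "continuous_map (prod_topology M (top_of_set I)) euclidean (\<lambda>(x, t). \<nu> x t)"
    using normal by (simp add: unit_normal_field_def)
  have "flow_patch W I Y N c1"
  proof (rule flow_patch.intro)
    show "open W" by (rule inv(3))
    show "convex I" using time(1) by (simp add: is_interval_convex)
    show "at t within I \<noteq> bot" if "t \<in> I" for t
      by (rule interval_nontrivial[OF time(1,2,4) that])
    show "smooth_family_on W I Y"
      using family chart by (auto simp: smooth_map_family_def W_def Y_def)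
  next
    fix t assume t: "t \<in> I"
    have "continuous_map (top_of_set W) (prod_topology M (top_of_set I)) (\<lambda>v. (inv_into U \<phi> v, t))"
      using inv(4) t by (simp add: continuous_map_pairwise o_def)
    from continuous_map_compose[OF this N_cont] show "continuous_on W (N t)"
      by (simp add: o_def N_def coord_rep_def)
  next
    fix v assume v: "v \<in> W"
    have "inv_into U \<phi> v \<in> topspace M" using W(1)[OF v] inv(2) by auto
    then have "continuous_map (top_of_set I) (prod_topology M (top_of_set I)) (\<lambda>t. (inv_into U \<phi> v, t))"
      by (simp add: continuous_map_pairwise o_def)
    from continuous_map_compose[OF this N_cont] show "continuous_on I (\<lambda>t. N t v)"
      by (simp add: o_def N_def coord_rep_def)
  next
    fix t v assume tv: "t \<in> I" "v \<in> W"
    show "adapted_frame (\<lambda>i. pd i (Y t) v) (N t v)"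
    proof (rule adapted_frame_immersion[OF dim])
      have "smooth_on W (Y t)"
        using family chart tv(1) by (auto simp: smooth_map_family_def smooth_family_on_def W_def Y_def)
      then have "kdiff 1 W (Y t)" by (rule smooth_on_imp_kdiff[OF inv(3)])
      then show "Y t differentiable (at v)" using tv by simp
      show "inj (frechet_derivative (Y t) (at v))"
        using immersions[OF tv(1)] chart tv(2) by (auto simp: smooth_immersion_def W_def Y_def)
      show "norm (N t v) = 1"
        using normal W(1)[OF tv(2)] inv(2) tv(1)
        by (auto simp: unit_normal_field_def N_def coord_rep_def)
      show "N t v \<bullet> pd i (Y t) v = 0" for i
      proof -
        \<comment> \<open>Orthogonality is given at points \<open>\<phi> x\<close>, so
          \<open>v\<close> is first written as the image of its preimage.\<close>
        have "\<nu> (inv_into U \<phi> v) t \<bullet> pd i (Y t) (\<phi> (inv_into U \<phi> v)) = 0"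
          using normal chart W(1)[OF tv(2)] tv(1) unfolding unit_normal_field_def Y_def by fast
        then show ?thesis by (simp add: W(2)[OF tv(2)] N_def coord_rep_def)
      qed
    qed
    show "has_second_derivative (\<lambda>s. Y s v)
        (mean_curv (Y t) (N t) v *\<^sub>R N t v + c1 t *\<^sub>R Y t v) t I"
      using flow[OF chart W(1)[OF tv(2)] tv(1)] W(2)[OF tv(2)]
      by (simp add: Y_def N_def coord_rep_def)
  qed
  then show ?thesis by (simp only: W_def Y_def N_def)
  qed
  show ?thesis
    unfolding Let_def
    by (intro ballI case_prodI2, rule flow_patch.curvature_evolution[OF patch]) auto
qed

end
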